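(* Assume the transition probability is stochastically continuous and has a periodic measure $\{\rho_s\}_{s\in\mathbb{R}}$ of period $\tau$, which is PS-mixing. Then the minimum period of the periodic measure is $\tilde\tau=\frac\tau k$, for certain $k\in\mathbb{N}\setminus\{0\}$, if and only if the infinitesimal generator $\mathcal L$ has simple eigenvalues $\{\frac{2lm\pi}{\tau}i\}_{m\in\mathbb{Z}}$, for some $l\in\mathbb{N}\setminus\{0\}$, and no other eigenvalues on the imaginary axis. The periodic measure has no positive minimum period if and only if $\mathcal L$ has simple eigenvalue $\{0\}$, and no other eigenvalues on the imaginary axis.
   Context: $\mathbb{X}$ is a Polish space with Borel $\sigma$-algebra $\mathcal B(\mathbb{X})$; $\mathbb{N}=\{0,1,2,\dots\}$. $\{P(t)\}_{t\ge0}$ is a Markovian semigroup given by transition probabilities $P(t,x,\cdot)$ on $\mathbb{X}$ satisfying Chapman–Kolmogorov, $P(t)\phi(x)=\int P(t,x,dy)\phi(y)$; stochastically continuous means $\lim_{t\to0}P(t,x,B(x,\gamma))=1$ for all $x\in\mathbb{X}$, $\gamma>0$. A map $\rho:\mathbb{R}\to\mathcal P(\mathbb{X})$ (Borel probability measures) is a periodic measure of period $\tau$ if $\rho_{s+\tau}=\rho_s$ and $\rho_{t+s}(B)=\int_{\mathbb{X}}P(t,x,B)\rho_s(dx)$ for all $s\in\mathbb{R}$, $t\ge0$, $B\in\mathcal B(\mathbb{X})$. The minimum period is the smallest $\tau>0$ for which this holds. Put $\bar\rho=\frac1\tau\int_0^\tau\rho_sds$ (an invariant measure of $\{P(t)\}$)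 and $L_s=\mathrm{supp}(\rho_s)$. Each $\rho_s$ is invariant for the discrete semigroup $\{P(k\tau)\}_{k\in\mathbb{N}}$ on $L_s$. For an invariant measure $\rho$ of a discrete semigroup $\{P(k\tau)\}_k$, let $P^\rho$ be the law on path space (times in $\tau\mathbb{Z}$) of the stationary Markov chain with these transition probabilities and marginals $\rho$, and $\theta^*_{k\tau}$ the time shift; $\rho$ is mixing if $\lim_{k\to\infty}P^\rho(\theta^*_{-k\tau}A\cap B)=P^\rho(A)P^\rho(B)$ for all measurable $A,B$. The periodic measure is PS-mixing if for each $s\in[0,\tau)$, $\rho_s$ is mixing for $\{P(k\tau)\}_{k\in\mathbb{N}}$ on $L_s$. $\mathcal L$ is the infinitesimal generator of $P(t)$ on (complex) $L^2(\mathbb{X},d\bar\rho)$: $\mathcal L\phi=\lim_{t\to0+}\frac{P(t)\phi-\phi}{t}$, with domain the $\phi$ for which the limit exists in $L^2(\mathbb{X},d\bar\rho)$. *)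

theory Defs
  imports "HOL-Probability.Probability"
begin

section \<open>Markovian semigroups and periodic measures\<close>

definition markov_semigroup :: "(real \<Rightarrow> 'a::polish_space \<Rightarrow> 'a measure) \<Rightarrow> bool" where
  "markov_semigroup P \<longleftrightarrow>
     (\<forall>t\<ge>0. P t \<in> borel \<rightarrow>\<^sub>M prob_algebra borel) \<and>
     (\<forall>x. P 0 x = return borel x) \<and>
     (\<forall>s\<ge>0. \<forall>t\<ge>0. \<forall>x. \<forall>B\<in>sets borel.
        emeasure (P (s + t) x) B = (\<integral>\<^sup>+y. emeasure (P t y) B \<partial>P s x))"

definition stochastically_continuous :: "(real \<Rightarrow> 'a::polish_space \<Rightarrow> 'a measure) \<Rightarrow> bool" where
  "stochastically_continuous P \<longleftrightarrow>
     (\<forall>x. \<forall>\<gamma>>0. ((\<lambda>t. measure (P t x) (ball x \<gamma>)) \<longlongrightarrow> 1) (at_right 0))"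

definition periodic_measure ::
    "(real \<Rightarrow> 'a::polish_space \<Rightarrow> 'a measure) \<Rightarrow> real \<Rightarrow> (real \<Rightarrow> 'a measure) \<Rightarrow> bool" where
  "periodic_measure P \<tau> \<rho> \<longleftrightarrow>
     0 < \<tau> \<and>
     (\<forall>s. \<rho> s \<in> space (prob_algebra borel)) \<and>
     (\<forall>s. \<rho> (s + \<tau>) = \<rho> s) \<and>
     (\<forall>s. \<forall>t\<ge>0. \<forall>B\<in>sets borel.
        emeasure (\<rho> (t + s)) B = (\<integral>\<^sup>+x. emeasure (P t x) B \<partial>\<rho> s))"

definition minimum_period ::
    "(real \<Rightarrow> 'a::polish_space \<Rightarrow> 'a measure) \<Rightarrow> (real \<Rightarrow> 'a measure) \<Rightarrow> real \<Rightarrow> bool" where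
  "minimum_period P \<rho> \<sigma> \<longleftrightarrow>
     periodic_measure P \<sigma> \<rho> \<and> (\<forall>\<sigma>'. periodic_measure P \<sigma>' \<rho> \<longrightarrow> \<sigma> \<le> \<sigma>')"

text \<open>
  The Giry bind of the uniform distribution on \<open>[0, \<tau>]\<close> with \<open>\<rho>\<close> is the mixture
  \<open>(1/\<tau>) \<integral> \<rho> s ds\<close>. It is meaningful when \<open>s \<mapsto> \<rho> s B\<close> is measurable, which is the case
  for periodic measures of stochastically continuous semigroups, as \<open>s \<mapsto> \<integral> f d(\<rho> s)\<close> is then
  right-continuous for bounded continuous \<open>f\<close>.
\<close>

definition average_measure :: "real \<Rightarrow> (real \<Rightarrow> 'a::polish_space measure) \<Rightarrow> 'a measure" where
  "average_measure \<tau> \<rho> = uniform_measure lborel {0..\<tau>} \<bind> \<rho>"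

definition measure_support :: "'a::topological_space measure \<Rightarrow> 'a set" where
  "measure_support \<mu> = {x. \<forall>U. open U \<and> x \<in> U \<longrightarrow> emeasure \<mu> U > 0}"


section \<open>Stationary chains and mixing\<close>

text \<open>
  \<open>cylinder_prob K [A\<^sub>0, \<dots>, A\<^sub>n] \<mu>\<close> is the probability that the chain with one-step kernel \<open>K\<close>
  and initial law \<open>\<mu>\<close> visits \<open>A\<^sub>0, \<dots>, A\<^sub>n\<close> at times \<open>0, \<dots>, n\<close>.
\<close>

primrec cylinder_prob ::
    "('a \<Rightarrow> 'a measure) \<Rightarrow> 'a set list \<Rightarrow> 'a measure \<Rightarrow> ennreal" where
  "cylinder_prob K [] \<mu> = 1"
| "cylinder_prob K (A # As) \<mu> = (\<integral>\<^sup>+x\<in>A. cylinder_prob K As (K x) \<partial>\<mu>)"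

text \<open>
  \<open>Q\<close> is the law, on two-sided paths in \<open>S\<close>, of the stationary chain with one-step kernel \<open>K\<close>
  and marginals \<open>\<mu>\<close>. For \<open>K = P \<tau>\<close>, the integer time \<open>n\<close> stands for the time \<open>n\<tau>\<close>; the
  transition over a gap \<open>k\<close> is then \<open>P (k\<tau>)\<close> by Chapman--Kolmogorov.
\<close>

definition stationary_chain_law ::
    "'a::polish_space set \<Rightarrow> ('a \<Rightarrow> 'a measure) \<Rightarrow> 'a measure \<Rightarrow> (int \<Rightarrow> 'a) measure \<Rightarrow> bool" where
  "stationary_chain_law S K \<mu> Q \<longleftrightarrow>
     sets Q = sets (\<Pi>\<^sub>M n\<in>(UNIV::int set). restrict_space borel S) \<and>
     (\<forall>m As. set As \<subseteq> sets (restrict_space borel S) \<longrightarrow>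
        emeasure Q {\<omega> \<in> space Q. \<forall>i<length As. \<omega> (m + int i) \<in> As ! i} = cylinder_prob K As \<mu>)"

definition path_shift :: "int \<Rightarrow> (int \<Rightarrow> 'a) \<Rightarrow> (int \<Rightarrow> 'a)" where
  "path_shift k \<omega> = (\<lambda>n. \<omega> (n + k))"

text \<open>
  The existential quantifier only names the path law: it is unique, since its values on
  cylinders are prescribed, and for \<open>\<mu>\<close> invariant and concentrated on \<open>S\<close> it exists by
  Kolmogorov's extension theorem.
\<close>

definition mixing_on ::
    "'a::polish_space set \<Rightarrow> ('a \<Rightarrow> 'a measure) \<Rightarrow> 'a measure \<Rightarrow> bool" where
  "mixing_on S K \<mu> \<longleftrightarrow>
     (\<exists>Q. stationary_chain_law S K \<mu> Q \<and>
        (\<forall>A\<in>sets Q. \<forall>B\<in>sets Q.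
           (\<lambda>k. measure Q (path_shift (- int k) ` A \<inter> B)) \<longlonglongrightarrow> measure Q A * measure Q B))"

definition PS_mixing ::
    "(real \<Rightarrow> 'a::polish_space \<Rightarrow> 'a measure) \<Rightarrow> real \<Rightarrow> (real \<Rightarrow> 'a measure) \<Rightarrow> bool" where
  "PS_mixing P \<tau> \<rho> \<longleftrightarrow> (\<forall>s\<in>{0..<\<tau>}. mixing_on (measure_support (\<rho> s)) (P \<tau>) (\<rho> s))"


section \<open>The generator on complex square-integrable functions\<close>

text \<open>
  Elements of \<open>L\<^sup>2(\<mu>)\<close> are handled through representatives, so equality in \<open>L\<^sup>2(\<mu>)\<close> is equality
  \<open>\<mu>\<close>-almost everywhere. When \<open>\<mu>\<close> is invariant, \<open>transition_op P t\<close> respects this equality.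
\<close>

definition L2_normsq :: "'a measure \<Rightarrow> ('a \<Rightarrow> complex) \<Rightarrow> ennreal" where
  "L2_normsq \<mu> \<phi> = (\<integral>\<^sup>+x. ennreal ((cmod (\<phi> x))\<^sup>2) \<partial>\<mu>)"

definition L2_fun :: "'a measure \<Rightarrow> ('a \<Rightarrow> complex) set" where
  "L2_fun \<mu> = {\<phi> \<in> borel_measurable \<mu>. L2_normsq \<mu> \<phi> < \<infinity>}"

definition transition_op ::
    "(real \<Rightarrow> 'a \<Rightarrow> 'a measure) \<Rightarrow> real \<Rightarrow> ('a \<Rightarrow> complex) \<Rightarrow> 'a \<Rightarrow> complex" where
  "transition_op P t \<phi> x = (\<integral>y. \<phi> y \<partial>P t x)"

text \<open>\<open>generator P \<mu> \<phi> \<psi>\<close>: \<open>\<phi>\<close> is in the domain of the generator, which maps it to \<open>\<psi>\<close>.\<close>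

definition generator ::
    "(real \<Rightarrow> 'a \<Rightarrow> 'a measure) \<Rightarrow> 'a measure \<Rightarrow> ('a \<Rightarrow> complex) \<Rightarrow> ('a \<Rightarrow> complex) \<Rightarrow> bool" where
  "generator P \<mu> \<phi> \<psi> \<longleftrightarrow>
     \<phi> \<in> L2_fun \<mu> \<and> \<psi> \<in> L2_fun \<mu> \<and>
     ((\<lambda>t. L2_normsq \<mu> (\<lambda>x. (transition_op P t \<phi> x - \<phi> x) / of_real t - \<psi> x)) \<longlongrightarrow> 0) (at_right 0)"

definition eigenfunction ::
    "(real \<Rightarrow> 'a \<Rightarrow> 'a measure) \<Rightarrow> 'a measure \<Rightarrow> complex \<Rightarrow> ('a \<Rightarrow> complex) \<Rightarrow> bool" where
  "eigenfunction P \<mu> z \<phi> \<longleftrightarrow> generator P \<mu> \<phi> (\<lambda>x. z * \<phi> x) \<and> \<not> (AE x in \<mu>. \<phi> x = 0)"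

definition eigenvalue ::
    "(real \<Rightarrow> 'a \<Rightarrow> 'a measure) \<Rightarrow> 'a measure \<Rightarrow> complex \<Rightarrow> bool" where
  "eigenvalue P \<mu> z \<longleftrightarrow> (\<exists>\<phi>. eigenfunction P \<mu> z \<phi>)"

text \<open>Simple means that the eigenspace, as a subspace of \<open>L\<^sup>2(\<mu>)\<close>, is one-dimensional.\<close>

definition simple_eigenvalue ::
    "(real \<Rightarrow> 'a \<Rightarrow> 'a measure) \<Rightarrow> 'a measure \<Rightarrow> complex \<Rightarrow> bool" where
  "simple_eigenvalue P \<mu> z \<longleftrightarrow>
     (\<exists>\<phi>. eigenfunction P \<mu> z \<phi> \<and>
        (\<forall>\<psi>. eigenfunction P \<mu> z \<psi> \<longrightarrow> (\<exists>c. AE x in \<mu>. \<psi> x = c * \<phi> x)))"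

end

theory Submission
  imports Defs
begin

text \<open>
  An eigenfunction \<open>\<phi>\<close> for an imaginary eigenvalue \<open>i \<lambda>\<close> satisfies \<open>P(t) \<phi> = exp (i \<lambda> t) \<phi>\<close>. Mixing
  of \<open>\<rho> s\<close> under \<open>P(\<tau>)\<close> then forces \<open>\<lambda> \<tau> \<in> 2\<pi>\<int>\<close> and \<open>\<phi> = C exp (i \<lambda> s)\<close> almost everywhere for
  \<open>\<rho> s\<close>, with \<open>C\<close> independent of \<open>s\<close>. Hence all imaginary eigenvalues are simple, they form a
  group \<open>\<Lambda>\<close>, and \<open>exp (i \<lambda> \<sigma>) = 1\<close> for every \<open>\<lambda> \<in> \<Lambda>\<close> and every period \<open>\<sigma>\<close> of \<open>\<rho>\<close>.

  Conversely, if \<open>s \<mapsto> \<integral> f d(\<rho> s)\<close> has a nonzero Fourier coefficient at \<open>\<lambda>\<close>, the ergodic averages of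
  \<open>exp (- i \<lambda> t) P(t) f\<close> converge to an eigenfunction, so \<open>\<lambda> \<in> \<Lambda>\<close>. By uniqueness of Fourier
  coefficients every \<open>\<sigma>\<close> annihilated by \<open>\<Lambda>\<close> is a period. Thus \<open>\<Lambda>\<close> and the group of periods of \<open>\<rho>\<close>
  are annihilators of each other, and one is infinite cyclic exactly when the other is.
\<close>

text \<open>The generator sees \<open>\<rho>bar\<close> only up to null sets, so it controls almost
  every phase s, whereas a period must work at every s. Right-continuity of the integrals of bounded
  continuous functions against \<open>\<rho> s\<close> closes this gap. It comes from stochastic
  continuity, is one-sided because the semigroup only moves forward, and also provides the joint
  measurability in time and state. Producing an eigenfunction meets the reverse difficulty: the mean
  ergodic theorem acts in each L2 (\<open>\<rho> s\<close>) separately, while one function on the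
  state space has to serve almost all s. Averaging the errors over s and taking a fast subsequence
  provides it. Mixing is a statement about path laws on the support. Two-time events turn it into
  decorrelation of sets, and density arguments extend this to integrable functions, once in the
  evolved slot (for eigenfunctions) and once in the test slot (for autocorrelations). The link
  between periods and eigenvalues is finally arithmetic: the admissible frequencies form a subgroup
  of the integers, which is trivial or generated by its least positive element.\<close>

section \<open>Integration against kernels\<close>

text \<open>\<open>Q\<close> need not be measurable: its exceptional set is enclosed in a measurable
  null set, and the Fubini-type statement is applied to the complement of that set.\<close>

lemma AE_bindD:
  assumes K: "K \<in> M \<rightarrow>\<^sub>M subprob_algebra N" and M: "space M \<noteq> {}" and Q: "AE y in M \<bind> K. Q y"
  shows "AE x in M. AE y in K x. Q y"
proof -
  have sets: "sets (M \<bind> K) = sets N"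
    by (rule sets_bind_measurable[OF K M])
  obtain Z where Z: "Z \<in> null_sets (M \<bind> K)" "{y \<in> space (M \<bind> K). \<not> Q y} \<subseteq> Z"
    using Q by (auto simp: eventually_ae_filter)
  have [measurable]: "Z \<in> sets N"
    using Z(1) sets by auto
  have "AE y in M \<bind> K. y \<notin> Z"
    using Z(1) by (rule AE_not_in)
  then have "AE x in M. AE y in K x. y \<notin> Z"
    using AE_bind[OF K, of "\<lambda>y. y \<notin> Z"] by simp
  then show ?thesis
    using AE_space
  proof eventually_elim
    case (elim x)
    have "space (K x) = space (M \<bind> K)"
      using sets_kernel[OF K elim(2)] sets by (intro sets_eq_imp_space_eq) simp
    with elim(1) Z(2) show ?case
      by (auto elim!: AE_mp)
  qed
qed

text \<open>Tonelli for the norm makes the inner integrals finite off a null set of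
  \<open>x\<close>. On that null set the Bochner integral takes a default value, which does not
  affect the outer integral.\<close>

lemma integrable_bind:
  fixes f :: "'b \<Rightarrow> 'c::{banach, second_countable_topology}"
  assumes M: "prob_space M" and K: "K \<in> M \<rightarrow>\<^sub>M prob_algebra N" and f: "integrable (M \<bind> K) f"
  shows "AE x in M. integrable (K x) f" and "integrable M (\<lambda>x. \<integral>y. f y \<partial>K x)"
    and "(\<integral>x. (\<integral>y. norm (f y) \<partial>K x) \<partial>M) = (\<integral>y. norm (f y) \<partial>(M \<bind> K))"
    and "integrable M (\<lambda>x. \<integral>y. norm (f y) \<partial>K x)"
proof -
  interpret M: prob_space M by fact
  note K' = measurable_prob_algebraD[OF K]
  have ne: "space M \<noteq> {}" by (rule M.not_empty)
  have sets: "sets (M \<bind> K) = sets N"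
    by (rule sets_bind_measurable[OF K' ne])
  have [measurable]: "f \<in> borel_measurable N"
    using borel_measurable_integrable[OF f] by (simp add: measurable_cong_sets[OF sets refl])
  note [measurable] = K'
  have meas: "f \<in> borel_measurable (K x)" if "x \<in> space M" for x
    using sets_kernel[OF K' that] by (simp cong: measurable_cong_sets)
  have fin: "(\<integral>\<^sup>+x. \<integral>\<^sup>+y. norm (f y) \<partial>K x \<partial>M) < \<infinity>"
    using f by (simp add: integrable_iff_bounded nn_integral_bind[OF _ K'])
  have "AE x in M. (\<integral>\<^sup>+y. norm (f y) \<partial>K x) \<noteq> \<infinity>"
    using fin by (intro nn_integral_PInf_AE) auto
  then show *: "AE x in M. integrable (K x) f"
    by (rule AE_mp) (auto intro!: AE_I2 integrableI_bounded meas simp: top.not_eq_extremum)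
  have ae: "AE x in M. ennreal (\<integral>y. norm (f y) \<partial>K x) = (\<integral>\<^sup>+y. norm (f y) \<partial>K x)"
    using * by (rule AE_mp) (auto intro!: AE_I2 nn_integral_eq_integral[symmetric])
  have eq: "(\<integral>\<^sup>+x. ennreal (\<integral>y. norm (f y) \<partial>K x) \<partial>M) = (\<integral>\<^sup>+x. \<integral>\<^sup>+y. norm (f y) \<partial>K x \<partial>M)"
    using ae by (rule nn_integral_cong_AE)
  show i: "integrable M (\<lambda>x. \<integral>y. norm (f y) \<partial>K x)"
    using fin eq by (intro integrableI_bounded) auto
  show "integrable M (\<lambda>x. \<integral>y. f y \<partial>K x)"
  proof (rule Bochner_Integration.integrable_bound[OF i])
    show "AE x in M. norm (\<integral>y. f y \<partial>K x) \<le> norm (\<integral>y. norm (f y) \<partial>K x)"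
      by (intro AE_I2) (simp add: integral_norm_bound)
  qed simp
  have "ennreal (\<integral>x. (\<integral>y. norm (f y) \<partial>K x) \<partial>M) = ennreal (\<integral>y. norm (f y) \<partial>(M \<bind> K))"
    using eq i f by (simp add: nn_integral_eq_integral[symmetric] nn_integral_bind[OF _ K'])
  then show "(\<integral>x. (\<integral>y. norm (f y) \<partial>K x) \<partial>M) = (\<integral>y. norm (f y) \<partial>(M \<bind> K))"
    by (simp add: integral_nonneg_AE)
qed

text \<open>Fubini for kernels, built from indicators through sums and dominated limits. Additivity
  of the inner integral is available only almost everywhere, since \<open>f\<close> and
  \<open>g\<close> need not be integrable for every \<open>K x\<close>.\<close>

lemma integral_bind:
  fixes f :: "'b \<Rightarrow> 'c::{banach, second_countable_topology}"
  assumes M: "prob_space M" and K: "K \<in> M \<rightarrow>\<^sub>M prob_algebra N" and f: "integrable (M \<bind> K) f"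
  shows "(\<integral>y. f y \<partial>(M \<bind> K)) = (\<integral>x. (\<integral>y. f y \<partial>K x) \<partial>M)"
  using f
proof (induction rule: integrable_induct)
  case (base A c)
  interpret M: prob_space M by fact
  note K' = measurable_prob_algebraD[OF K]
  note [measurable] = K'
  have A: "A \<in> sets N"
    using base sets_bind_measurable[OF K' M.not_empty] by simp
  have "(\<integral>x. measure (K x) A *\<^sub>R c \<partial>M) = (\<integral>x. measure (K x) A \<partial>M) *\<^sub>R c"
    using A
    by (intro integral_scaleR_left M.integrable_const_bound[where B=1] AE_I2)
       (auto intro!: subprob_space.subprob_measure_le_1 subprob_space_kernel[OF K'])
  also have "(\<integral>x. measure (K x) A \<partial>M) = measure (M \<bind> K) A"
    using M.measure_bind[OF K' A] by simp
  finally have eq: "(\<integral>x. measure (K x) A *\<^sub>R c \<partial>M) = measure (M \<bind> K) A *\<^sub>R c" .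
  have "(\<integral>y. indicator A y *\<^sub>R c \<partial>K x) = measure (K x) A *\<^sub>R c" if "x \<in> space M" for x
    using A sets_kernel[OF K' that]
      subprob_space.emeasure_subprob_space_less_top[OF subprob_space_kernel[OF K' that], of A]
    by (subst integral_scaleR_left) (auto simp: integrable_indicator_iff top.not_eq_extremum)
  then have "(\<integral>x. (\<integral>y. indicator A y *\<^sub>R c \<partial>K x) \<partial>M) = (\<integral>x. measure (K x) A *\<^sub>R c \<partial>M)"
    by (rule Bochner_Integration.integral_cong[OF refl])
  with eq base show ?case
    by (subst integral_scaleR_left) (auto simp: integrable_indicator_iff)
next
  case (add f g)
  have "AE x in M. (\<integral>y. f y + g y \<partial>K x) = (\<integral>y. f y \<partial>K x) + (\<integral>y. g y \<partial>K x)"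
    using integrable_bind(1)[OF M K add.hyps(1)] integrable_bind(1)[OF M K add.hyps(2)] by eventually_elim simp
  then have "(\<integral>x. (\<integral>y. f y + g y \<partial>K x) \<partial>M) = (\<integral>x. (\<integral>y. f y \<partial>K x) + (\<integral>y. g y \<partial>K x) \<partial>M)"
    using integrable_bind(2)[OF M K add.hyps(1)] integrable_bind(2)[OF M K add.hyps(2)]
      integrable_bind(2)[OF M K Bochner_Integration.integrable_add[OF add.hyps(1,2)]]
    by (intro integral_cong_AE) auto
  with add integrable_bind(2)[OF M K add.hyps(1)] integrable_bind(2)[OF M K add.hyps(2)]
  show ?case by simp
next
  case (lim f s)
  interpret M: prob_space M by fact
  note K' = measurable_prob_algebraD[OF K]
  have sets: "sets (M \<bind> K) = sets N"
    by (rule sets_bind_measurable[OF K' M.not_empty])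
  have [measurable]: "f \<in> borel_measurable N" "\<And>i. s i \<in> borel_measurable N"
    using lim.hyps(1,4)[THEN borel_measurable_integrable] by (simp_all add: measurable_cong_sets[OF sets refl])
  have sp: "space (K x) = space (M \<bind> K)" if "x \<in> space M" for x
    using sets_kernel[OF K' that] sets by (intro sets_eq_imp_space_eq) simp
  have si: "integrable (K x) (s i)" if "integrable (K x) f" "x \<in> space M" for x i
  proof (rule Bochner_Integration.integrable_bound)
    \<comment> \<open>The factor 2 is the bound on the approximating simple functions that the
      induction rule supplies.\<close>
    show "integrable (K x) (\<lambda>y. 2 * norm (f y))"
      using that by simp
    show "s i \<in> borel_measurable (K x)"
      by (simp add: measurable_cong_sets[OF sets_kernel[OF K' that(2)] refl])
    show "AE y in K x. norm (s i y) \<le> norm (2 * norm (f y))"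
      using lim.hyps(3) sp[OF that(2)] by (auto intro!: AE_I2)
  qed
  have "(\<lambda>i. \<integral>x. (\<integral>y. s i y \<partial>K x) \<partial>M) \<longlonglongrightarrow> (\<integral>x. (\<integral>y. f y \<partial>K x) \<partial>M)"
  proof (rule integral_dominated_convergence)
    show "integrable M (\<lambda>x. 2 * (\<integral>y. norm (f y) \<partial>K x))"
      using integrable_bind(4)[OF M K lim.hyps(4)] by simp
    show "(\<lambda>x. \<integral>y. f y \<partial>K x) \<in> borel_measurable M"
      "\<And>i. (\<lambda>x. \<integral>y. s i y \<partial>K x) \<in> borel_measurable M"
      using integrable_bind(2)[OF M K lim.hyps(4)] integrable_bind(2)[OF M K lim.hyps(1)] by auto
    show "AE x in M. (\<lambda>i. \<integral>y. s i y \<partial>K x) \<longlonglongrightarrow> (\<integral>y. f y \<partial>K x)"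
      using integrable_bind(1)[OF M K lim.hyps(4)] AE_space
    proof eventually_elim
      case (elim x)
      then have "f \<in> borel_measurable (K x)" "\<And>i. s i \<in> borel_measurable (K x)"
        using sets_kernel[OF K' elim(2)] by (auto cong: measurable_cong_sets)
      with elim lim.hyps sp[OF elim(2)] show ?case
        by (intro integral_dominated_convergence[where w="\<lambda>y. 2 * norm (f y)"] AE_I2) auto
    qed
    show "AE x in M. norm (\<integral>y. s i y \<partial>K x) \<le> 2 * (\<integral>y. norm (f y) \<partial>K x)" for i
      using integrable_bind(1)[OF M K lim.hyps(4)] AE_space
    proof eventually_elim
      case (elim x)
      have "norm (\<integral>y. s i y \<partial>K x) \<le> (\<integral>y. 2 * norm (f y) \<partial>K x)"
        using si[OF elim] elim(1) lim.hyps(3) sp[OF elim(2)]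
        by (intro order_trans[OF integral_norm_bound] integral_mono) auto
      then show ?case by simp
    qed
  qed
  moreover have "(\<lambda>i. \<integral>y. s i y \<partial>(M \<bind> K)) \<longlonglongrightarrow> (\<integral>y. f y \<partial>(M \<bind> K))"
    using lim.hyps by (intro integral_dominated_convergence[where w="\<lambda>y. 2 * norm (f y)"] AE_I2) auto
  ultimately show ?case
    using lim.IH LIMSEQ_unique by auto
qed

section \<open>Square-integrable complex functions on a probability space\<close>

lemma (in prob_space) integrable_square_cmod:
  fixes f :: "'a \<Rightarrow> complex"
  assumes [measurable]: "f \<in> borel_measurable M" and fin: "(\<integral>\<^sup>+x. ennreal ((cmod (f x))\<^sup>2) \<partial>M) < \<infinity>"
  shows "integrable M f"
proof -
  have sq: "integrable M (\<lambda>x. (cmod (f x))\<^sup>2)"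
    using fin by (intro integrableI_bounded) auto
  have bd: "cmod (f x) \<le> 1 + (cmod (f x))\<^sup>2" for x
    using zero_le_power2[of "cmod (f x) - 1"] by (simp add: power2_diff) (smt (verit) zero_le_power2 norm_ge_zero)
  show f: "integrable M f"
    by (rule Bochner_Integration.integrable_bound[where f="\<lambda>x. 1 + (cmod (f x))\<^sup>2"])
       (use sq bd in \<open>auto intro!: AE_I2\<close>)
qed

text \<open>The variance of \<open>f\<close> about its mean is nonnegative. Applied under each
  transition kernel, this makes the transition operators contractions of L2.\<close>

lemma (in prob_space) cmod_integral_squared_le:
  fixes f :: "'a \<Rightarrow> complex"
  assumes [measurable]: "f \<in> borel_measurable M"
  shows "ennreal ((cmod (\<integral>x. f x \<partial>M))\<^sup>2) \<le> (\<integral>\<^sup>+x. ennreal ((cmod (f x))\<^sup>2) \<partial>M)"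
proof (cases "(\<integral>\<^sup>+x. ennreal ((cmod (f x))\<^sup>2) \<partial>M) = \<infinity>")
  case False
  define m where "m = (\<integral>x. f x \<partial>M)"
  have fin: "(\<integral>\<^sup>+x. ennreal ((cmod (f x))\<^sup>2) \<partial>M) < \<infinity>"
    using False by (simp add: top.not_eq_extremum)
  then have sq: "integrable M (\<lambda>x. (cmod (f x))\<^sup>2)"
    by (intro integrableI_bounded) auto
  have f: "integrable M f"
    using fin by (intro integrable_square_cmod) auto
  have "0 \<le> (\<integral>x. (cmod (f x - m))\<^sup>2 \<partial>M)"
    by simp
  also have "(\<lambda>x. (cmod (f x - m))\<^sup>2) = (\<lambda>x. (cmod (f x))\<^sup>2 - 2 * Re (f x * cnj m) + (cmod m)\<^sup>2)"
    unfolding cmod_power2 by (simp add: fun_eq_iff power2_eq_square algebra_simps)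
  also have "(\<integral>x. (cmod (f x))\<^sup>2 - 2 * Re (f x * cnj m) + (cmod m)\<^sup>2 \<partial>M)
    = (\<integral>x. (cmod (f x))\<^sup>2 \<partial>M) - 2 * Re (m * cnj m) + (cmod m)\<^sup>2"
    using sq f by (simp add: m_def prob_space)
  also have "Re (m * cnj m) = (cmod m)\<^sup>2"
    by (simp only: cmod_power2) (simp add: power2_eq_square)
  finally have "(cmod m)\<^sup>2 \<le> (\<integral>x. (cmod (f x))\<^sup>2 \<partial>M)"
    by simp
  then show ?thesis
    unfolding m_def using sq by (subst nn_integral_eq_integral) auto
qed simp

section \<open>Right-continuous families of measures\<close>

text \<open>Time is approximated from the right by a variable with countably many values, for which
  joint measurability reduces to measurability at each fixed time.\<close>

lemma right_continuous_measurable: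
  fixes f :: "real \<Rightarrow> 'x \<Rightarrow> 'b::metric_space"
  assumes meas: "\<And>t. f t \<in> borel_measurable M"
    and cont: "\<And>x a. x \<in> space M \<Longrightarrow> ((\<lambda>t. f t x) \<longlongrightarrow> f a x) (at_right a)"
  shows "(\<lambda>(t, x). f t x) \<in> borel_measurable (borel \<Otimes>\<^sub>M M)"
proof (rule borel_measurable_LIMSEQ_metric)
  \<comment> \<open>The next point of the grid of mesh 1 / (n + 1) strictly to the right of
    \<open>t\<close>; strictness is what a limit along \<open>at_right\<close> needs.\<close>
  define X where "X n t = (of_int \<lfloor>real (Suc n) * t\<rfloor> + 1) / real (Suc n)" for n and t :: real
  show "(\<lambda>p. f (X n (fst p)) (snd p)) \<in> borel_measurable (borel \<Otimes>\<^sub>M M)" for n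
    unfolding X_def
    by (rule measurable_compose_countable[where f="\<lambda>i p. f ((of_int i + 1) / real (Suc n)) (snd p)"
          and g="\<lambda>p. \<lfloor>real (Suc n) * fst p\<rfloor>"])
       (auto intro!: measurable_compose[OF _ meas])
  fix p :: "real \<times> 'x" assume p: "p \<in> space (borel \<Otimes>\<^sub>M M)"
  obtain t x where tx: "p = (t, x)" by force
  have X1: "t < X n t" and X2: "X n t \<le> t + 1 / real (Suc n)" for n
  proof -
    have "real (Suc n) * t < of_int \<lfloor>real (Suc n) * t\<rfloor> + 1"
      by linarith
    then show "t < X n t"
      unfolding X_def by (subst pos_less_divide_eq) (auto simp: mult.commute)
    have "of_int \<lfloor>real (Suc n) * t\<rfloor> + 1 \<le> real (Suc n) * t + 1"
      by linarith
    then have "X n t \<le> (real (Suc n) * t + 1) / real (Suc n)"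
      unfolding X_def by (intro divide_right_mono) auto
    then show "X n t \<le> t + 1 / real (Suc n)"
      by (simp add: add_divide_distrib del: of_nat_Suc)
  qed
  have "(\<lambda>n. X n t) \<longlonglongrightarrow> t"
  proof (rule tendsto_sandwich)
    show "\<forall>\<^sub>F n in sequentially. t \<le> X n t" "\<forall>\<^sub>F n in sequentially. X n t \<le> t + 1 / real (Suc n)"
      using X1 X2 by (auto intro: always_eventually less_imp_le)
    show "(\<lambda>n. t + 1 / real (Suc n)) \<longlonglongrightarrow> t"
      using tendsto_add[OF tendsto_const[of t] LIMSEQ_inverse_real_of_nat] by (simp add: inverse_eq_divide)
  qed simp
  then have "filterlim (\<lambda>n. X n t) (at_right t) sequentially"
    using X1 by (auto simp: filterlim_at less_imp_neq[symmetric])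
  from filterlim_compose[OF cont this, of x] p
  show "(\<lambda>n. f (X n (fst p)) (snd p)) \<longlonglongrightarrow> (case p of (t, x) \<Rightarrow> f t x)"
    by (simp add: tx space_pair_measure)
qed

section \<open>Closed sets tested by continuous functions\<close>

definition closed_approx :: "'a::metric_space set \<Rightarrow> nat \<Rightarrow> 'a \<Rightarrow> real" where
  "closed_approx C n x = max 0 (1 - real n * infdist x C)"

lemma closed_approx:
  "continuous_on UNIV (closed_approx C n)" "\<bar>closed_approx C n x\<bar> \<le> 1"
  unfolding closed_approx_def
  by (intro continuous_intros) (auto simp: infdist_nonneg)

text \<open>Off a closed set the distance to it is positive, so a steep enough slope
  \<open>n\<close> pushes the value to 0. For empty \<open>C\<close>, \<open>infdist\<close> is 0
  and the functions would be constantly 1, hence the hypothesis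
  \<open>C \<noteq> {}\<close>.\<close>

lemma closed_approx_LIMSEQ:
  assumes "closed C" "C \<noteq> {}"
  shows "(\<lambda>n. closed_approx C n x) \<longlonglongrightarrow> indicator C x"
proof (cases "x \<in> C")
  case True
  then show ?thesis
    by (simp add: closed_approx_def)
next
  case False
  then have pos: "0 < infdist x C"
    using infdist_pos_not_in_closed[OF assms] by simp
  obtain N :: nat where N: "1 / infdist x C < real N"
    using reals_Archimedean2 by blast
  have "closed_approx C n x = 0" if "N \<le> n" for n
  proof -
    have "1 < real N * infdist x C"
      using N pos by (simp add: field_simps)
    also have "\<dots> \<le> real n * infdist x C"
      using that pos by (intro mult_right_mono) auto
    finally show ?thesis
      by (simp add: closed_approx_def)
  qed
  then have "\<forall>\<^sub>F n in sequentially. closed_approx C n x = indicator C x"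
    using False by (auto simp: eventually_sequentially)
  then show ?thesis
    by (rule tendsto_eventually)
qed

lemma measure_closed_LIMSEQ:
  fixes \<mu> :: "'a::metric_space measure"
  assumes \<mu>: "\<mu> \<in> space (prob_algebra borel)" and C: "closed C" "C \<noteq> {}"
  shows "(\<lambda>n. \<integral>x. closed_approx C n x \<partial>\<mu>) \<longlonglongrightarrow> measure \<mu> C"
proof -
  interpret prob_space \<mu>
    using \<mu> by (simp add: space_prob_algebra)
  have sets: "sets \<mu> = sets borel"
    using \<mu> by (simp add: space_prob_algebra)
  have [measurable]: "closed_approx C n \<in> borel_measurable \<mu>" for n
    using borel_measurable_continuous_onI[OF closed_approx(1)] by (simp add: measurable_cong_sets[OF sets refl])
  have [measurable]: "C \<in> sets \<mu>"
    using C by (simp add: sets)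
  have "(\<lambda>n. \<integral>x. closed_approx C n x \<partial>\<mu>) \<longlonglongrightarrow> (\<integral>x. indicator C x \<partial>\<mu>)"
    by (rule integral_dominated_convergence[where w="\<lambda>_. 1"])
       (auto intro!: AE_I2 closed_approx_LIMSEQ C closed_approx)
  then show ?thesis
    by (simp add: sets_eq_imp_space_eq[OF sets])
qed

lemma borel_eq_sigma_closed: "sets (borel :: 'a::topological_space measure) = sigma_sets UNIV (Collect closed)"
  by (subst borel_eq_closed) simp

lemma Int_stable_closed: "Int_stable (Collect closed)"
  by (auto simp: Int_stable_def)

text \<open>Closed sets form an intersection-stable generator, and the mass of a closed set is a
  limit of integrals of \<open>closed_approx\<close>. These functions are bounded by 1, so test
  functions with that bound suffice.\<close>

lemma prob_algebra_eqI_continuous: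
  fixes \<mu> \<nu> :: "'a::metric_space measure"
  assumes \<mu>: "\<mu> \<in> space (prob_algebra borel)" and \<nu>: "\<nu> \<in> space (prob_algebra borel)"
    and eq: "\<And>f :: 'a \<Rightarrow> real. continuous_on UNIV f \<Longrightarrow> (\<And>x. \<bar>f x\<bar> \<le> 1) \<Longrightarrow> (\<integral>x. f x \<partial>\<mu>) = (\<integral>x. f x \<partial>\<nu>)"
  shows "\<mu> = \<nu>"
proof (rule measure_eqI_generator_eq[OF Int_stable_closed, where \<Omega>=UNIV and A="\<lambda>_. UNIV"])
  show "sets \<mu> = sigma_sets UNIV (Collect closed)" "sets \<nu> = sigma_sets UNIV (Collect closed)"
    using \<mu> \<nu> by (simp_all add: space_prob_algebra borel_eq_sigma_closed)
  interpret \<mu>: prob_space \<mu>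
    using \<mu> by (simp add: space_prob_algebra)
  interpret \<nu>: prob_space \<nu>
    using \<nu> by (simp add: space_prob_algebra)
  fix C :: "'a set" assume "C \<in> Collect closed"
  then have C: "closed C" by simp
  show "emeasure \<mu> C = emeasure \<nu> C"
  proof (cases "C = {}")
    case False
    have "measure \<mu> C = measure \<nu> C"
    proof (rule LIMSEQ_unique)
      show "(\<lambda>n. \<integral>x. closed_approx C n x \<partial>\<mu>) \<longlonglongrightarrow> measure \<mu> C"
        by (rule measure_closed_LIMSEQ[OF \<mu> C False])
      show "(\<lambda>n. \<integral>x. closed_approx C n x \<partial>\<mu>) \<longlonglongrightarrow> measure \<nu> C"
        using measure_closed_LIMSEQ[OF \<nu> C False] eq[OF closed_approx(1,2)] by simp
    qed
    then show ?thesis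
      by (simp add: \<mu>.emeasure_eq_measure \<nu>.emeasure_eq_measure)
  qed simp
qed (use assms in \<open>auto simp: space_prob_algebra prob_space_def finite_measure.emeasure_finite\<close>)

text \<open>Continuity is assumed only for integrals of continuous functions. Masses of closed sets
  are pointwise limits of such integrals, and closed sets generate the Borel sets. For
  \<open>\<rho>\<close> this gives the average measure its meaning.\<close>

lemma right_continuous_kernel:
  fixes \<kappa> :: "real \<Rightarrow> 'x \<Rightarrow> 'a::polish_space measure"
  assumes meas: "\<And>t. \<kappa> t \<in> M \<rightarrow>\<^sub>M prob_algebra borel"
    and cont: "\<And>x a f. x \<in> space M \<Longrightarrow> continuous_on UNIV f \<Longrightarrow> (\<And>y. \<bar>f y\<bar> \<le> 1) \<Longrightarrow>
       ((\<lambda>t. \<integral>y. f y \<partial>\<kappa> t x) \<longlongrightarrow> (\<integral>y. f y \<partial>\<kappa> a x :: real)) (at_right a)"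
  shows "(\<lambda>(t, x). \<kappa> t x) \<in> borel \<Otimes>\<^sub>M M \<rightarrow>\<^sub>M prob_algebra borel"
proof (rule measurable_prob_algebra_generated[OF borel_eq_sigma_closed Int_stable_closed])
  fix p :: "real \<times> 'x" assume "p \<in> space (borel \<Otimes>\<^sub>M M)"
  then have "(case p of (t, x) \<Rightarrow> \<kappa> t x) \<in> space (prob_algebra borel)"
    using measurable_space[OF meas] by (auto simp: space_pair_measure)
  then show "prob_space (case p of (t, x) \<Rightarrow> \<kappa> t x)" "sets (case p of (t, x) \<Rightarrow> \<kappa> t x) = sets borel"
    by (simp_all add: space_prob_algebra)
next
  fix C :: "'a set" assume "C \<in> Collect closed"
  then have C: "closed C" by simp
  show "(\<lambda>p. emeasure (case p of (t, x) \<Rightarrow> \<kappa> t x) C) \<in> borel_measurable (borel \<Otimes>\<^sub>M M)"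
  proof (cases "C = {}")
    case False
    have int: "(\<lambda>(t, x). \<integral>y. closed_approx C n y \<partial>\<kappa> t x) \<in> borel_measurable (borel \<Otimes>\<^sub>M M)" for n
    proof (rule right_continuous_measurable)
      have [measurable]: "closed_approx C n \<in> borel_measurable borel"
        by (rule borel_measurable_continuous_onI[OF closed_approx(1)])
      show "(\<lambda>x. \<integral>y. closed_approx C n y \<partial>\<kappa> t x) \<in> borel_measurable M" for t
        by (rule measurable_compose[OF measurable_prob_algebraD[OF meas] integral_measurable_subprob_algebra]) simp
    qed (use closed_approx in \<open>auto intro!: cont\<close>)
    have "(\<lambda>p. measure (case p of (t, x) \<Rightarrow> \<kappa> t x) C) \<in> borel_measurable (borel \<Otimes>\<^sub>M M)"
    proof (rule borel_measurable_LIMSEQ_metric[OF int])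
      fix p :: "real \<times> 'x" assume "p \<in> space (borel \<Otimes>\<^sub>M M)"
      then have "(case p of (t, x) \<Rightarrow> \<kappa> t x) \<in> space (prob_algebra borel)"
        using measurable_space[OF meas] by (auto simp: space_pair_measure)
      from measure_closed_LIMSEQ[OF this C False]
      show "(\<lambda>n. case p of (t, x) \<Rightarrow> \<integral>y. closed_approx C n y \<partial>\<kappa> t x)
        \<longlonglongrightarrow> measure (case p of (t, x) \<Rightarrow> \<kappa> t x) C"
        by (simp add: case_prod_beta)
    qed
    then have "(\<lambda>p. ennreal (measure (case p of (t, x) \<Rightarrow> \<kappa> t x) C)) \<in> borel_measurable (borel \<Otimes>\<^sub>M M)"
      by simp
    also have "?this \<longleftrightarrow> ?thesis"
    proof (rule measurable_cong)
      fix p :: "real \<times> 'x" assume "p \<in> space (borel \<Otimes>\<^sub>M M)"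
      then have "(case p of (t, x) \<Rightarrow> \<kappa> t x) \<in> space (prob_algebra borel)"
        using measurable_space[OF meas] by (auto simp: space_pair_measure)
      then interpret prob_space "(case p of (t, x) \<Rightarrow> \<kappa> t x)"
        by (simp add: space_prob_algebra)
      show "ennreal (measure (case p of (t, x) \<Rightarrow> \<kappa> t x) C) = emeasure (case p of (t, x) \<Rightarrow> \<kappa> t x) C"
        by (simp add: emeasure_eq_measure)
    qed
    finally show ?thesis .
  qed simp
qed simp

section \<open>Lebesgue measure on the circle\<close>

locale circle =
  fixes \<tau> :: real
  assumes period_pos: "0 < \<tau>"
begin

lemma period_nonneg [simp]: "0 \<le> \<tau>"
  using period_pos by simp

abbreviation U :: "real measure" where
  "U \<equiv> uniform_measure lborel {0..\<tau>}"

section \<open>Reduction modulo the period and rotation invariance\<close>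

definition wrap :: "real \<Rightarrow> real" where
  "wrap s = s - of_int \<lfloor>s / \<tau>\<rfloor> * \<tau>"

lemma wrap_bounds: "0 \<le> wrap s" "wrap s < \<tau>"
  using period_pos floor_divide_lower[of \<tau> s] floor_divide_upper[of \<tau> s]
  by (simp_all add: wrap_def algebra_simps)

lemma wrap_id: "0 \<le> s \<Longrightarrow> s < \<tau> \<Longrightarrow> wrap s = s"
  using period_pos by (simp add: wrap_def floor_eq_iff)

lemma measurable_wrap [measurable]: "wrap \<in> borel_measurable borel"
  unfolding wrap_def by measurable

lemma periodic_of_nat:
  assumes "\<And>s. h (s + \<tau>) = h s"
  shows "h (s + of_nat n * \<tau>) = h s"
proof (induction n)
  case (Suc n)
  have "h (s + of_nat (Suc n) * \<tau>) = h ((s + of_nat n * \<tau>) + \<tau>)"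
    by (simp add: algebra_simps)
  with Suc assms show ?case by simp
qed simp

lemma periodic_of_int:
  assumes "\<And>s. h (s + \<tau>) = h s"
  shows "h (s + of_int k * \<tau>) = h s"
proof (cases "0 \<le> k")
  case True
  then show ?thesis
    using periodic_of_nat[of h s "nat k"] assms by simp
next
  case False
  then show ?thesis
    using periodic_of_nat[of h "s + of_int k * \<tau>" "nat (- k)"] assms by simp
qed

lemma wrap_periodic:
  assumes "\<And>s. h (s + \<tau>) = h s"
  shows "h (wrap s) = h s"
  using periodic_of_int[of h s "- \<lfloor>s / \<tau>\<rfloor>"] assms by (simp add: wrap_def)

lemma wrap_add_period: "wrap (s + \<tau>) = wrap s"
  using period_pos by (simp add: wrap_def add_divide_distrib algebra_simps)

lemma emeasure_U_space: "emeasure lborel {0..\<tau>} \<noteq> 0" "emeasure lborel {0..\<tau>} < \<infinity>"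
  using period_pos by auto

lemma prob_space_U: "prob_space U"
  using emeasure_U_space by (intro prob_space_uniform_measure) auto

sublocale U: prob_space U
  by (rule prob_space_U)

text \<open>\<open>U\<close> lives on the closed interval, while \<open>wrap\<close> is the identity
  only on the half-open one; the endpoint \<tau> is a null set.\<close>

lemma AE_U_bounds: "AE s in U. 0 \<le> s \<and> s < \<tau>"
  unfolding AE_uniform_measure[OF emeasure_U_space]
  using AE_lborel_singleton[of \<tau>] by eventually_elim auto

lemma nn_integral_U:
  assumes [measurable]: "h \<in> borel_measurable borel"
  shows "(\<integral>\<^sup>+s. h s \<partial>U) = (\<integral>\<^sup>+s. h s * indicator {0..<\<tau>} s \<partial>lborel) / ennreal \<tau>"
proof -
  have "(\<integral>\<^sup>+s. h s * indicator {0..\<tau>} s \<partial>lborel) = (\<integral>\<^sup>+s. h s * indicator {0..<\<tau>} s \<partial>lborel)"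
    by (rule nn_integral_cong_AE)
      (use AE_lborel_singleton[of \<tau>] in eventually_elim, auto split: split_indicator)
  then show ?thesis
    using period_pos nn_integral_uniform_measure[of h lborel "{0..\<tau>}"] by simp
qed

text \<open>After reducing the shift to r in [0, \<tau>), the window [r, \<tau> + r) is cut at
  \<tau> and its second piece is moved back by one period.\<close>

lemma nn_integral_U_shift:
  assumes [measurable]: "h \<in> borel_measurable borel" and per: "\<And>s. h (s + \<tau>) = h s"
  shows "(\<integral>\<^sup>+s. h (s + t) \<partial>U) = (\<integral>\<^sup>+s. h s \<partial>U)"
proof -
  define r where "r = wrap t"
  have r: "0 \<le> r" "r < \<tau>"
    unfolding r_def by (rule wrap_bounds)+
  have ht: "h (s + t) = h (s + r)" for s
    using wrap_periodic[of "\<lambda>t. h (s + t)" t] per unfolding r_def by (simp add: add.assoc[symmetric])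
  have "(\<integral>\<^sup>+s. h (s + t) * indicator {0..<\<tau>} s \<partial>lborel) =
      (\<integral>\<^sup>+s. (\<lambda>s. h s * indicator {r..<\<tau> + r} s) (r + 1 * s) \<partial>lborel)"
    by (intro nn_integral_cong) (auto simp: ht add.commute split: split_indicator)
  also have "\<dots> = (\<integral>\<^sup>+s. h s * indicator {r..<\<tau> + r} s \<partial>lborel)"
    by (subst nn_integral_real_affine[where c=1 and t=r]) auto
  also have "\<dots> = (\<integral>\<^sup>+s. h s * indicator {r..<\<tau>} s + h s * indicator {\<tau>..<\<tau> + r} s \<partial>lborel)"
    using r by (intro nn_integral_cong) (auto split: split_indicator)
  also have "\<dots> = (\<integral>\<^sup>+s. h s * indicator {r..<\<tau>} s \<partial>lborel) + (\<integral>\<^sup>+s. h s * indicator {\<tau>..<\<tau> + r} s \<partial>lborel)"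
    by (rule nn_integral_add) auto
  also have "(\<integral>\<^sup>+s. h s * indicator {\<tau>..<\<tau> + r} s \<partial>lborel) =
      (\<integral>\<^sup>+s. (\<lambda>s. h s * indicator {\<tau>..<\<tau> + r} s) (\<tau> + 1 * s) \<partial>lborel)"
    by (subst nn_integral_real_affine[where c=1 and t=\<tau>]) auto
  also have "\<dots> = (\<integral>\<^sup>+s. h s * indicator {0..<r} s \<partial>lborel)"
    using per by (intro nn_integral_cong) (auto simp: add.commute split: split_indicator)
  also have "(\<integral>\<^sup>+s. h s * indicator {r..<\<tau>} s \<partial>lborel) + (\<integral>\<^sup>+s. h s * indicator {0..<r} s \<partial>lborel)
      = (\<integral>\<^sup>+s. h s * indicator {r..<\<tau>} s + h s * indicator {0..<r} s \<partial>lborel)"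
    by (rule nn_integral_add[symmetric]) auto
  also have "\<dots> = (\<integral>\<^sup>+s. h s * indicator {0..<\<tau>} s \<partial>lborel)"
    using r by (intro nn_integral_cong) (auto split: split_indicator)
  finally show ?thesis
    by (simp add: nn_integral_U)
qed

text \<open>Rotation invariance in the form of equal image measures, so that it transfers to Bochner
  integrals of vector-valued functions, integrable or not.\<close>

lemma distr_U_wrap: "distr U borel (\<lambda>s. wrap (s + t)) = distr U borel wrap"
proof (rule measure_eqI)
  fix A assume "A \<in> sets (distr U borel (\<lambda>s. wrap (s + t)))"
  then have [measurable]: "A \<in> sets borel" by simp
  have "emeasure (distr U borel (\<lambda>s. wrap (s + t))) A = (\<integral>\<^sup>+s. indicator A (wrap (s + t)) \<partial>U)"
    by (subst nn_integral_indicator[symmetric]) (auto simp: nn_integral_distr simp del: nn_integral_indicator)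
  also have "\<dots> = (\<integral>\<^sup>+s. indicator A (wrap s) \<partial>U)"
    by (rule nn_integral_U_shift) (auto simp: wrap_add_period)
  also have "\<dots> = emeasure (distr U borel wrap) A"
    by (subst nn_integral_indicator[symmetric]) (auto simp: nn_integral_distr simp del: nn_integral_indicator)
  finally show "emeasure (distr U borel (\<lambda>s. wrap (s + t))) A = emeasure (distr U borel wrap) A" .
qed simp

lemma integral_U_shift:
  fixes h :: "real \<Rightarrow> 'b::{banach, second_countable_topology}"
  assumes [measurable]: "h \<in> borel_measurable borel" and per: "\<And>s. h (s + \<tau>) = h s"
  shows "(\<integral>s. h (s + t) \<partial>U) = (\<integral>s. h s \<partial>U)"
proof -
  have w: "h (wrap s) = h s" for s
    using wrap_periodic[of h] per by blast
  have "(\<integral>s. h (s + t) \<partial>U) = (\<integral>s. h s \<partial>distr U borel (\<lambda>s. wrap (s + t)))"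
    by (subst integral_distr) (auto simp: w)
  also have "\<dots> = (\<integral>s. h s \<partial>U)"
    by (subst distr_U_wrap, subst integral_distr) (auto simp: w)
  finally show ?thesis .
qed

text \<open>\<open>Q\<close> is an arbitrary periodic predicate. Its exceptional set is enclosed in
  a Borel null set, whose preimage under the rotation is null as well.\<close>

lemma AE_U_shift:
  assumes per: "\<And>s. Q (s + \<tau>) = Q s" and Q: "AE s in U. Q s"
  shows "AE s in U. Q (s + t)"
proof -
  obtain Z where Z: "Z \<in> null_sets U" "{s \<in> space U. \<not> Q s} \<subseteq> Z"
    using Q by (auto simp: eventually_ae_filter)
  then have [measurable]: "Z \<in> sets borel"
    by auto
  have "(\<integral>\<^sup>+s. indicator Z (wrap (s + t)) \<partial>U) = (\<integral>\<^sup>+s. indicator Z (wrap s) \<partial>U)"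
    by (rule nn_integral_U_shift) (auto simp: wrap_add_period)
  also have "\<dots> = (\<integral>\<^sup>+s. indicator Z s \<partial>U)"
    by (rule nn_integral_cong_AE) (use AE_U_bounds in eventually_elim, simp add: wrap_id)
  also have "\<dots> = 0"
    using Z(1) by auto
  finally have "AE s in U. indicator Z (wrap (s + t)) = (0::ennreal)"
    by (subst (asm) nn_integral_0_iff_AE) auto
  then show ?thesis
  proof eventually_elim
    case (elim s)
    then have "Q (wrap (s + t))"
      using Z(2) by (auto simp: indicator_def split: if_splits)
    then show "Q (s + t)"
      using wrap_periodic[of Q] per by blast
  qed
qed

lemma periodic_all:
  assumes per: "\<And>s. Q (s + \<tau>) = Q s" and Q: "\<And>s. 0 \<le> s \<Longrightarrow> s < \<tau> \<Longrightarrow> Q s"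
  shows "Q s"
  using Q[OF wrap_bounds[of s]] wrap_periodic[of Q] per by blast

end

section \<open>Periodic measures of a Markovian semigroup\<close>

locale periodic_chain = circle \<tau> for \<tau> +
  fixes P :: "real \<Rightarrow> 'a::polish_space \<Rightarrow> 'a measure" and \<rho> :: "real \<Rightarrow> 'a measure"
  assumes semigroup: "markov_semigroup P"
    and stoch_cont: "stochastically_continuous P"
    and periodic: "periodic_measure P \<tau> \<rho>"
begin

lemma P_kernel: "0 \<le> t \<Longrightarrow> P t \<in> borel \<rightarrow>\<^sub>M prob_algebra borel"
  using semigroup by (simp add: markov_semigroup_def)

text \<open>Nothing is known about \<open>P t\<close> for negative \<open>t\<close>. Clamping the
  time yields a kernel for every real \<open>t\<close>, so that joint measurability can be stated
  over all of \<open>borel\<close>.\<close>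

lemma P_kernel' [measurable]: "P (max 0 t) \<in> borel \<rightarrow>\<^sub>M prob_algebra borel"
  by (simp add: P_kernel)

lemma P_in [simp]: "0 \<le> t \<Longrightarrow> P t x \<in> space (prob_algebra borel)"
  using measurable_space[OF P_kernel] by simp

lemma \<rho>_in [simp]: "\<rho> s \<in> space (prob_algebra borel)"
  using periodic by (simp add: periodic_measure_def)

lemma prob_space_P [simp]: "0 \<le> t \<Longrightarrow> prob_space (P t x)"
  using P_in[of t x] by (simp add: space_prob_algebra del: P_in)

lemma prob_space_\<rho> [simp]: "prob_space (\<rho> s)"
  using \<rho>_in[of s] by (simp add: space_prob_algebra del: \<rho>_in)

lemma sets_P [simp]: "0 \<le> t \<Longrightarrow> sets (P t x) = sets borel"
  using P_in[of t x] by (simp add: space_prob_algebra del: P_in)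

lemma sets_\<rho> [simp, measurable_cong]: "sets (\<rho> s) = sets borel"
  using \<rho>_in[of s] by (simp add: space_prob_algebra del: \<rho>_in)

lemma borel_measurable_P [simp]: "0 \<le> t \<Longrightarrow> borel_measurable (P t x) = borel_measurable borel"
  by (rule measurable_cong_sets) simp_all

lemma borel_measurable_\<rho> [simp]: "borel_measurable (\<rho> s) = borel_measurable borel"
  by (rule measurable_cong_sets) simp_all

lemma P_0: "P 0 x = return borel x"
  using semigroup by (simp add: markov_semigroup_def)

lemma \<rho>_add_period: "\<rho> (s + \<tau>) = \<rho> s"
  using periodic by (simp add: periodic_measure_def)

lemma P_add: 
  assumes "0 \<le> s" "0 \<le> t"
  shows "P (s + t) x = P s x \<bind> P t"
proof (rule measure_eqI)
  show "sets (P (s + t) x) = sets (P s x \<bind> P t)"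
    using assms by (simp add: sets_bind'[OF P_in P_kernel])
  fix B assume "B \<in> sets (P (s + t) x)"
  with assms have B: "B \<in> sets borel" by simp
  have "emeasure (P s x \<bind> P t) B = (\<integral>\<^sup>+y. emeasure (P t y) B \<partial>P s x)"
    using assms B by (intro emeasure_bind_prob_algebra[OF P_in P_kernel]) auto
  then show "emeasure (P (s + t) x) B = emeasure (P s x \<bind> P t) B"
    using semigroup assms B by (simp add: markov_semigroup_def)
qed

lemma \<rho>_add: 
  assumes "0 \<le> t"
  shows "\<rho> (s + t) = \<rho> s \<bind> P t"
proof (rule measure_eqI)
  show "sets (\<rho> (s + t)) = sets (\<rho> s \<bind> P t)"
    using assms by (simp add: sets_bind'[OF \<rho>_in P_kernel])
  fix B assume "B \<in> sets (\<rho> (s + t))"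
  then have B: "B \<in> sets borel" by simp
  have "emeasure (\<rho> s \<bind> P t) B = (\<integral>\<^sup>+y. emeasure (P t y) B \<partial>\<rho> s)"
    using assms B by (intro emeasure_bind_prob_algebra[OF \<rho>_in P_kernel]) auto
  then show "emeasure (\<rho> (s + t)) B = emeasure (\<rho> s \<bind> P t) B"
    using periodic assms B by (simp add: periodic_measure_def add.commute)
qed

section \<open>Weak right-continuity in time\<close>

lemma P_tendsto_id:
  fixes f :: "'a \<Rightarrow> real"
  assumes f: "continuous_on UNIV f" and bd: "\<And>y. \<bar>f y\<bar> \<le> 1"
  shows "((\<lambda>h. \<integral>y. f y \<partial>P h x) \<longlongrightarrow> f x) (at_right 0)"
proof (rule tendstoI)
  fix e :: real assume e: "0 < e"
  have [measurable]: "f \<in> borel_measurable borel"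
    by (rule borel_measurable_continuous_onI[OF f])
  obtain g where g: "0 < g" "\<And>y. dist y x < g \<Longrightarrow> dist (f y) (f x) < e / 2"
    using f e unfolding continuous_on_iff by (metis UNIV_I half_gt_zero)
  have "((\<lambda>h. measure (P h x) (ball x g)) \<longlongrightarrow> 1) (at_right 0)"
    using stoch_cont g by (simp add: stochastically_continuous_def)
  \<comment> \<open>Off the ball \<open>f\<close> deviates from \<open>f x\<close> by at most 2, so
    a mass of e / 4 there costs e / 2; the oscillation inside the ball costs the other half.\<close>
  then have "\<forall>\<^sub>F h in at_right 0. 1 - e / 4 < measure (P h x) (ball x g)"
    using e by (intro order_tendstoD) auto
  moreover have "\<forall>\<^sub>F h in at_right 0. (0::real) < h"
    by (rule eventually_at_right_less)
  ultimately show "\<forall>\<^sub>F h in at_right 0. dist (\<integral>y. f y \<partial>P h x) (f x) < e"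
  proof eventually_elim
    case (elim h)
    interpret prob_space "P h x"
      using elim by simp
    have [simp]: "integrable (P h x) f"
      using elim bd by (intro integrable_const_bound[where B=1]) auto
    have sp: "space (P h x) = UNIV"
      using sets_eq_imp_space_eq[OF sets_P[of h x]] elim by simp
    have ball: "ball x g \<in> events" "- ball x g \<in> events"
      using elim by auto
    have "dist (\<integral>y. f y \<partial>P h x) (f x) = \<bar>\<integral>y. f y - f x \<partial>P h x\<bar>"
      by (simp add: dist_real_def prob_space)
    also have "\<dots> \<le> (\<integral>y. \<bar>f y - f x\<bar> \<partial>P h x)"
      by (rule integral_abs_bound)
    also have "\<dots> \<le> (\<integral>y. e / 2 + 2 * indicator (- ball x g) y \<partial>P h x)"
    proof (rule integral_mono)
      fix y
      have "\<bar>f y - f x\<bar> \<le> 2"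
        using bd[of y] bd[of x] by linarith
      then show "\<bar>f y - f x\<bar> \<le> e / 2 + 2 * indicator (- ball x g) y"
        using g(2)[of y] e by (auto simp: dist_real_def dist_commute split: split_indicator)
    qed (use ball in \<open>auto simp: less_top[symmetric]\<close>)
    also have "\<dots> = e / 2 + 2 * prob (- ball x g)"
      using ball prob_space by (simp add: sp less_top[symmetric])
    also have "prob (- ball x g) = 1 - prob (ball x g)"
      using prob_compl[OF ball(1)] sp by (simp add: Compl_eq_Diff_UNIV)
    finally show ?case
      using elim(1) by simp
  qed
qed

text \<open>Dominated convergence, applied along sequences, lifts the limit from initial points to
  initial laws. With the initial laws \<open>P a x\<close> and \<open>\<rho> a\<close> it turns
  continuity at time 0 into right-continuity at time \<open>a\<close>.\<close>

lemma bind_P_tendsto: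
  fixes f :: "'a \<Rightarrow> real"
  assumes f: "continuous_on UNIV f" and bd: "\<And>y. \<bar>f y\<bar> \<le> 1" and \<mu>: "\<mu> \<in> space (prob_algebra borel)"
  shows "((\<lambda>h. \<integral>y. f y \<partial>(\<mu> \<bind> P h)) \<longlongrightarrow> (\<integral>y. f y \<partial>\<mu>)) (at_right 0)"
  unfolding tendsto_at_iff_sequentially comp_def
proof (intro allI impI)
  have [measurable]: "f \<in> borel_measurable borel"
    by (rule borel_measurable_continuous_onI[OF f])
  interpret prob_space \<mu>
    using \<mu> by (simp add: space_prob_algebra)
  have [measurable_cong]: "sets \<mu> = sets borel"
    using \<mu> by (simp add: space_prob_algebra)
  fix X :: "nat \<Rightarrow> real" assume "\<forall>i. X i \<in> {0<..} - {0}" and X0: "X \<longlonglongrightarrow> 0"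
  then have pos: "0 < X i" for i by auto
  note K [measurable] = measurable_prob_algebraD[OF P_kernel[OF less_imp_le[OF pos]]]
  have "(\<integral>y. f y \<partial>(\<mu> \<bind> P (X i))) = (\<integral>x. (\<integral>y. f y \<partial>P (X i) x) \<partial>\<mu>)" for i
  proof (rule integral_bind[where N=borel])
    show "prob_space \<mu>" by unfold_locales
    show "P (X i) \<in> \<mu> \<rightarrow>\<^sub>M prob_algebra borel"
      using P_kernel[OF less_imp_le[OF pos]] by measurable
    interpret b: prob_space "\<mu> \<bind> P (X i)"
      by (rule prob_space_bind'[OF \<mu> P_kernel[OF less_imp_le[OF pos]]])
    have "sets (\<mu> \<bind> P (X i)) = sets borel"
      by (rule sets_bind'[OF \<mu> P_kernel[OF less_imp_le[OF pos]]])
    then show "integrable (\<mu> \<bind> P (X i)) f"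
      using bd by (intro b.integrable_const_bound[where B=1]) (auto cong: measurable_cong_sets)
  qed
  moreover have "(\<lambda>i. \<integral>x. (\<integral>y. f y \<partial>P (X i) x) \<partial>\<mu>) \<longlonglongrightarrow> (\<integral>x. f x \<partial>\<mu>)"
  proof (rule integral_dominated_convergence[where w="\<lambda>_. 1"])
    show "AE x in \<mu>. (\<lambda>i. \<integral>y. f y \<partial>P (X i) x) \<longlonglongrightarrow> f x"
    proof (rule AE_I2)
      fix x
      have "filterlim X (at_right 0) sequentially"
        using X0 pos by (auto simp: filterlim_at less_imp_neq[symmetric])
      with P_tendsto_id[OF f bd] show "(\<lambda>i. \<integral>y. f y \<partial>P (X i) x) \<longlonglongrightarrow> f x"
        by (rule filterlim_compose)
    qed
    show "(\<lambda>x. \<integral>y. f y \<partial>P (X i) x) \<in> borel_measurable \<mu>" for i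
      by measurable
    show "AE x in \<mu>. norm (\<integral>y. f y \<partial>P (X i) x) \<le> 1" for i
    proof (rule AE_I2)
      fix x
      interpret p: prob_space "P (X i) x"
        using pos[of i] by simp
      have "norm (\<integral>y. f y \<partial>P (X i) x) \<le> (\<integral>y. \<bar>f y\<bar> \<partial>P (X i) x)"
        using integral_norm_bound[of "P (X i) x" f] by simp
      also have "\<dots> \<le> 1"
        using pos[of i] bd
        by (intro p.integral_le_const p.integrable_const_bound[where B=1]) auto
      finally show "norm (\<integral>y. f y \<partial>P (X i) x) \<le> 1" .
    qed
  qed simp_all
  ultimately show "(\<lambda>i. \<integral>y. f y \<partial>(\<mu> \<bind> P (X i))) \<longlonglongrightarrow> (\<integral>y. f y \<partial>\<mu>)"
    by simp
qed

lemma P_right_continuous: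
  fixes f :: "'a \<Rightarrow> real"
  assumes f: "continuous_on UNIV f" "\<And>y. \<bar>f y\<bar> \<le> 1"
  shows "((\<lambda>t. \<integral>y. f y \<partial>P (max 0 t) x) \<longlongrightarrow> (\<integral>y. f y \<partial>P (max 0 a) x)) (at_right a)"
proof (cases "0 \<le> a")
  case True
  have "((\<lambda>h. \<integral>y. f y \<partial>(P a x \<bind> P h)) \<longlongrightarrow> (\<integral>y. f y \<partial>P a x)) (at_right 0)"
    using True f by (intro bind_P_tendsto) auto
  moreover have "\<forall>\<^sub>F h in at_right 0. (\<integral>y. f y \<partial>(P a x \<bind> P h)) = (\<integral>y. f y \<partial>P (max 0 (h + a)) x)"
    using eventually_at_right_less[of 0] by eventually_elim (simp add: True P_add[symmetric] add.commute)
  ultimately have "((\<lambda>h. \<integral>y. f y \<partial>P (max 0 (h + a)) x) \<longlongrightarrow> (\<integral>y. f y \<partial>P a x)) (at_right 0)"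
    by (rule Lim_transform_eventually)
  then show ?thesis
    using True by (subst filterlim_at_right_to_0) simp
next
  case False
  \<comment> \<open>For negative \<open>a\<close> the clamped family is constantly
    \<open>P 0 x\<close> just to the right of \<open>a\<close>.\<close>
  then have "\<forall>\<^sub>F t in at_right a. t < 0"
    by (intro eventually_at_rightI[of a 0]) auto
  then have "\<forall>\<^sub>F t in at_right a. (\<integral>y. f y \<partial>P (max 0 t) x) = (\<integral>y. f y \<partial>P (max 0 a) x)"
    by eventually_elim (use False in \<open>simp add: max_def\<close>)
  then show ?thesis
    by (rule tendsto_eventually)
qed

lemma \<rho>_right_continuous:
  fixes f :: "'a \<Rightarrow> real"
  assumes f: "continuous_on UNIV f" "\<And>y. \<bar>f y\<bar> \<le> 1"
  shows "((\<lambda>t. \<integral>y. f y \<partial>\<rho> t) \<longlongrightarrow> (\<integral>y. f y \<partial>\<rho> a)) (at_right a)"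
proof -
  have "((\<lambda>h. \<integral>y. f y \<partial>(\<rho> a \<bind> P h)) \<longlongrightarrow> (\<integral>y. f y \<partial>\<rho> a)) (at_right 0)"
    using f by (intro bind_P_tendsto) auto
  moreover have "\<forall>\<^sub>F h in at_right 0. (\<integral>y. f y \<partial>(\<rho> a \<bind> P h)) = (\<integral>y. f y \<partial>\<rho> (h + a))"
    using eventually_at_right_less[of 0] by eventually_elim (simp add: \<rho>_add[symmetric] add.commute)
  ultimately have "((\<lambda>h. \<integral>y. f y \<partial>\<rho> (h + a)) \<longlongrightarrow> (\<integral>y. f y \<partial>\<rho> a)) (at_right 0)"
    by (rule Lim_transform_eventually)
  then show ?thesis
    by (subst filterlim_at_right_to_0) simp
qed

lemma \<rho>_kernel [measurable]: "\<rho> \<in> borel \<rightarrow>\<^sub>M prob_algebra borel"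
proof -
  \<comment> \<open>The one-point second factor turns the two-parameter lemma into a statement about
    \<open>t\<close> alone.\<close>
  have "(\<lambda>(t, x::unit). \<rho> t) \<in> borel \<Otimes>\<^sub>M count_space UNIV \<rightarrow>\<^sub>M prob_algebra borel"
    by (rule right_continuous_kernel) (auto intro!: \<rho>_right_continuous measurable_const)
  from measurable_compose[OF _ this, of "\<lambda>t. (t, ())" borel] show ?thesis
    by simp
qed

lemma \<rho>_kernel_U: "\<rho> \<in> U \<rightarrow>\<^sub>M prob_algebra borel"
  using \<rho>_kernel by measurable

section \<open>The averaged measure and its invariance\<close>

abbreviation \<rho>bar :: "'a measure" where
  "\<rho>bar \<equiv> average_measure \<tau> \<rho>"

lemma \<rho>bar_in: "\<rho>bar \<in> space (prob_algebra borel)"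
  unfolding average_measure_def space_prob_algebra
  using U.prob_space_axioms
    prob_space_bind'[of U borel, OF _ \<rho>_kernel] sets_bind'[of U borel, OF _ \<rho>_kernel]
  by (simp add: space_prob_algebra)

lemma prob_space_\<rho>bar: "prob_space \<rho>bar"
  using \<rho>bar_in by (simp add: space_prob_algebra)

lemma sets_\<rho>bar [simp, measurable_cong]: "sets \<rho>bar = sets borel"
  using \<rho>bar_in by (simp add: space_prob_algebra)

lemma borel_measurable_\<rho>bar [simp]: "borel_measurable \<rho>bar = borel_measurable borel"
  by (rule measurable_cong_sets) simp_all

lemma nn_integral_\<rho>bar:
  assumes "f \<in> borel_measurable borel"
  shows "(\<integral>\<^sup>+x. f x \<partial>\<rho>bar) = (\<integral>\<^sup>+s. (\<integral>\<^sup>+x. f x \<partial>\<rho> s) \<partial>U)"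
  unfolding average_measure_def
  by (rule nn_integral_bind[OF assms measurable_prob_algebraD[OF \<rho>_kernel_U]])

lemma AE_\<rho>bar:
  assumes "Measurable.pred borel Q"
  shows "(AE x in \<rho>bar. Q x) \<longleftrightarrow> (AE s in U. AE x in \<rho> s. Q x)"
  unfolding average_measure_def
  by (rule AE_bind[OF measurable_prob_algebraD[OF \<rho>_kernel_U] assms])

lemma AE_\<rho>barD: "AE x in \<rho>bar. Q x \<Longrightarrow> AE s in U. AE x in \<rho> s. Q x"
  unfolding average_measure_def
  by (rule AE_bindD[OF measurable_prob_algebraD[OF \<rho>_kernel_U] U.not_empty])

lemma nn_integral_\<rho>_P:
  assumes [measurable]: "f \<in> borel_measurable borel" and t: "0 \<le> t"
  shows "(\<integral>\<^sup>+x. (\<integral>\<^sup>+y. f y \<partial>P t x) \<partial>\<rho> s) = (\<integral>\<^sup>+x. f x \<partial>\<rho> (s + t))"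
  unfolding \<rho>_add[OF t]
  by (rule nn_integral_bind[OF assms(1), symmetric])
     (use measurable_prob_algebraD[OF P_kernel[OF t]] in measurable)

text \<open>\<open>P t\<close> carries \<open>\<rho> s\<close> to \<open>\<rho> (s + t)\<close>,
  which rotates the phase, and the uniform law of the phase is rotation invariant.\<close>

lemma nn_integral_\<rho>bar_P:
  assumes [measurable]: "f \<in> borel_measurable borel" and t: "0 \<le> t"
  shows "(\<integral>\<^sup>+x. (\<integral>\<^sup>+y. f y \<partial>P t x) \<partial>\<rho>bar) = (\<integral>\<^sup>+x. f x \<partial>\<rho>bar)"
proof -
  note [measurable] = measurable_prob_algebraD[OF P_kernel[OF t]] measurable_prob_algebraD[OF \<rho>_kernel]
    nn_integral_measurable_subprob_algebra
  have "(\<integral>\<^sup>+x. (\<integral>\<^sup>+y. f y \<partial>P t x) \<partial>\<rho>bar) = (\<integral>\<^sup>+s. (\<integral>\<^sup>+x. f x \<partial>\<rho> (s + t)) \<partial>U)"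
    by (simp add: nn_integral_\<rho>bar nn_integral_\<rho>_P t)
  also have "\<dots> = (\<integral>\<^sup>+s. (\<integral>\<^sup>+x. f x \<partial>\<rho> s) \<partial>U)"
    by (rule nn_integral_U_shift) (auto simp: \<rho>_add_period)
  finally show ?thesis
    by (simp add: nn_integral_\<rho>bar)
qed

lemma bind_\<rho>bar_P:
  assumes "0 \<le> t"
  shows "\<rho>bar \<bind> P t = \<rho>bar"
proof (rule measure_eqI)
  show "sets (\<rho>bar \<bind> P t) = sets \<rho>bar"
    using sets_bind'[OF \<rho>bar_in P_kernel[OF assms]] by simp
  fix B assume "B \<in> sets (\<rho>bar \<bind> P t)"
  then have B: "B \<in> sets borel"
    using sets_bind'[OF \<rho>bar_in P_kernel[OF assms]] by simp
  have "emeasure (\<rho>bar \<bind> P t) B = (\<integral>\<^sup>+x. emeasure (P t x) B \<partial>\<rho>bar)"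
    using B by (rule emeasure_bind_prob_algebra[OF \<rho>bar_in P_kernel[OF assms]])
  also have "\<dots> = (\<integral>\<^sup>+x. (\<integral>\<^sup>+y. indicator B y \<partial>P t x) \<partial>\<rho>bar)"
    using B assms by simp
  also have "\<dots> = (\<integral>\<^sup>+x. indicator B x \<partial>\<rho>bar)"
    using B assms by (intro nn_integral_\<rho>bar_P) auto
  finally show "emeasure (\<rho>bar \<bind> P t) B = emeasure \<rho>bar B"
    using B by simp
qed

end

section \<open>Consequences of mixing\<close>

text \<open>By second countability, the complement of the support is covered by the null members of
  a countable basis.\<close>

lemma measure_support:
  fixes \<mu> :: "'a::second_countable_topology measure"
  assumes "sets \<mu> = sets borel"
  shows "closed (measure_support \<mu>)" and "AE x in \<mu>. x \<in> measure_support \<mu>"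
proof -
  have compl: "- measure_support \<mu> = \<Union>{U. open U \<and> emeasure \<mu> U = 0}"
    by (auto simp: measure_support_def not_gr_zero)
  have "open (\<Union>{U. open U \<and> emeasure \<mu> U = 0})"
    by auto
  then show "closed (measure_support \<mu>)"
    unfolding closed_def compl .
  obtain B :: "'a set set" where B: "countable B" "topological_basis B"
    using ex_countable_basis by blast
  define B0 where "B0 = {b \<in> B. emeasure \<mu> b = 0}"
  have "(\<Union>b\<in>B0. b) \<in> null_sets \<mu>"
  proof (rule null_sets_UN')
    show "countable B0"
      using B(1) by (auto simp: B0_def intro: countable_subset)
    show "b \<in> null_sets \<mu>" if "b \<in> B0" for b
      using that topological_basis_open[OF B(2)] assms by (auto simp: B0_def null_sets_def)
  qed
  moreover have "{x \<in> space \<mu>. \<not> x \<in> measure_support \<mu>} \<subseteq> (\<Union>b\<in>B0. b)"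
  proof
    fix x assume "x \<in> {x \<in> space \<mu>. \<not> x \<in> measure_support \<mu>}"
    then have "x \<in> - measure_support \<mu>"
      by simp
    then obtain V where V: "open V" "emeasure \<mu> V = 0" "x \<in> V"
      unfolding compl by auto
    then obtain b where b: "b \<in> B" "x \<in> b" "b \<subseteq> V"
      using topological_basisE[OF B(2)] by metis
    have "emeasure \<mu> b \<le> emeasure \<mu> V"
      using b V assms by (intro emeasure_mono) auto
    with b V show "x \<in> (\<Union>b\<in>B0. b)"
      by (auto simp: B0_def)
  qed
  ultimately show "AE x in \<mu>. x \<in> measure_support \<mu>"
    by (rule AE_I')
qed

lemma Cesaro_zero:
  fixes c :: "nat \<Rightarrow> real"
  assumes c: "c \<longlonglongrightarrow> 0" and nonneg: "\<And>n. 0 \<le> c n"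
  shows "(\<lambda>n. (\<Sum>j<n. c j) / real n) \<longlonglongrightarrow> 0"
proof (rule LIMSEQ_I)
  fix e :: real assume e: "0 < e"
  obtain N where N: "c n < e / 2" if "N \<le> n" for n
    using order_tendstoD(2)[OF c, of "e / 2"] e by (auto simp: eventually_sequentially)
  define D where "D = (\<Sum>j<N. c j)"
  \<comment> \<open>Beyond this index the first \<open>N\<close> terms contribute less than half of
    \<open>e\<close> to the average.\<close>
  obtain M :: nat where M: "2 * D / e < real M"
    using reals_Archimedean2 by blast
  have "norm ((\<Sum>j<n. c j) / real n - 0) < e" if n: "Suc (max N M) \<le> n" for n
  proof -
    have "(\<Sum>j<n. c j) = D + (\<Sum>j=N..<n. c j)"
      using n by (subst sum.atLeastLessThan_concat[of 0 N n "c", symmetric, unfolded atLeast0LessThan]) (auto simp: D_def)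
    also have "(\<Sum>j=N..<n. c j) \<le> (\<Sum>j=N..<n. e / 2)"
      using N by (intro sum_mono) (auto intro: less_imp_le)
    also have "\<dots> \<le> real n * (e / 2)"
      using e by (simp add: mult_right_mono)
    also have "D + real n * (e / 2) < real n * e"
    proof -
      have "2 * D / e < real n"
        using M n by linarith
      then show ?thesis
        using e by (simp add: field_simps)
    qed
    finally have "(\<Sum>j<n. c j) < e * real n"
      by (simp add: mult.commute)
    moreover have "0 \<le> (\<Sum>j<n. c j)"
      using nonneg by (intro sum_nonneg) auto
    ultimately show ?thesis
      using n by (simp add: pos_divide_less_eq)
  qed
  then show "\<exists>no. \<forall>n\<ge>no. norm ((\<Sum>j<n. c j) / real n - 0) < e"
    by blast
qed

text \<open>An e / 3 argument: linear functionals dominated by a common multiple of the L1 norm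
  converge on L1 once they converge on indicators. Additivity is asked for on integrable functions,
  where the Bochner integral has it. The lemma serves twice, with the evolved function and with the
  test function as the variable.\<close>

lemma tendsto_functional_integrable:
  fixes L :: "nat \<Rightarrow> ('a \<Rightarrow> complex) \<Rightarrow> complex" and l :: "('a \<Rightarrow> complex) \<Rightarrow> complex"
  assumes ind: "\<And>A. A \<in> sets M \<Longrightarrow> (\<lambda>k. L k (indicator A)) \<longlonglongrightarrow> l (indicator A)"
    and add: "\<And>k f g. integrable M f \<Longrightarrow> integrable M g \<Longrightarrow> L k (\<lambda>x. f x + g x) = L k f + L k g"
      "\<And>f g. integrable M f \<Longrightarrow> integrable M g \<Longrightarrow> l (\<lambda>x. f x + g x) = l f + l g"
    and scale: "\<And>k f c. L k (\<lambda>x. c * f x) = c * L k f" "\<And>f c. l (\<lambda>x. c * f x) = c * l f"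
    and bound: "\<And>k f. integrable M f \<Longrightarrow> cmod (L k f) \<le> C * (\<integral>x. cmod (f x) \<partial>M)"
      "\<And>f. integrable M f \<Longrightarrow> cmod (l f) \<le> C * (\<integral>x. cmod (f x) \<partial>M)"
    and f: "integrable M f"
  shows "(\<lambda>k. L k f) \<longlonglongrightarrow> l f"
  using f
proof (induction rule: integrable_induct)
  case (base A c)
  have "(\<lambda>x. indicator A x *\<^sub>R c) = (\<lambda>x. c * indicator A x)"
    by (auto split: split_indicator)
  then show ?case
    using tendsto_mult_left[OF ind[OF base(1)], of c] by (simp add: scale)
next
  case (add f g)
  then show ?case
    using assms(2,3) by (auto intro: tendsto_add)
next
  case (lim f s)
  have diff: "integrable M (\<lambda>x. f x - s i x)" for i
    using lim by auto
  have "L k (\<lambda>x. s i x + (f x - s i x)) = L k (s i) + L k (\<lambda>x. f x - s i x)" for k i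
    by (rule assms(2)) (use lim.hyps(1) diff in auto)
  moreover have "l (\<lambda>x. s i x + (f x - s i x)) = l (s i) + l (\<lambda>x. f x - s i x)" for i
    by (rule assms(3)) (use lim.hyps(1) diff in auto)
  ultimately have split: "L k f = L k (s i) + L k (\<lambda>x. f x - s i x)" "l f = l (s i) + l (\<lambda>x. f x - s i x)" for k i
    by simp_all
  have "(\<lambda>i. \<integral>x. cmod (f x - s i x) \<partial>M) \<longlonglongrightarrow> (\<integral>x. 0 \<partial>M)"
  \<comment> \<open>The approximants are bounded by 2 |f|, so the difference is bounded by 3
    |f|.\<close>
  proof (rule integral_dominated_convergence[where w="\<lambda>x. 3 * cmod (f x)"])
    show "AE x in M. (\<lambda>i. cmod (f x - s i x)) \<longlonglongrightarrow> 0"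
    proof (rule AE_I2)
      fix x assume "x \<in> space M"
      then show "(\<lambda>i. cmod (f x - s i x)) \<longlonglongrightarrow> 0"
        using tendsto_norm[OF tendsto_diff[OF tendsto_const[of "f x"] lim.hyps(2)[of x]]] by simp
    qed
    show "AE x in M. norm (cmod (f x - s i x)) \<le> 3 * cmod (f x)" for i
    proof (rule AE_I2)
      fix x assume x: "x \<in> space M"
      have "cmod (f x - s i x) \<le> cmod (f x) + cmod (s i x)"
        by (rule norm_triangle_ineq4)
      with lim.hyps(3)[OF x, of i] show "norm (cmod (f x - s i x)) \<le> 3 * cmod (f x)"
        by simp
    qed
  qed (use lim.hyps(1,4) in auto)
  then have small: "(\<lambda>i. C * (\<integral>x. cmod (f x - s i x) \<partial>M)) \<longlonglongrightarrow> 0"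
    using tendsto_mult_left[of _ 0 sequentially C] by simp
  show ?case
  proof (rule tendstoI)
    fix e :: real assume "0 < e"
    then have "\<forall>\<^sub>F i in sequentially. C * (\<integral>x. cmod (f x - s i x) \<partial>M) < e / 3"
      by (intro order_tendstoD(2)[OF small]) simp
    then obtain i where i: "C * (\<integral>x. cmod (f x - s i x) \<partial>M) < e / 3"
      using eventually_happens'[OF sequentially_bot] by blast
    have "\<forall>\<^sub>F k in sequentially. dist (L k (s i)) (l (s i)) < e / 3"
      using \<open>0 < e\<close> by (intro tendstoD[OF lim.IH]) auto
    then show "\<forall>\<^sub>F k in sequentially. dist (L k f) (l f) < e"
    proof eventually_elim
      case (elim k)
      have "dist (L k f) (l f) = cmod ((L k (s i) - l (s i)) + L k (\<lambda>x. f x - s i x) - l (\<lambda>x. f x - s i x))"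
        using split(1)[of k i] split(2)[of i] by (simp add: dist_norm algebra_simps)
      also have "\<dots> \<le> dist (L k (s i)) (l (s i)) + cmod (L k (\<lambda>x. f x - s i x)) + cmod (l (\<lambda>x. f x - s i x))"
        unfolding dist_norm by (meson norm_triangle_ineq norm_triangle_ineq4 add_right_mono order_trans)
      finally show ?case
        using elim i bound(1)[OF diff, of k i] bound(2)[OF diff, of i] by linarith
    qed
  qed
qed

context periodic_chain
begin

section \<open>The chain sampled at multiples of the period\<close>

lemma periods_nonneg [simp]: "0 \<le> real k * \<tau>"
  using period_pos by simp

lemma \<rho>_bind_period: "\<rho> s \<bind> P (real k * \<tau>) = \<rho> s"
  using periodic_of_nat[of \<rho> s k] by (simp add: \<rho>_add[symmetric] \<rho>_add_period)

lemma P_kernel_\<rho>: "0 \<le> t \<Longrightarrow> P t \<in> \<rho> s \<rightarrow>\<^sub>M prob_algebra borel"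
  using P_kernel[of t] by (simp add: measurable_cong_sets[OF sets_\<rho> refl])

text \<open>\<open>\<rho> s\<close> is its own image under k periods, so from almost every starting
  point the exceptional set is almost surely not hit at that time.\<close>

lemma AE_\<rho>_P:
  assumes "AE y in \<rho> s. Q y"
  shows "AE x in \<rho> s. AE y in P (real k * \<tau>) x. Q y"
proof (rule AE_bindD[OF measurable_prob_algebraD[OF P_kernel_\<rho>]])
  show "AE y in \<rho> s \<bind> P (real k * \<tau>). Q y"
    unfolding \<rho>_bind_period by fact
qed (simp_all add: prob_space.not_empty)

text \<open>A cylinder event names a set at every intermediate time; \<open>S\<close> is the entry
  that imposes no condition, as the chain almost surely stays in \<open>S\<close>. One step has
  already been made when the list begins, so \<open>A\<close> after \<open>n\<close> copies of
  \<open>S\<close> is visited at time \<open>Suc n\<close>.\<close>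

lemma cylinder_prob_supported:
  assumes S: "AE x in \<rho> s. x \<in> S" "S \<in> sets borel" and A: "A \<in> sets borel"
  shows "AE x in \<rho> s. cylinder_prob (P \<tau>) (replicate n S @ [A]) (P \<tau> x) = emeasure (P (real (Suc n) * \<tau>) x) A"
proof (induction n)
  case 0
  show ?case
    using A period_pos by (simp add: AE_I2)
next
  case (Suc n)
  have "AE y in \<rho> s. y \<in> S \<and>
      cylinder_prob (P \<tau>) (replicate n S @ [A]) (P \<tau> y) = emeasure (P (real (Suc n) * \<tau>) y) A"
    using S(1) Suc by eventually_elim simp
  from AE_\<rho>_P[OF this, of 1, unfolded of_nat_1 mult_1]
  have "AE x in \<rho> s. AE y in P \<tau> x. y \<in> S \<and>
      cylinder_prob (P \<tau>) (replicate n S @ [A]) (P \<tau> y) = emeasure (P (real (Suc n) * \<tau>) y) A" .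
  then show ?case
  proof eventually_elim
    case (elim x)
    have "cylinder_prob (P \<tau>) (replicate (Suc n) S @ [A]) (P \<tau> x) =
        (\<integral>\<^sup>+y. cylinder_prob (P \<tau>) (replicate n S @ [A]) (P \<tau> y) * indicator S y \<partial>P \<tau> x)"
      by simp
    also have "\<dots> = (\<integral>\<^sup>+y. emeasure (P (real (Suc n) * \<tau>) y) A \<partial>P \<tau> x)"
      by (rule nn_integral_cong_AE) (use elim in eventually_elim, simp)
    also have "\<dots> = emeasure (P \<tau> x \<bind> P (real (Suc n) * \<tau>)) A"
      using period_pos A by (intro emeasure_bind_prob_algebra[symmetric]) (auto intro!: P_kernel simp del: of_nat_Suc)
    also have "P \<tau> x \<bind> P (real (Suc n) * \<tau>) = P (real (Suc (Suc n)) * \<tau>) x"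
      using period_pos by (subst P_add[symmetric]) (auto simp: algebra_simps)
    finally show ?case .
  qed
qed

text \<open>The path-space condition is applied to two one-coordinate events: being in
  \<open>B\<close> at time 0 and, after the shift, in \<open>A\<close> at time k.\<close>

lemma mixing_sets:
  assumes mix: "mixing_on (measure_support (\<rho> s)) (P \<tau>) (\<rho> s)"
    and A: "A \<in> sets borel" and B: "B \<in> sets borel"
  shows "(\<lambda>k. \<integral>x. indicator B x * measure (P (real k * \<tau>) x) A \<partial>\<rho> s) \<longlonglongrightarrow> measure (\<rho> s) A * measure (\<rho> s) B"
proof -
  interpret \<rho>: prob_space "\<rho> s" by simp
  define S where "S = measure_support (\<rho> s)"
  have clS: "closed S" and aeS: "AE x in \<rho> s. x \<in> S"
    using measure_support[OF sets_\<rho>[of s]] unfolding S_def by auto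
  then have [measurable]: "S \<in> sets borel" by simp
  obtain Q where law: "stationary_chain_law S (P \<tau>) (\<rho> s) Q"
    and lim: "\<And>A B. A \<in> sets Q \<Longrightarrow> B \<in> sets Q \<Longrightarrow>
       (\<lambda>k. measure Q (path_shift (- int k) ` A \<inter> B)) \<longlonglongrightarrow> measure Q A * measure Q B"
    using mix unfolding mixing_on_def S_def by blast
  have setsQ: "sets Q = sets (\<Pi>\<^sub>M n\<in>(UNIV::int set). restrict_space borel S)"
    and cyl: "\<And>m As. set As \<subseteq> sets (restrict_space borel S) \<Longrightarrow>
        emeasure Q {\<omega> \<in> space Q. \<forall>i<length As. \<omega> (m + int i) \<in> As ! i} = cylinder_prob (P \<tau>) As (\<rho> s)"
    using law unfolding stationary_chain_law_def by blast+
  have spaceQ: "space Q = {\<omega>. \<forall>n. \<omega> n \<in> S}"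
    using sets_eq_imp_space_eq[OF setsQ] by (auto simp: space_PiM space_restrict_space)
  \<comment> \<open>Paths have coordinates in \<open>S\<close>, so the sets are cut down to
    \<open>S\<close>; this removes null sets only.\<close>
  define A' B' where "A' = A \<inter> S" and "B' = B \<inter> S"
  have AB' [measurable]: "A' \<in> sets borel" "B' \<in> sets borel"
    using A B by (auto simp: A'_def B'_def)
  have in_restr: "A' \<in> sets (restrict_space borel S)" "B' \<in> sets (restrict_space borel S)" "S \<in> sets (restrict_space borel S)"
    using A B by (auto simp: A'_def B'_def sets_restrict_space)
  define Z where "Z C = {\<omega> \<in> space Q. \<omega> 0 \<in> C}" for C
  have Z_sets: "Z C \<in> sets Q" if "C \<in> sets (restrict_space borel S)" for C
  proof -
    have "Z C = (\<lambda>\<omega>. \<omega> 0) -` C \<inter> space (\<Pi>\<^sub>M n\<in>(UNIV::int set). restrict_space borel S)"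
      using sets_eq_imp_space_eq[OF setsQ] by (auto simp: Z_def)
    also have "\<dots> \<in> sets (\<Pi>\<^sub>M n\<in>(UNIV::int set). restrict_space borel S)"
      using that by (intro measurable_sets[OF measurable_component_singleton]) auto
    finally show ?thesis
      using setsQ by simp
  qed
  have Z_measure: "measure Q (Z C) = measure (\<rho> s) C" if "C \<in> sets (restrict_space borel S)" "C \<in> sets borel" for C
    using cyl[of "[C]" 0] that by (simp add: Z_def measure_def)
  have ae: "AE x in \<rho> s. AE y in P (real k * \<tau>) x. y \<in> S" for k
    by (rule AE_\<rho>_P[OF aeS])
  \<comment> \<open>The shift is \<open>Suc n\<close> because with shift 0 both sets would constrain
    the same coordinate; dropping one term leaves the limit unchanged.\<close>
  have pair: "measure Q (path_shift (- int (Suc n)) ` Z A' \<inter> Z B')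
      = (\<integral>x. indicator B x * measure (P (real (Suc n) * \<tau>) x) A \<partial>\<rho> s)" for n
  proof -
    define As where "As = B' # replicate n S @ [A']"
    \<comment> \<open>Shifting by a negative amount delays the path, so the condition at time 0
      moves to time n + 1.\<close>
    have "path_shift (- int (Suc n)) ` Z A' = {\<omega> \<in> space Q. \<omega> (int (Suc n)) \<in> A'}"
    proof (intro set_eqI iffI)
      fix \<omega> assume "\<omega> \<in> {\<omega> \<in> space Q. \<omega> (int (Suc n)) \<in> A'}"
      then have "path_shift (int (Suc n)) \<omega> \<in> Z A'"
        by (auto simp: Z_def spaceQ path_shift_def)
      moreover have "\<omega> = path_shift (- int (Suc n)) (path_shift (int (Suc n)) \<omega>)"
        by (simp add: path_shift_def)
      ultimately show "\<omega> \<in> path_shift (- int (Suc n)) ` Z A'"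
        by blast
    qed (auto simp: Z_def spaceQ path_shift_def)
    then have "path_shift (- int (Suc n)) ` Z A' \<inter> Z B' = {\<omega> \<in> space Q. \<omega> 0 \<in> B' \<and> \<omega> (int (Suc n)) \<in> A'}"
      by (auto simp: Z_def)
    also have "\<dots> = {\<omega> \<in> space Q. \<forall>i<length As. \<omega> (0 + int i) \<in> As ! i}"
    proof -
      have "(\<forall>i<length As. \<omega> (0 + int i) \<in> As ! i) \<longleftrightarrow> \<omega> 0 \<in> B' \<and> \<omega> (int (Suc n)) \<in> A'"
        if \<omega>: "\<And>n. \<omega> n \<in> S" for \<omega>
      proof
        assume *: "\<forall>i<length As. \<omega> (0 + int i) \<in> As ! i"
        show "\<omega> 0 \<in> B' \<and> \<omega> (int (Suc n)) \<in> A'"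
          using *[rule_format, of 0] *[rule_format, of "Suc n"] by (auto simp: As_def nth_append)
      next
        assume *: "\<omega> 0 \<in> B' \<and> \<omega> (int (Suc n)) \<in> A'"
        show "\<forall>i<length As. \<omega> (0 + int i) \<in> As ! i"
        proof (intro allI impI)
          fix i assume "i < length As"
          then consider "i = 0" | j where "i = Suc j" "j < n" | "i = Suc n"
            unfolding As_def by (cases i) (auto simp: less_Suc_eq)
          then show "\<omega> (0 + int i) \<in> As ! i"
            by cases (use * \<omega> in \<open>auto simp: As_def nth_append\<close>)
        qed
      qed
      then show ?thesis
        by (auto simp: spaceQ)
    qed
    finally have "emeasure Q (path_shift (- int (Suc n)) ` Z A' \<inter> Z B') = cylinder_prob (P \<tau>) As (\<rho> s)"
      using cyl[of As 0] in_restr by (simp add: As_def set_replicate_conv_if split: if_splits)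
    also have "\<dots> = (\<integral>\<^sup>+x. cylinder_prob (P \<tau>) (replicate n S @ [A']) (P \<tau> x) * indicator B' x \<partial>\<rho> s)"
      by (simp add: As_def)
    also have "\<dots> = (\<integral>\<^sup>+x. ennreal (indicator B x * measure (P (real (Suc n) * \<tau>) x) A) \<partial>\<rho> s)"
    proof (rule nn_integral_cong_AE)
      show "AE x in \<rho> s. cylinder_prob (P \<tau>) (replicate n S @ [A']) (P \<tau> x) * indicator B' x
          = ennreal (indicator B x * measure (P (real (Suc n) * \<tau>) x) A)"
        using cylinder_prob_supported[OF aeS \<open>S \<in> sets borel\<close> AB'(1), of n] ae[of "Suc n"] aeS
      proof eventually_elim
        case (elim x)
        interpret p: prob_space "P (real (Suc n) * \<tau>) x"
          by (simp del: of_nat_Suc)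
        have "emeasure (P (real (Suc n) * \<tau>) x) A' = emeasure (P (real (Suc n) * \<tau>) x) A"
        proof (rule emeasure_eq_AE)
          show "AE y in P (real (Suc n) * \<tau>) x. y \<in> A' \<longleftrightarrow> y \<in> A"
            using elim(2) by eventually_elim (simp add: A'_def)
        qed (use A in \<open>simp_all del: of_nat_Suc\<close>)
        then show ?case
          using elim by (simp add: p.emeasure_eq_measure B'_def split: split_indicator del: of_nat_Suc)
      qed
    qed
    also have "\<dots> = ennreal (\<integral>x. indicator B x * measure (P (real (Suc n) * \<tau>) x) A \<partial>\<rho> s)"
    proof (rule nn_integral_eq_integral)
      note [measurable] = measurable_prob_algebraD[OF P_kernel[OF periods_nonneg[of "Suc n"]]] A B
      have "(\<lambda>x. indicator B x * measure (P (real (Suc n) * \<tau>) x) A) \<in> borel_measurable (\<rho> s)"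
        by (simp del: of_nat_Suc)
      moreover have "norm (indicator B x * measure (P (real (Suc n) * \<tau>) x) A) \<le> 1" for x
        by (auto split: split_indicator intro!: prob_space.prob_le_1 simp del: of_nat_Suc)
      ultimately show "integrable (\<rho> s) (\<lambda>x. indicator B x * measure (P (real (Suc n) * \<tau>) x) A)"
        by (intro \<rho>.integrable_const_bound[where B=1] AE_I2) auto
    qed simp
    finally show ?thesis
      by (simp add: measure_def integral_nonneg_AE del: of_nat_Suc)
  qed
  have "(\<lambda>n. measure Q (path_shift (- int (Suc n)) ` Z A' \<inter> Z B')) \<longlonglongrightarrow> measure Q (Z A') * measure Q (Z B')"
    using lim[OF Z_sets Z_sets, OF in_restr(1,2)] by (rule LIMSEQ_Suc)
  moreover have "measure (\<rho> s) A' = measure (\<rho> s) A" "measure (\<rho> s) B' = measure (\<rho> s) B"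
    using aeS A B unfolding A'_def B'_def
    by (auto intro!: \<rho>.finite_measure_eq_AE elim!: AE_mp)
  ultimately have "(\<lambda>n. \<integral>x. indicator B x * measure (P (real (Suc n) * \<tau>) x) A \<partial>\<rho> s) \<longlonglongrightarrow> measure (\<rho> s) A * measure (\<rho> s) B"
    unfolding pair using Z_measure in_restr AB' by simp
  then show ?thesis
    by (rule LIMSEQ_imp_Suc)
qed


section \<open>Transition operators on bounded and on integrable functions\<close>

lemma transition_op_measurable [measurable]:
  assumes "f \<in> borel_measurable borel" and t: "0 \<le> t"
  shows "transition_op P t f \<in> borel_measurable borel"
  unfolding transition_op_def
  by (rule measurable_compose[OF measurable_prob_algebraD[OF P_kernel[OF t]]
        integral_measurable_subprob_algebra[OF assms(1)]])

lemma transition_op_scale: "transition_op P t (\<lambda>x. c * f x) x = c * transition_op P t f x"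
  by (simp add: transition_op_def)

lemma integrable_bounded:
  fixes f :: "'a \<Rightarrow> complex"
  assumes "\<mu> \<in> space (prob_algebra borel)" "f \<in> borel_measurable borel" "\<And>x. cmod (f x) \<le> C"
  shows "integrable \<mu> f"
proof -
  interpret prob_space \<mu>
    using assms by (simp add: space_prob_algebra)
  have "f \<in> borel_measurable \<mu>"
    using assms(1,2) measurable_cong_sets[of \<mu> borel borel "borel :: complex measure"]
    by (simp add: space_prob_algebra)
  then show ?thesis
    using assms(3) by (intro integrable_const_bound[where B=C]) auto
qed

lemma transition_op_bound:
  assumes f: "f \<in> borel_measurable borel" "\<And>x. cmod (f x) \<le> C" and t: "0 \<le> t"
  shows "cmod (transition_op P t f x) \<le> C"
proof -
  interpret prob_space "P t x"
    using t by simp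
  have "cmod (transition_op P t f x) \<le> (\<integral>y. cmod (f y) \<partial>P t x)"
    unfolding transition_op_def by (rule integral_norm_bound)
  also have "\<dots> \<le> C"
    using f t integrable_bounded[OF P_in f, of t x] by (intro integral_le_const) auto
  finally show ?thesis .
qed

lemma transition_op_add:
  assumes f: "f \<in> borel_measurable borel" "\<And>x. cmod (f x) \<le> C" and st: "0 \<le> s" "0 \<le> t"
  shows "transition_op P (s + t) f x = transition_op P s (transition_op P t f) x"
  unfolding transition_op_def
proof (subst P_add[OF st], rule integral_bind[where N=borel])
  show "prob_space (P s x)"
    using st by simp
  show "P t \<in> P s x \<rightarrow>\<^sub>M prob_algebra borel"
    using P_kernel[of t] st by (simp add: measurable_cong_sets[OF sets_P refl])
  show "integrable (P s x \<bind> P t) f"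
    using integrable_bounded[OF P_in f, of "s + t" x] st by (simp add: P_add[symmetric])
qed

text \<open>Measures move forward from \<open>\<rho> s\<close> to \<open>\<rho> (s + t)\<close>,
  hence functions move backward, from L1 of \<open>\<rho> (s + t)\<close> to L1 of
  \<open>\<rho> s\<close>, contractively and with the same integral.\<close>

lemma transition_op_\<rho>:
  fixes f :: "'a \<Rightarrow> complex"
  assumes f: "integrable (\<rho> (s + t)) f" and t: "0 \<le> t"
  shows "AE x in \<rho> s. integrable (P t x) f" and "integrable (\<rho> s) (transition_op P t f)"
    and "(\<integral>x. transition_op P t f x \<partial>\<rho> s) = (\<integral>x. f x \<partial>\<rho> (s + t))"
    and "(\<integral>x. cmod (transition_op P t f x) \<partial>\<rho> s) \<le> (\<integral>x. cmod (f x) \<partial>\<rho> (s + t))"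
proof -
  have f': "integrable (\<rho> s \<bind> P t) f"
    using f by (simp add: \<rho>_add t)
  note b = integrable_bind[OF prob_space_\<rho> P_kernel_\<rho>[OF t] f']
  show "AE x in \<rho> s. integrable (P t x) f"
    by (rule b(1))
  show i: "integrable (\<rho> s) (transition_op P t f)"
    using b(2) unfolding transition_op_def by simp
  show "(\<integral>x. transition_op P t f x \<partial>\<rho> s) = (\<integral>x. f x \<partial>\<rho> (s + t))"
    using integral_bind[OF prob_space_\<rho> P_kernel_\<rho>[OF t] f']
    by (simp add: transition_op_def \<rho>_add t)
  have "(\<integral>x. cmod (transition_op P t f x) \<partial>\<rho> s) \<le> (\<integral>x. (\<integral>y. cmod (f y) \<partial>P t x) \<partial>\<rho> s)"
    using integrable_norm[OF i] b(4) by (intro integral_mono) (auto simp: transition_op_def integral_norm_bound)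
  then show "(\<integral>x. cmod (transition_op P t f x) \<partial>\<rho> s) \<le> (\<integral>x. cmod (f x) \<partial>\<rho> (s + t))"
    using b(3) by (simp add: \<rho>_add t)
qed

lemma \<rho>_add_periods [simp]: "\<rho> (s + real k * \<tau>) = \<rho> s"
  using periodic_of_nat[of \<rho> s k] by (simp add: \<rho>_add_period)

lemmas transition_op_\<rho>_periods = transition_op_\<rho>[where t="real k * \<tau>" for k, simplified]

section \<open>Mixing as decorrelation of functions\<close>

lemma transition_op_indicator:
  assumes "0 \<le> t" "A \<in> sets borel"
  shows "transition_op P t (indicator A) x = complex_of_real (measure (P t x) A)"
proof -
  have "(indicator A :: 'a \<Rightarrow> complex) = (\<lambda>x. complex_of_real (indicator A x))"
    by (auto split: split_indicator)
  then have "transition_op P t (indicator A) x = complex_of_real (\<integral>y. indicator A y \<partial>P t x)"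
    unfolding transition_op_def by (simp only: integral_complex_of_real)
  moreover have "space (P t x) = UNIV"
    using sets_eq_imp_space_eq[OF sets_P[OF assms(1), of x]] by simp
  ultimately show ?thesis
    using assms by simp
qed

text \<open>Passage from sets to functions in the evolved slot; the L1 bound is uniform in k because
  \<open>\<rho> s\<close> is invariant under k periods. An eigenfunction is only known to be
  integrable, so it is tested against bounded functions, here indicators.\<close>

lemma mixing_indicator:
  assumes mix: "mixing_on (measure_support (\<rho> s)) (P \<tau>) (\<rho> s)"
    and B: "B \<in> sets borel" and f: "integrable (\<rho> s) f"
  shows "(\<lambda>k. \<integral>x. indicator B x * transition_op P (real k * \<tau>) f x \<partial>\<rho> s)
    \<longlonglongrightarrow> (\<integral>x. f x \<partial>\<rho> s) * complex_of_real (measure (\<rho> s) B)"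
  using _ _ _ _ _ _ _ f
proof (rule tendsto_functional_integrable[where C=1])
  interpret \<rho>: prob_space "\<rho> s" by simp
  have meas: "f \<in> borel_measurable borel" if "integrable (\<rho> s) f" for f :: "'a \<Rightarrow> complex"
    using borel_measurable_integrable[OF that] by simp
  have ibd: "integrable (\<rho> s) (\<lambda>x. indicator B x * transition_op P (real k * \<tau>) f x)"
    if "integrable (\<rho> s) f" for k f
  proof (rule Bochner_Integration.integrable_bound[OF transition_op_\<rho>_periods(2)[OF that, of k]])
    show "(\<lambda>x. indicator B x * transition_op P (real k * \<tau>) f x) \<in> borel_measurable (\<rho> s)"
      using meas[OF that] B by simp
  qed (auto split: split_indicator)
  fix k and f g :: "'a \<Rightarrow> complex" and c :: complex
  show "(\<integral>x. indicator B x * transition_op P (real k * \<tau>) (\<lambda>x. c * f x) x \<partial>\<rho> s) =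
      c * (\<integral>x. indicator B x * transition_op P (real k * \<tau>) f x \<partial>\<rho> s)"
    by (simp add: transition_op_scale mult.left_commute)
  show "(\<integral>x. c * f x \<partial>\<rho> s) * complex_of_real (measure (\<rho> s) B) =
      c * ((\<integral>x. f x \<partial>\<rho> s) * complex_of_real (measure (\<rho> s) B))"
    by simp
  assume f: "integrable (\<rho> s) f"
  show "cmod ((\<integral>x. f x \<partial>\<rho> s) * complex_of_real (measure (\<rho> s) B)) \<le> 1 * (\<integral>x. cmod (f x) \<partial>\<rho> s)"
    using mult_mono[OF integral_norm_bound[of "\<rho> s" f] \<rho>.prob_le_1[of B]] by (simp add: norm_mult)
  have "cmod (\<integral>x. indicator B x * transition_op P (real k * \<tau>) f x \<partial>\<rho> s) \<le>
      (\<integral>x. cmod (indicator B x * transition_op P (real k * \<tau>) f x) \<partial>\<rho> s)"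
    by (rule integral_norm_bound)
  also have "\<dots> \<le> (\<integral>x. cmod (transition_op P (real k * \<tau>) f x) \<partial>\<rho> s)"
    using ibd[OF f, of k] transition_op_\<rho>_periods(2)[OF f, of k]
    by (intro integral_mono integrable_norm) (auto split: split_indicator)
  also have "\<dots> \<le> (\<integral>x. cmod (f x) \<partial>\<rho> s)"
    by (rule transition_op_\<rho>_periods(4)[OF f])
  finally show "cmod (\<integral>x. indicator B x * transition_op P (real k * \<tau>) f x \<partial>\<rho> s) \<le> 1 * (\<integral>x. cmod (f x) \<partial>\<rho> s)"
    by simp
  assume g: "integrable (\<rho> s) g"
  show "(\<integral>x. f x + g x \<partial>\<rho> s) * complex_of_real (measure (\<rho> s) B) =
      (\<integral>x. f x \<partial>\<rho> s) * complex_of_real (measure (\<rho> s) B) + (\<integral>x. g x \<partial>\<rho> s) * complex_of_real (measure (\<rho> s) B)"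
    using f g by (simp add: distrib_right)
  have "(\<integral>x. indicator B x * transition_op P (real k * \<tau>) (\<lambda>x. f x + g x) x \<partial>\<rho> s) =
     (\<integral>x. indicator B x * transition_op P (real k * \<tau>) f x + indicator B x * transition_op P (real k * \<tau>) g x \<partial>\<rho> s)"
  proof (rule integral_cong_AE)
    show "AE x in \<rho> s. indicator B x * transition_op P (real k * \<tau>) (\<lambda>x. f x + g x) x =
       indicator B x * transition_op P (real k * \<tau>) f x + indicator B x * transition_op P (real k * \<tau>) g x"
      using transition_op_\<rho>_periods(1)[OF f, of k] transition_op_\<rho>_periods(1)[OF g, of k]
      by eventually_elim (simp add: transition_op_def distrib_left)
    show "(\<lambda>x. indicator B x * transition_op P (real k * \<tau>) (\<lambda>x. f x + g x) x) \<in> borel_measurable (\<rho> s)"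
      using borel_measurable_integrable[OF ibd[OF Bochner_Integration.integrable_add[OF f g], of k]] .
    show "(\<lambda>x. indicator B x * transition_op P (real k * \<tau>) f x + indicator B x * transition_op P (real k * \<tau>) g x) \<in> borel_measurable (\<rho> s)"
      using borel_measurable_integrable[OF ibd[OF f, of k]] borel_measurable_integrable[OF ibd[OF g, of k]]
      by (rule borel_measurable_add)
  qed
  then show "(\<integral>x. indicator B x * transition_op P (real k * \<tau>) (\<lambda>x. f x + g x) x \<partial>\<rho> s) =
     (\<integral>x. indicator B x * transition_op P (real k * \<tau>) f x \<partial>\<rho> s) + (\<integral>x. indicator B x * transition_op P (real k * \<tau>) g x \<partial>\<rho> s)"
    using ibd[OF f, of k] ibd[OF g, of k] by simp
next
  fix A assume "A \<in> sets (\<rho> s)"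
  then have A: "A \<in> sets borel" by simp
  have sp: "space (\<rho> s) = UNIV"
    using sets_eq_imp_space_eq[OF sets_\<rho>[of s]] by simp
  have ind: "(indicator A :: 'a \<Rightarrow> complex) x = complex_of_real (indicator A x)" for A x
    by (auto split: split_indicator)
  have "(\<integral>x. indicator B x * transition_op P (real k * \<tau>) (indicator A) x \<partial>\<rho> s) =
      complex_of_real (\<integral>x. indicator B x * measure (P (real k * \<tau>) x) A \<partial>\<rho> s)" for k
    by (simp only: transition_op_indicator[OF periods_nonneg A] ind[of B] of_real_mult[symmetric] integral_complex_of_real)
  moreover have "(\<integral>x. indicator A x \<partial>\<rho> s) = complex_of_real (measure (\<rho> s) A)"
    using A by (simp add: ind integral_complex_of_real sp)
  moreover have "(\<lambda>k. complex_of_real (\<integral>x. indicator B x * measure (P (real k * \<tau>) x) A \<partial>\<rho> s))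
      \<longlonglongrightarrow> complex_of_real (measure (\<rho> s) A * measure (\<rho> s) B)"
    by (rule tendsto_of_real[OF mixing_sets[OF mix A B]])
  ultimately show "(\<lambda>k. \<integral>x. indicator B x * transition_op P (real k * \<tau>) (indicator A) x \<partial>\<rho> s)
      \<longlonglongrightarrow> (\<integral>x. indicator A x \<partial>\<rho> s) * complex_of_real (measure (\<rho> s) B)"
    by simp
qed

text \<open>The roles are exchanged: the evolved function is bounded by \<open>C\<close>, and the
  integrable test function is the one approximated. The autocorrelations in the mean ergodic theorem
  have this form, the test function being the conjugate of the evolved one.\<close>

lemma mixing_bounded:
  assumes mix: "mixing_on (measure_support (\<rho> s)) (P \<tau>) (\<rho> s)"
    and f: "f \<in> borel_measurable borel" "\<And>x. cmod (f x) \<le> C" and h: "integrable (\<rho> s) h"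
  shows "(\<lambda>k. \<integral>x. h x * transition_op P (real k * \<tau>) f x \<partial>\<rho> s)
    \<longlonglongrightarrow> (\<integral>x. h x \<partial>\<rho> s) * (\<integral>x. f x \<partial>\<rho> s)"
  using _ _ _ _ _ _ _ h
proof (rule tendsto_functional_integrable[where C=C])
  have fi: "integrable (\<rho> s) f"
    using f by (intro integrable_bounded) auto
  have bd: "cmod (transition_op P (real k * \<tau>) f x) \<le> C" for k x
    using f by (intro transition_op_bound) auto
  have C: "0 \<le> C"
    using f(2) norm_ge_zero order_trans by blast
  have meas: "f \<in> borel_measurable borel" if "integrable (\<rho> s) f" for f :: "'a \<Rightarrow> complex"
    using borel_measurable_integrable[OF that] by simp
  have le: "cmod (h x * transition_op P (real k * \<tau>) f x) \<le> C * cmod (h x)" for h x k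
    using mult_right_mono[OF bd[of k x], of "cmod (h x)"] by (simp add: norm_mult mult.commute)
  have ibd: "integrable (\<rho> s) (\<lambda>x. h x * transition_op P (real k * \<tau>) f x)"
    if "integrable (\<rho> s) h" for k h
  proof (rule Bochner_Integration.integrable_bound)
    show "integrable (\<rho> s) (\<lambda>x. C * cmod (h x))"
      using that by simp
    show "(\<lambda>x. h x * transition_op P (real k * \<tau>) f x) \<in> borel_measurable (\<rho> s)"
      using meas[OF that] f by measurable
    show "AE x in \<rho> s. cmod (h x * transition_op P (real k * \<tau>) f x) \<le> norm (C * cmod (h x))"
      using le C by (intro AE_I2) auto
  qed
  fix k and h g :: "'a \<Rightarrow> complex" and c :: complex
  show "(\<integral>x. c * h x * transition_op P (real k * \<tau>) f x \<partial>\<rho> s) = c * (\<integral>x. h x * transition_op P (real k * \<tau>) f x \<partial>\<rho> s)"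
    by (simp add: mult.assoc)
  show "(\<integral>x. c * h x \<partial>\<rho> s) * (\<integral>x. f x \<partial>\<rho> s) = c * ((\<integral>x. h x \<partial>\<rho> s) * (\<integral>x. f x \<partial>\<rho> s))"
    by simp
  assume h: "integrable (\<rho> s) h"
  have "cmod (\<integral>x. h x * transition_op P (real k * \<tau>) f x \<partial>\<rho> s) \<le> (\<integral>x. cmod (h x * transition_op P (real k * \<tau>) f x) \<partial>\<rho> s)"
    by (rule integral_norm_bound)
  also have "\<dots> \<le> (\<integral>x. C * cmod (h x) \<partial>\<rho> s)"
    using ibd[OF h, of k] h le by (intro integral_mono integrable_norm) auto
  finally show "cmod (\<integral>x. h x * transition_op P (real k * \<tau>) f x \<partial>\<rho> s) \<le> C * (\<integral>x. cmod (h x) \<partial>\<rho> s)"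
    by simp
  interpret \<rho>: prob_space "\<rho> s" by simp
  have "cmod (\<integral>x. f x \<partial>\<rho> s) \<le> C"
    using fi f by (intro order_trans[OF integral_norm_bound] \<rho>.integral_le_const) auto
  moreover have "cmod (\<integral>x. h x \<partial>\<rho> s) \<le> (\<integral>x. cmod (h x) \<partial>\<rho> s)"
    by (rule integral_norm_bound)
  ultimately show "cmod ((\<integral>x. h x \<partial>\<rho> s) * (\<integral>x. f x \<partial>\<rho> s)) \<le> C * (\<integral>x. cmod (h x) \<partial>\<rho> s)"
    unfolding norm_mult using C by (subst mult.commute) (intro mult_mono, auto)
  assume g: "integrable (\<rho> s) g"
  show "(\<integral>x. h x + g x \<partial>\<rho> s) * (\<integral>x. f x \<partial>\<rho> s) =
     (\<integral>x. h x \<partial>\<rho> s) * (\<integral>x. f x \<partial>\<rho> s) + (\<integral>x. g x \<partial>\<rho> s) * (\<integral>x. f x \<partial>\<rho> s)"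
    using g h by (simp add: distrib_right)
  show "(\<integral>x. (h x + g x) * transition_op P (real k * \<tau>) f x \<partial>\<rho> s) =
     (\<integral>x. h x * transition_op P (real k * \<tau>) f x \<partial>\<rho> s) + (\<integral>x. g x * transition_op P (real k * \<tau>) f x \<partial>\<rho> s)"
    using ibd[OF h, of k] ibd[OF g, of k] by (simp add: distrib_right)
next
  fix A assume "A \<in> sets (\<rho> s)"
  then have A: "A \<in> sets borel" by simp
  have sp: "space (\<rho> s) = UNIV"
    using sets_eq_imp_space_eq[OF sets_\<rho>[of s]] by simp
  have ind: "(indicator A :: 'a \<Rightarrow> complex) x = complex_of_real (indicator A x)" for A x
    by (auto split: split_indicator)
  have "(\<integral>x. indicator A x \<partial>\<rho> s) = complex_of_real (measure (\<rho> s) A)"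
    using A by (simp add: ind integral_complex_of_real sp)
  moreover have "integrable (\<rho> s) f"
    using f by (intro integrable_bounded) auto
  ultimately show "(\<lambda>k. \<integral>x. indicator A x * transition_op P (real k * \<tau>) f x \<partial>\<rho> s)
      \<longlonglongrightarrow> (\<integral>x. indicator A x \<partial>\<rho> s) * (\<integral>x. f x \<partial>\<rho> s)"
    using mixing_indicator[OF mix A, of f] by (simp add: mult.commute)
qed

text \<open>For an eigenfunction the correlation with a set \<open>B\<close> after k periods is z^k
  times the integral of \<open>f\<close> over \<open>B\<close>. If z = 1 this sequence is constant,
  so \<open>f\<close> has the set integrals of its mean. Otherwise invariance forces the mean to be
  0, and since the modulus of the sequence is constant, every set integral is 0.\<close>

lemma mixing_eigenfunction_const:
  assumes mix: "mixing_on (measure_support (\<rho> s)) (P \<tau>) (\<rho> s)"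
    and f: "integrable (\<rho> s) f" and z: "cmod z = 1"
    and eig: "\<And>k. AE x in \<rho> s. transition_op P (real k * \<tau>) f x = z ^ k * f x"
  shows "AE x in \<rho> s. f x = (\<integral>y. f y \<partial>\<rho> s)" and "z \<noteq> 1 \<Longrightarrow> (\<integral>y. f y \<partial>\<rho> s) = 0"
proof -
  interpret \<rho>: prob_space "\<rho> s" by simp
  have [measurable]: "f \<in> borel_measurable borel"
    using borel_measurable_integrable[OF f] by simp
  define m where "m = (\<integral>y. f y \<partial>\<rho> s)"
  have "m = (\<integral>x. transition_op P (real 1 * \<tau>) f x \<partial>\<rho> s)"
    using transition_op_\<rho>_periods(3)[of s f 1] f by (simp add: m_def)
  also have "\<dots> = (\<integral>x. z * f x \<partial>\<rho> s)"
    using eig[of 1] period_pos by (intro integral_cong_AE) auto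
  finally have m: "m = z * m"
    by (simp add: m_def)
  then show zm: "(\<integral>y. f y \<partial>\<rho> s) = 0" if "z \<noteq> 1"
    using that by (simp add: m_def)
  have B: "(\<integral>x. indicator B x * f x \<partial>\<rho> s) = m * complex_of_real (measure (\<rho> s) B)" if B [measurable]: "B \<in> sets borel" for B
  proof -
    let ?b = "\<integral>x. indicator B x * f x \<partial>\<rho> s"
    have "(\<integral>x. indicator B x * transition_op P (real k * \<tau>) f x \<partial>\<rho> s) = (\<integral>x. z ^ k * (indicator B x * f x) \<partial>\<rho> s)" for k
    proof (rule integral_cong_AE)
      show "AE x in \<rho> s. indicator B x * transition_op P (real k * \<tau>) f x = z ^ k * (indicator B x * f x)"
        using eig[of k] by eventually_elim (simp add: mult_ac)
    qed simp_all
    then have lim: "(\<lambda>k. z ^ k * ?b) \<longlonglongrightarrow> m * complex_of_real (measure (\<rho> s) B)"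
      using mixing_indicator[OF mix B f] by (simp add: m_def)
    show ?thesis
    proof (cases "z = 1")
      case True
      then show ?thesis
        using lim by (simp add: LIMSEQ_const_iff)
    next
      case False
      then have "m = 0"
        using zm by (simp add: m_def)
      then have "(\<lambda>k. cmod (z ^ k * ?b)) \<longlonglongrightarrow> 0"
        using tendsto_norm[OF lim] by simp
      then show ?thesis
        using \<open>m = 0\<close> by (simp add: norm_mult norm_power z LIMSEQ_const_iff)
    qed
  qed
  have sp: "space (\<rho> s) = UNIV"
    using sets_eq_imp_space_eq[OF sets_\<rho>[of s]] by simp
  have "AE x in \<rho> s. f x - m = 0"
  proof (rule \<rho>.density_zero)
    show "integrable (\<rho> s) (\<lambda>x. f x - m)"
      using f by simp
    fix A assume "A \<in> sets (\<rho> s)"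
    then have A [measurable]: "A \<in> sets borel" by simp
    have i1: "integrable (\<rho> s) (\<lambda>x. indicator A x * f x)"
      by (rule Bochner_Integration.integrable_bound[OF f]) (auto split: split_indicator)
    have i2: "integrable (\<rho> s) (indicator A :: 'a \<Rightarrow> real)"
      by (auto intro!: \<rho>.integrable_const_bound[where B=1] split: split_indicator)
    have "set_lebesgue_integral (\<rho> s) A (\<lambda>x. f x - m) = (\<integral>x. indicator A x * f x - indicator A x *\<^sub>R m \<partial>\<rho> s)"
      unfolding set_lebesgue_integral_def
      by (intro Bochner_Integration.integral_cong) (auto split: split_indicator)
    also have "\<dots> = (\<integral>x. indicator A x * f x \<partial>\<rho> s) - (\<integral>x. indicator A x *\<^sub>R m \<partial>\<rho> s)"
      using i1 i2 by (intro Bochner_Integration.integral_diff) auto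
    also have "(\<integral>x. indicator A x *\<^sub>R m \<partial>\<rho> s) = measure (\<rho> s) A *\<^sub>R m"
      using i2 by (subst integral_scaleR_left) (auto simp: sp)
    finally show "set_lebesgue_integral (\<rho> s) A (\<lambda>x. f x - m) = 0"
      using B[OF A] by (simp add: scaleR_conv_of_real mult.commute)
  qed
  then show "AE x in \<rho> s. f x = (\<integral>y. f y \<partial>\<rho> s)"
    by (simp add: m_def)
qed


section \<open>The mean ergodic theorem over periods\<close>

lemma transition_op_0:
  assumes "f \<in> borel_measurable borel"
  shows "transition_op P 0 f x = f x"
  using assms by (simp add: transition_op_def P_0 integral_return)

lemma cmod_transition_op_squared_le:
  assumes f: "f \<in> borel_measurable borel" "\<And>x. cmod (f x) \<le> C" and t: "0 \<le> t"
  shows "(cmod (transition_op P t f x))\<^sup>2 \<le> (\<integral>y. (cmod (f y))\<^sup>2 \<partial>P t x)"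
proof -
  interpret prob_space "P t x"
    using t by simp
  have "integrable (P t x) (\<lambda>y. (cmod (f y))\<^sup>2)"
    using f t by (intro integrable_const_bound[where B="C\<^sup>2"]) (auto intro!: power_mono)
  then have "ennreal ((cmod (transition_op P t f x))\<^sup>2) \<le> ennreal (\<integral>y. (cmod (f y))\<^sup>2 \<partial>P t x)"
    unfolding transition_op_def
    using f t by (subst nn_integral_eq_integral[symmetric]) (auto intro!: cmod_integral_squared_le)
  then show ?thesis
    by (simp add: integral_nonneg_AE)
qed

text \<open>
  Only weak convergence of \<open>P (k \<tau>) f\<close> is available. Expanding
  \<open>\<parallel>S (K + 1)\<parallel>\<^sup>2\<close> for \<open>S (K + 1) = g + P \<tau> (S K)\<close> bounds the partial sums of a centred \<open>g\<close>
  by its autocorrelations, which tend to zero; this gives strong convergence of the averages.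
\<close>

lemma mean_ergodic:
  assumes mix: "mixing_on (measure_support (\<rho> s)) (P \<tau>) (\<rho> s)"
    and f: "f \<in> borel_measurable borel" "\<And>x. cmod (f x) \<le> C"
  defines "m \<equiv> \<integral>x. f x \<partial>\<rho> s"
  shows "(\<lambda>K. \<integral>x. (cmod ((\<Sum>j<K. transition_op P (real j * \<tau>) f x) / of_nat K - m))\<^sup>2 \<partial>\<rho> s) \<longlonglongrightarrow> 0"
proof -
  interpret \<rho>: prob_space "\<rho> s" by simp
  note [measurable] = f(1)
  define T where "T j = transition_op P (real j * \<tau>)" for j
  define g where "g x = f x - m" for x
  have g_meas [measurable]: "g \<in> borel_measurable borel"
    unfolding g_def by measurable
  have fi: "integrable (\<rho> s) f"
    using f by (intro integrable_bounded) auto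
  have "cmod m \<le> C"
    unfolding m_def using fi f by (intro order_trans[OF integral_norm_bound] \<rho>.integral_le_const) auto
  \<comment> \<open>Both |f| and |m| are at most \<open>C\<close>, so \<open>D\<close> bounds the
    centred function.\<close>
  define D where "D = 2 * C"
  have [measurable]: "(\<lambda>x. cnj (g x)) \<in> borel_measurable borel"
    by (rule measurable_compose[OF g_meas borel_measurable_continuous_onI]) (intro continuous_intros)
  have gD: "cmod (g x) \<le> D" for x
    unfolding g_def D_def using norm_triangle_ineq4[of "f x" m] f(2)[of x] \<open>cmod m \<le> C\<close> by linarith
  then have D: "0 \<le> D"
    using norm_ge_zero order_trans by blast
  have T_meas [measurable]: "T j h \<in> borel_measurable borel" if "h \<in> borel_measurable borel" for j h
    unfolding T_def using that by simp
  have TD: "cmod (T j g x) \<le> D" for j x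
    unfolding T_def using gD by (intro transition_op_bound) auto
  have Tg: "T j g x = T j f x - m" for j x
  proof -
    interpret p: prob_space "P (real j * \<tau>) x" by simp
    have "integrable (P (real j * \<tau>) x) f"
      using f by (intro integrable_bounded) auto
    then show ?thesis
      by (simp add: T_def transition_op_def g_def p.prob_space)
  qed
  define S where "S K x = (\<Sum>j<K. T j g x)" for K x
  have S_meas [measurable]: "S K \<in> borel_measurable borel" for K
    unfolding S_def by measurable
  have SD: "cmod (S K x) \<le> real K * D" for K x
    unfolding S_def using sum_norm_bound[of "{..<K}" "\<lambda>j. T j g x" D] TD by simp
  have TT: "T 1 (T j g) x = T (Suc j) g x" for j x
  proof -
    have "transition_op P (real 1 * \<tau> + real j * \<tau>) g x = T 1 (T j g) x"
      unfolding T_def using gD by (intro transition_op_add) auto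
    then show ?thesis
      by (simp add: T_def algebra_simps)
  qed
  have TS: "T 1 (S K) x = (\<Sum>j<K. T (Suc j) g x)" for K x
  proof -
    have "integrable (P (real 1 * \<tau>) x) (T j g)" for j
      using TD by (intro integrable_bounded) auto
    then have "T 1 (S K) x = (\<Sum>j<K. T 1 (T j g) x)"
      unfolding S_def T_def[of 1] by (subst transition_op_def) (simp add: transition_op_def[of P \<tau>])
    then show ?thesis
      by (simp only: TT)
  qed
  \<comment> \<open>The term j = 0 is \<open>g\<close> itself, and the remaining terms are one
    period applied to the previous partial sum.\<close>
  have Suc_S: "S (Suc K) x = g x + T 1 (S K) x" for K x
    unfolding TS by (simp add: S_def sum.lessThan_Suc_shift T_def transition_op_0 del: sum.lessThan_Suc of_nat_Suc)
  define a where "a K = (\<integral>x. (cmod (S K x))\<^sup>2 \<partial>\<rho> s)" for K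
  define c where "c j = (\<integral>x. cnj (g x) * T j g x \<partial>\<rho> s)" for j
  have gi: "integrable (\<rho> s) g"
    using gD by (intro integrable_bounded) auto
  have "(\<integral>x. g x \<partial>\<rho> s) = 0"
    using fi by (simp add: g_def m_def \<rho>.prob_space)
  then have "c \<longlonglongrightarrow> 0"
    using mixing_bounded[OF mix g_meas gD, of "\<lambda>x. cnj (g x)"] gi by (simp add: c_def[abs_def] T_def)
  then have c0: "(\<lambda>j. cmod (c (Suc j))) \<longlonglongrightarrow> 0"
    using tendsto_norm_zero LIMSEQ_Suc by blast
  \<comment> \<open>A bound for the increments of \<open>a\<close>: the square of \<open>g\<close>
    contributes at most D^2 and the cross terms twice the autocorrelations, while the evolved sum
    contributes at most \<open>a K\<close> by contraction and invariance.\<close>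
  define b where "b K = D\<^sup>2 + 2 * (\<Sum>j<K. cmod (c (Suc j)))" for K
  have sq_int: "integrable \<mu> (\<lambda>x. (cmod (h x))\<^sup>2)"
    if "\<mu> \<in> space (prob_algebra borel)" "h \<in> borel_measurable borel" "\<And>x. cmod (h x) \<le> E"
    for \<mu> and h :: "'a \<Rightarrow> complex" and E
  proof -
    interpret prob_space \<mu>
      using that by (simp add: space_prob_algebra)
    have "h \<in> borel_measurable \<mu>"
      using that(1,2) measurable_cong_sets[of \<mu> borel borel "borel :: complex measure"]
      by (simp add: space_prob_algebra)
    then show ?thesis
      using that(3) by (intro integrable_const_bound[where B="E\<^sup>2"]) (auto intro!: power_mono)
  qed
  have step: "a (Suc K) \<le> a K + b K" for K
  proof -
    have i1: "integrable (\<rho> s) (\<lambda>x. (cmod (g x))\<^sup>2)"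
      using gD by (intro sq_int) auto
    have TSD: "cmod (T 1 (S K) x) \<le> real K * D" for x
      unfolding T_def using SD by (intro transition_op_bound) auto
    have i2: "integrable (\<rho> s) (\<lambda>x. (cmod (T 1 (S K) x))\<^sup>2)"
      using TSD by (intro sq_int) auto
    have i3: "integrable (\<rho> s) (\<lambda>x. cnj (g x) * T j g x)" for j
    proof (rule integrable_bounded)
      show "cmod (cnj (g x) * T j g x) \<le> D * D" for x
        unfolding norm_mult complex_mod_cnj using gD TD D by (intro mult_mono) auto
    qed auto
    have eq: "(cmod (S (Suc K) x))\<^sup>2 = (cmod (g x))\<^sup>2 + 2 * (\<Sum>j<K. Re (cnj (g x) * T (Suc j) g x)) + (cmod (T 1 (S K) x))\<^sup>2" for x
    proof -
      have "(cmod (u + v))\<^sup>2 = (cmod u)\<^sup>2 + 2 * Re (cnj u * v) + (cmod v)\<^sup>2" for u v :: complex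
        unfolding cmod_power2 by (simp add: power2_eq_square algebra_simps)
      moreover have "Re (cnj (g x) * T 1 (S K) x) = (\<Sum>j<K. Re (cnj (g x) * T (Suc j) g x))"
        unfolding TS by (simp only: sum_distrib_left Re_sum)
      ultimately show ?thesis
        unfolding Suc_S by simp
    qed
    have "a (Suc K) = (\<integral>x. (cmod (g x))\<^sup>2 \<partial>\<rho> s) + 2 * (\<Sum>j<K. Re (c (Suc j))) + (\<integral>x. (cmod (T 1 (S K) x))\<^sup>2 \<partial>\<rho> s)"
    proof -
      define r where "r j x = Re (cnj (g x) * T (Suc j) g x)" for j x
      have "integrable (\<rho> s) (r j)" "(\<integral>x. r j x \<partial>\<rho> s) = Re (c (Suc j))" for j
        unfolding r_def c_def using integrable_Re[OF i3] integral_Re[OF i3] by blast+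
      then show ?thesis
        unfolding a_def eq r_def[symmetric] using i1 i2 by simp
    qed
    also have "(\<integral>x. (cmod (g x))\<^sup>2 \<partial>\<rho> s) \<le> D\<^sup>2"
      using i1 gD by (intro \<rho>.integral_le_const) (auto intro!: power_mono)
    also have "(\<Sum>j<K. Re (c (Suc j))) \<le> (\<Sum>j<K. cmod (c (Suc j)))"
      by (intro sum_mono complex_Re_le_cmod)
    also have "(\<integral>x. (cmod (T 1 (S K) x))\<^sup>2 \<partial>\<rho> s) \<le> (\<integral>x. (\<integral>y. (cmod (S K y))\<^sup>2 \<partial>P (real 1 * \<tau>) x) \<partial>\<rho> s)"
    proof (rule integral_mono[OF i2])
      show "(cmod (T 1 (S K) x))\<^sup>2 \<le> (\<integral>y. (cmod (S K y))\<^sup>2 \<partial>P (real 1 * \<tau>) x)" for x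
        unfolding T_def using SD by (intro cmod_transition_op_squared_le) auto
      show "integrable (\<rho> s) (\<lambda>x. \<integral>y. (cmod (S K y))\<^sup>2 \<partial>P (real 1 * \<tau>) x)"
        using SD by (intro integrable_bind(2)[OF prob_space_\<rho> P_kernel_\<rho>[OF periods_nonneg]])
          (auto simp only: \<rho>_bind_period intro!: sq_int \<rho>_in S_meas)
    qed
    also have "(\<integral>x. (\<integral>y. (cmod (S K y))\<^sup>2 \<partial>P (real 1 * \<tau>) x) \<partial>\<rho> s) = a K"
      unfolding a_def using SD
      by (subst integral_bind[OF prob_space_\<rho> P_kernel_\<rho>[OF periods_nonneg], symmetric])
        (auto simp only: \<rho>_bind_period intro!: sq_int \<rho>_in S_meas)
    finally show ?thesis
      by (simp add: b_def)
  qed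
  \<comment> \<open>\<open>b\<close> is increasing, so adding up the increments gives this bound.
    Division by K^2 leaves D^2 / K and a Cesaro mean of the autocorrelations.\<close>
  have "a K \<le> real K * b K" for K
  proof (induction K)
    case 0
    show ?case by (simp add: a_def S_def)
  next
    case (Suc K)
    have "a (Suc K) \<le> a K + b K"
      by (rule step)
    also have "\<dots> \<le> real (Suc K) * b K"
      using Suc by (simp add: algebra_simps)
    also have "\<dots> \<le> real (Suc K) * b (Suc K)"
      by (intro mult_left_mono) (auto simp: b_def)
    finally show ?case .
  qed
  then have aK: "a K / (real K)\<^sup>2 \<le> b K / real K" for K
    by (cases "K = 0") (auto simp: power2_eq_square divide_simps mult.commute)
  have "(\<lambda>K. D\<^sup>2 / real K + 2 * ((\<Sum>j<K. cmod (c (Suc j))) / real K)) \<longlonglongrightarrow> 0 + 2 * 0"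
    by (intro tendsto_add tendsto_mult tendsto_const Cesaro_zero c0 lim_const_over_n) auto
  then have b0: "(\<lambda>K. b K / real K) \<longlonglongrightarrow> 0"
    by (simp add: b_def add_divide_distrib)
  have a0: "0 \<le> a K / (real K)\<^sup>2" for K
    by (simp add: a_def)
  have "(\<lambda>K. a K / (real K)\<^sup>2) \<longlonglongrightarrow> 0"
    by (rule tendsto_sandwich[OF always_eventually[OF allI] always_eventually[OF allI] tendsto_const b0])
      (rule a0, rule aK)
  moreover have "\<forall>\<^sub>F K in sequentially. a K / (real K)\<^sup>2 =
      (\<integral>x. (cmod ((\<Sum>j<K. transition_op P (real j * \<tau>) f x) / of_nat K - m))\<^sup>2 \<partial>\<rho> s)"
    using eventually_gt_at_top[of 0]
  proof eventually_elim
    case (elim K)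
    have "(\<Sum>j<K. transition_op P (real j * \<tau>) f x) / of_nat K - m = S K x / of_nat K" for x
      using elim by (simp add: S_def Tg sum_subtractf diff_divide_distrib flip: T_def)
    then show ?case
      by (simp add: a_def norm_divide power_divide)
  qed
  ultimately show ?thesis
    by (rule Lim_transform_eventually)
qed

end

section \<open>Imaginary eigenvalues of the generator\<close>

lemma exp_difference_quotient:
  fixes z :: complex
  shows "((\<lambda>h. (exp (z * of_real h) - 1) / of_real h) \<longlongrightarrow> z) (at_right 0)"
proof -
  have "((\<lambda>w. exp (z * w)) has_field_derivative z) (at 0)"
    by (auto intro!: derivative_eq_intros)
  then have "((\<lambda>w. (exp (z * w) - 1) / w) \<longlongrightarrow> z) (at 0)"
    by (simp add: has_field_derivative_iff)
  moreover have "filterlim (\<lambda>h::real. complex_of_real h) (at 0) (at_right 0)"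
    unfolding filterlim_at
  proof
    show "\<forall>\<^sub>F h in at_right 0. complex_of_real h \<in> UNIV \<and> complex_of_real h \<noteq> 0"
      using eventually_at_right_less[of 0] by eventually_elim simp
    show "(complex_of_real \<longlongrightarrow> 0) (at_right 0)"
      using tendsto_of_real[OF tendsto_ident_at[of "0::real" "{0<..}"]] by simp
  qed
  ultimately show ?thesis
    by (rule filterlim_compose)
qed

section \<open>Calculus of the squared L2 norm\<close>

lemma L2_normsq_scale:
  assumes "f \<in> borel_measurable \<mu>"
  shows "L2_normsq \<mu> (\<lambda>x. c * f x) = ennreal ((cmod c)\<^sup>2) * L2_normsq \<mu> f"
  unfolding L2_normsq_def
  using assms by (simp add: norm_mult power_mult_distrib ennreal_mult nn_integral_cmult)

lemma L2_normsq_cong_AE: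
  "AE x in \<mu>. f x = g x \<Longrightarrow> L2_normsq \<mu> f = L2_normsq \<mu> g"
  unfolding L2_normsq_def by (rule nn_integral_cong_AE) auto

text \<open>Cauchy--Schwarz against the constant 1. The factor n is affordable later: n increments
  of size o(h) with h = t / n have total squared norm n^2 o(h^2), which tends to 0.\<close>

lemma L2_normsq_sum_le:
  assumes [measurable]: "\<And>j. f j \<in> borel_measurable \<mu>"
  shows "L2_normsq \<mu> (\<lambda>x. \<Sum>j<n. f j x) \<le> of_nat n * (\<Sum>j<n. L2_normsq \<mu> (f j))"
proof -
  have "(cmod (\<Sum>j<n. f j x))\<^sup>2 \<le> real n * (\<Sum>j<n. (cmod (f j x))\<^sup>2)" for x
  proof -
    have "(cmod (\<Sum>j<n. f j x))\<^sup>2 \<le> (\<Sum>j<n. cmod (f j x))\<^sup>2"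
      by (intro power_mono norm_sum) auto
    also have "\<dots> \<le> (\<Sum>j<n. 1\<^sup>2) * (\<Sum>j<n. (cmod (f j x))\<^sup>2)"
      using Cauchy_Schwarz_ineq_sum[of "\<lambda>_. 1" "\<lambda>j. cmod (f j x)" "{..<n}"] by simp
    finally show ?thesis by simp
  qed
  then have "L2_normsq \<mu> (\<lambda>x. \<Sum>j<n. f j x) \<le> (\<integral>\<^sup>+x. ennreal (real n * (\<Sum>j<n. (cmod (f j x))\<^sup>2)) \<partial>\<mu>)"
    unfolding L2_normsq_def by (intro nn_integral_mono ennreal_leI)
  also have "\<dots> = (\<integral>\<^sup>+x. of_nat n * (\<Sum>j<n. ennreal ((cmod (f j x))\<^sup>2)) \<partial>\<mu>)"
    by (intro nn_integral_cong) (simp add: ennreal_mult sum_nonneg sum_ennreal ennreal_of_nat_eq_real_of_nat)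
  also have "\<dots> = of_nat n * (\<Sum>j<n. L2_normsq \<mu> (f j))"
    by (simp add: L2_normsq_def nn_integral_cmult nn_integral_sum del: sum_ennreal)
  finally show ?thesis .
qed

lemma L2_normsq_add_le:
  assumes [measurable]: "f \<in> borel_measurable \<mu>" "g \<in> borel_measurable \<mu>"
  shows "L2_normsq \<mu> (\<lambda>x. f x + g x) \<le> 2 * L2_normsq \<mu> f + 2 * L2_normsq \<mu> g"
proof -
  define F where "F j = (if j = 0 then f else g)" for j :: nat
  have [measurable]: "F j \<in> borel_measurable \<mu>" for j
    by (simp add: F_def)
  show ?thesis
  proof -
    have "{..<2::nat} = {0, 1}" by auto
    with L2_normsq_sum_le[of F \<mu> 2] show ?thesis
      by (simp add: F_def distrib_left)
  qed
qed

lemma L2_normsq_eq_0: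
  assumes "f \<in> borel_measurable \<mu>" "L2_normsq \<mu> f = 0"
  shows "AE x in \<mu>. f x = 0"
  using assms unfolding L2_normsq_def by (subst (asm) nn_integral_0_iff_AE) auto

context periodic_chain
begin

lemma L2_fun_\<rho>barD:
  assumes "f \<in> L2_fun \<rho>bar"
  shows "f \<in> borel_measurable borel" "L2_normsq \<rho>bar f < \<infinity>" "integrable \<rho>bar f"
proof -
  have f: "f \<in> borel_measurable \<rho>bar" and N: "L2_normsq \<rho>bar f < \<infinity>"
    using assms unfolding L2_fun_def by blast+
  then show "f \<in> borel_measurable borel" "L2_normsq \<rho>bar f < \<infinity>"
    by simp_all
  show "integrable \<rho>bar f"
    using prob_space.integrable_square_cmod[OF prob_space_\<rho>bar f] N unfolding L2_normsq_def .
qed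

lemma P_kernel_\<rho>bar: "0 \<le> t \<Longrightarrow> P t \<in> \<rho>bar \<rightarrow>\<^sub>M prob_algebra borel"
  using P_kernel[of t] by (simp add: measurable_cong_sets[OF sets_\<rho>bar refl])

lemma AE_integrable_P:
  assumes "integrable \<rho>bar (f :: 'a \<Rightarrow> complex)" "0 \<le> t"
  shows "AE x in \<rho>bar. integrable (P t x) f"
  using integrable_bind(1)[OF prob_space_\<rho>bar P_kernel_\<rho>bar, of t f] assms by (simp add: bind_\<rho>bar_P)

text \<open>For unbounded \<open>f\<close> the composition law is justified at points where
  \<open>f\<close> is integrable after the total time; invariance of \<open>\<rho>bar\<close> makes
  these almost all points.\<close>

lemma transition_op_add_AE:
  assumes "integrable \<rho>bar f" "0 \<le> s" "0 \<le> t"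
  shows "AE x in \<rho>bar. transition_op P (s + t) f x = transition_op P s (transition_op P t f) x"
  using AE_integrable_P[OF assms(1) add_nonneg_nonneg[OF assms(2,3)]]
proof eventually_elim
  case (elim x)
  show ?case
    unfolding transition_op_def
  proof (subst P_add[OF assms(2,3)], rule integral_bind[where N=borel])
    show "prob_space (P s x)"
      using assms by simp
    show "P t \<in> P s x \<rightarrow>\<^sub>M prob_algebra borel"
      using P_kernel[of t] assms by (simp add: measurable_cong_sets[OF sets_P refl])
    show "integrable (P s x \<bind> P t) f"
      using elim by (simp add: P_add[OF assms(2,3), symmetric])
  qed
qed

text \<open>Jensen under each kernel, followed by invariance of \<open>\<rho>bar\<close>.\<close>

lemma L2_normsq_transition_op_le:
  assumes [measurable]: "f \<in> borel_measurable borel" and t: "0 \<le> t"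
  shows "L2_normsq \<rho>bar (transition_op P t f) \<le> L2_normsq \<rho>bar f"
proof -
  have "L2_normsq \<rho>bar (transition_op P t f) \<le> (\<integral>\<^sup>+x. (\<integral>\<^sup>+y. ennreal ((cmod (f y))\<^sup>2) \<partial>P t x) \<partial>\<rho>bar)"
    unfolding L2_normsq_def transition_op_def
    using t by (intro nn_integral_mono prob_space.cmod_integral_squared_le) auto
  also have "\<dots> = L2_normsq \<rho>bar f"
    unfolding L2_normsq_def using t by (intro nn_integral_\<rho>bar_P) auto
  finally show ?thesis .
qed

lemma transition_op_in_L2:
  assumes "f \<in> L2_fun \<rho>bar" "0 \<le> t"
  shows "transition_op P t f \<in> L2_fun \<rho>bar"
  using order_le_less_trans[OF L2_normsq_transition_op_le[OF L2_fun_\<rho>barD(1)[OF assms(1)] assms(2)] L2_fun_\<rho>barD(2)[OF assms(1)]]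
    transition_op_measurable[OF L2_fun_\<rho>barD(1)[OF assms(1)] assms(2)]
  by (simp add: L2_fun_def)

text \<open>The curve exp (- z h) P(h) \<phi> has right derivative 0 at h = 0. Since z is imaginary,
  the exponential factor does not change norms.\<close>

lemma generator_eigen_tendsto:
  assumes gen: "generator P \<rho>bar \<phi> (\<lambda>x. z * \<phi> x)" and z: "Re z = 0"
  shows "((\<lambda>h. L2_normsq \<rho>bar (\<lambda>x. (exp (- z * of_real h) * transition_op P h \<phi> x - \<phi> x) / of_real h)) \<longlongrightarrow> 0) (at_right 0)"
proof -
  have \<phi>: "\<phi> \<in> L2_fun \<rho>bar"
    and lim: "((\<lambda>t. L2_normsq \<rho>bar (\<lambda>x. (transition_op P t \<phi> x - \<phi> x) / of_real t - z * \<phi> x)) \<longlongrightarrow> 0) (at_right 0)"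
    using gen unfolding generator_def by blast+
  note [measurable] = L2_fun_\<rho>barD(1)[OF \<phi>]
  define N where "N = L2_normsq \<rho>bar"
  \<comment> \<open>The coefficient of \<phi> left over once the generator defect is split off; it
    tends to z - z = 0.\<close>
  define \<kappa> where "\<kappa> h = exp (- z * of_real h) * z + (exp (- z * of_real h) - 1) / of_real h" for h
  have exp1: "((\<lambda>h. exp (- z * of_real h)) \<longlongrightarrow> exp (- z * of_real 0)) (at_right 0)"
    by (intro tendsto_intros)
  have "(\<kappa> \<longlongrightarrow> 1 * z + - z) (at_right 0)"
    unfolding \<kappa>_def[abs_def] using exp1 exp_difference_quotient[of "- z"] by (intro tendsto_intros) auto
  then have "((\<lambda>h. (cmod (\<kappa> h))\<^sup>2) \<longlongrightarrow> (cmod 0)\<^sup>2) (at_right 0)"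
    by (intro tendsto_intros) simp
  then have "((\<lambda>h. ennreal ((cmod (\<kappa> h))\<^sup>2)) \<longlongrightarrow> 0) (at_right 0)"
    using tendsto_ennrealI by fastforce
  moreover have "N \<phi> < \<infinity>"
    using L2_fun_\<rho>barD(2)[OF \<phi>] by (simp add: N_def)
  ultimately have "((\<lambda>h. 2 * L2_normsq \<rho>bar (\<lambda>x. (transition_op P h \<phi> x - \<phi> x) / of_real h - z * \<phi> x)
      + 2 * (ennreal ((cmod (\<kappa> h))\<^sup>2) * N \<phi>)) \<longlongrightarrow> 2 * 0 + 2 * (0 * N \<phi>)) (at_right 0)"
    using lim by (intro tendsto_add ennreal_tendsto_cmult tendsto_mult_ennreal tendsto_const) auto
  then have lim0: "((\<lambda>h. 2 * L2_normsq \<rho>bar (\<lambda>x. (transition_op P h \<phi> x - \<phi> x) / of_real h - z * \<phi> x)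
      + 2 * (ennreal ((cmod (\<kappa> h))\<^sup>2) * N \<phi>)) \<longlongrightarrow> 0) (at_right 0)"
    by simp
  show ?thesis
  proof (rule tendsto_sandwich[OF _ _ tendsto_const lim0])
    show "\<forall>\<^sub>F h in at_right 0. L2_normsq \<rho>bar (\<lambda>x. (exp (- z * of_real h) * transition_op P h \<phi> x - \<phi> x) / of_real h) \<le>
      2 * L2_normsq \<rho>bar (\<lambda>x. (transition_op P h \<phi> x - \<phi> x) / of_real h - z * \<phi> x) + 2 * (ennreal ((cmod (\<kappa> h))\<^sup>2) * N \<phi>)"
      using eventually_at_right_less[of 0]
    proof eventually_elim
      case (elim h)
      let ?A = "\<lambda>x. (transition_op P h \<phi> x - \<phi> x) / of_real h - z * \<phi> x"
      have [measurable]: "transition_op P h \<phi> \<in> borel_measurable borel"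
        using elim by (intro transition_op_measurable) auto
      have "(exp (- z * of_real h) * transition_op P h \<phi> x - \<phi> x) / of_real h = exp (- z * of_real h) * ?A x + \<kappa> h * \<phi> x" for x
        using elim by (simp add: \<kappa>_def field_simps)
      then have "L2_normsq \<rho>bar (\<lambda>x. (exp (- z * of_real h) * transition_op P h \<phi> x - \<phi> x) / of_real h) =
          L2_normsq \<rho>bar (\<lambda>x. exp (- z * of_real h) * ?A x + \<kappa> h * \<phi> x)"
        by (simp only:)
      also have "\<dots> \<le> 2 * L2_normsq \<rho>bar (\<lambda>x. exp (- z * of_real h) * ?A x) + 2 * L2_normsq \<rho>bar (\<lambda>x. \<kappa> h * \<phi> x)"
        by (rule L2_normsq_add_le) auto
      also have "L2_normsq \<rho>bar (\<lambda>x. exp (- z * of_real h) * ?A x) = L2_normsq \<rho>bar ?A"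
        using z by (subst L2_normsq_scale) auto
      also have "L2_normsq \<rho>bar (\<lambda>x. \<kappa> h * \<phi> x) = ennreal ((cmod (\<kappa> h))\<^sup>2) * N \<phi>"
        unfolding N_def by (rule L2_normsq_scale) auto
      finally show ?case .
    qed
  qed simp
qed

text \<open>
  The curve \<open>t \<mapsto> exp (- z t) P(t) \<phi>\<close> moves by \<open>o(h)\<close> over a time step \<open>h\<close>, uniformly in \<open>t\<close> by
  contractivity, so summing over \<open>n\<close> steps of length \<open>t / n\<close> shows that it is constant.
\<close>

lemma generator_eigen_imp:
  assumes gen: "generator P \<rho>bar \<phi> (\<lambda>x. z * \<phi> x)" and z: "Re z = 0" and t: "0 \<le> t"
  shows "AE x in \<rho>bar. transition_op P t \<phi> x = exp (z * of_real t) * \<phi> x"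
proof (cases "t = 0")
  case True
  have "\<phi> \<in> borel_measurable borel"
    using gen L2_fun_\<rho>barD(1)[of \<phi>] unfolding generator_def by blast
  with True show ?thesis
    by (simp add: transition_op_0)
next
  case False
  with t have t: "0 < t" by simp
  have \<phi>: "\<phi> \<in> L2_fun \<rho>bar"
    using gen unfolding generator_def by blast
  note \<phi>' [measurable] = L2_fun_\<rho>barD(1)[OF \<phi>]
  define e where "e h = exp (- z * complex_of_real h)" for h
  have e: "cmod (e h) = 1" "e (h + h') = e h * e h'" "e 0 = 1" for h h'
    using z by (simp_all add: e_def distrib_left exp_add[symmetric])
  define u where "u h x = e h * transition_op P h \<phi> x" for h x
  have u_meas: "u h \<in> borel_measurable borel" if "0 \<le> h" for h
    unfolding u_def using that by (intro borel_measurable_times borel_measurable_const transition_op_measurable) auto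
  \<comment> \<open>The n increments cost n^2 in the squared norm, and normalising by the step
    length contributes h^2; the product t^2 does not depend on n.\<close>
  have bound: "L2_normsq \<rho>bar (\<lambda>x. u t x - \<phi> x) \<le> ennreal (t\<^sup>2) * L2_normsq \<rho>bar (\<lambda>x. (u (t / n) x - \<phi> x) / of_real (t / n))"
    if n: "0 < n" for n :: nat
  proof -
    define h where "h = t / n"
    have h: "0 < h" "t = real n * h"
      using n t by (auto simp: h_def)
    define w where "w x = u h x - \<phi> x" for x
    have [measurable]: "u h \<in> borel_measurable borel" "u t \<in> borel_measurable borel"
      "u (real j * h) \<in> borel_measurable borel" for j :: nat
      using h t u_meas by auto
    have w_meas [measurable]: "w \<in> borel_measurable borel"
      unfolding w_def by measurable
    define v where "v j x = u (real (Suc j) * h) x - u (real j * h) x" for j x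
    have v_meas [measurable]: "v j \<in> borel_measurable borel" for j
      unfolding v_def by measurable
    \<comment> \<open>Increment j is the first increment \<open>w\<close> evolved for time j h and
      multiplied by a unimodular number, so its norm is at most that of \<open>w\<close>.\<close>
    have v_eq: "AE x in \<rho>bar. v j x = e (real j * h) * transition_op P (real j * h) w x" for j
    proof -
      have j: "0 \<le> real j * h" "0 \<le> h"
        using h by auto
      have "AE x in \<rho>bar. transition_op P (real j * h + h) \<phi> x = transition_op P (real j * h) (transition_op P h \<phi>) x"
        by (rule transition_op_add_AE[OF L2_fun_\<rho>barD(3)[OF \<phi>] j])
      moreover have "AE x in \<rho>bar. integrable (P (real j * h) x) \<phi>"
        by (rule AE_integrable_P[OF L2_fun_\<rho>barD(3)[OF \<phi>] j(1)])
      moreover have "AE x in \<rho>bar. integrable (P (real j * h) x) (transition_op P h \<phi>)"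
        by (rule AE_integrable_P[OF L2_fun_\<rho>barD(3)[OF transition_op_in_L2[OF \<phi> j(2)]] j(1)])
      ultimately show ?thesis
      proof eventually_elim
        case (elim x)
        have "transition_op P (real j * h) w x = e h * transition_op P (real j * h) (transition_op P h \<phi>) x - transition_op P (real j * h) \<phi> x"
          using elim(2,3) by (simp add: transition_op_def[of P "real j * h"] w_def u_def)
        moreover have "real (Suc j) * h = real j * h + h"
          by (simp add: algebra_simps)
        ultimately show ?case
          unfolding v_def u_def by (simp only: elim(1) e(2) right_diff_distrib mult.assoc)
      qed
    qed
    have v_le: "L2_normsq \<rho>bar (v j) \<le> L2_normsq \<rho>bar w" for j
    proof -
      have [measurable]: "transition_op P (real j * h) w \<in> borel_measurable borel"
        using h by (intro transition_op_measurable) auto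
      have "L2_normsq \<rho>bar (v j) = L2_normsq \<rho>bar (\<lambda>x. e (real j * h) * transition_op P (real j * h) w x)"
        by (rule L2_normsq_cong_AE[OF v_eq])
      also have "\<dots> = L2_normsq \<rho>bar (transition_op P (real j * h) w)"
        using e(1) by (subst L2_normsq_scale) auto
      also have "\<dots> \<le> L2_normsq \<rho>bar w"
        using h by (intro L2_normsq_transition_op_le) auto
      finally show ?thesis .
    qed
    have "u t x - \<phi> x = (\<Sum>j<n. v j x)" for x
    proof -
      have "(\<Sum>j<n. v j x) = u (real n * h) x - u (real 0 * h) x"
        unfolding v_def by (rule sum_lessThan_telescope)
      then show ?thesis
        using \<phi>' by (simp add: h(2)[symmetric]) (simp add: u_def e transition_op_0)
    qed
    then have "L2_normsq \<rho>bar (\<lambda>x. u t x - \<phi> x) = L2_normsq \<rho>bar (\<lambda>x. \<Sum>j<n. v j x)"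
      by simp
    also have "\<dots> \<le> of_nat n * (\<Sum>j<n. L2_normsq \<rho>bar (v j))"
      by (rule L2_normsq_sum_le) simp
    also have "\<dots> \<le> of_nat n * (\<Sum>j<n. L2_normsq \<rho>bar w)"
      by (intro mult_left_mono sum_mono v_le) auto
    also have "\<dots> = ennreal ((real n)\<^sup>2) * L2_normsq \<rho>bar w"
      by (simp add: ennreal_of_nat_eq_real_of_nat power2_eq_square ennreal_mult mult.assoc)
    also have "L2_normsq \<rho>bar w = L2_normsq \<rho>bar (\<lambda>x. of_real h * ((u h x - \<phi> x) / of_real h))"
      using h by (simp add: w_def[abs_def])
    also have "\<dots> = ennreal (h\<^sup>2) * L2_normsq \<rho>bar (\<lambda>x. (u h x - \<phi> x) / of_real h)"
      using h by (subst L2_normsq_scale) auto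
    also have "ennreal ((real n)\<^sup>2) * (ennreal (h\<^sup>2) * L2_normsq \<rho>bar (\<lambda>x. (u h x - \<phi> x) / of_real h))
        = ennreal (t\<^sup>2) * L2_normsq \<rho>bar (\<lambda>x. (u h x - \<phi> x) / of_real h)"
      by (simp add: mult.assoc[symmetric] ennreal_mult[symmetric] h(2) power_mult_distrib)
    finally show ?thesis
      unfolding h_def .
  qed
  have "filterlim (\<lambda>n. t / real n) (at_right 0) sequentially"
    unfolding filterlim_at
  proof
    show "\<forall>\<^sub>F n in sequentially. t / real n \<in> {0<..} \<and> t / real n \<noteq> 0"
      using eventually_gt_at_top[of 0] by eventually_elim (use t in simp)
  qed (rule lim_const_over_n)
  from filterlim_compose[OF generator_eigen_tendsto[OF gen z] this]
  have "(\<lambda>n. L2_normsq \<rho>bar (\<lambda>x. (u (t / n) x - \<phi> x) / of_real (t / n))) \<longlonglongrightarrow> 0"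
    by (simp add: u_def e_def)
  then have "(\<lambda>n. ennreal (t\<^sup>2) * L2_normsq \<rho>bar (\<lambda>x. (u (t / n) x - \<phi> x) / of_real (t / n))) \<longlonglongrightarrow> ennreal (t\<^sup>2) * 0"
    by (intro ennreal_tendsto_cmult) auto
  then have "L2_normsq \<rho>bar (\<lambda>x. u t x - \<phi> x) \<le> ennreal (t\<^sup>2) * 0"
    by (rule tendsto_lowerbound) (use bound in \<open>auto intro: eventually_mono[OF eventually_gt_at_top[of 0]]\<close>)
  then have "L2_normsq \<rho>bar (\<lambda>x. u t x - \<phi> x) = 0"
    by simp
  then have "AE x in \<rho>bar. u t x - \<phi> x = 0"
    using u_meas[of t] t by (intro L2_normsq_eq_0) auto
  then show ?thesis
  proof eventually_elim
    case (elim x)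
    have "exp (z * of_real t) * e t = 1"
      by (simp add: e_def exp_add[symmetric])
    then show ?case
      using elim by (simp add: u_def) (metis mult.assoc mult_1)
  qed
qed

text \<open>The generator defect is almost everywhere a scalar multiple of \<phi>, and the scalar
  \<open>\<kappa> t\<close> tends to 0.\<close>

lemma generator_eigenI:
  assumes \<phi>: "\<phi> \<in> L2_fun \<rho>bar"
    and eig: "\<And>t. 0 < t \<Longrightarrow> AE x in \<rho>bar. transition_op P t \<phi> x = exp (z * of_real t) * \<phi> x"
  shows "generator P \<rho>bar \<phi> (\<lambda>x. z * \<phi> x)"
proof -
  note [measurable] = L2_fun_\<rho>barD(1)[OF \<phi>]
  have z\<phi>: "(\<lambda>x. z * \<phi> x) \<in> L2_fun \<rho>bar"
    using L2_fun_\<rho>barD(2)[OF \<phi>] by (auto simp: L2_fun_def L2_normsq_scale ennreal_mult_less_top)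
  define \<kappa> where "\<kappa> h = (exp (z * of_real h) - 1) / of_real h - z" for h
  have "(\<kappa> \<longlongrightarrow> z - z) (at_right 0)"
    unfolding \<kappa>_def[abs_def] by (intro tendsto_intros exp_difference_quotient)
  then have "((\<lambda>h. (cmod (\<kappa> h))\<^sup>2) \<longlongrightarrow> (cmod 0)\<^sup>2) (at_right 0)"
    by (intro tendsto_intros) simp
  then have "((\<lambda>h. ennreal ((cmod (\<kappa> h))\<^sup>2)) \<longlongrightarrow> 0) (at_right 0)"
    using tendsto_ennrealI by fastforce
  then have "((\<lambda>h. ennreal ((cmod (\<kappa> h))\<^sup>2) * L2_normsq \<rho>bar \<phi>) \<longlongrightarrow> 0 * L2_normsq \<rho>bar \<phi>) (at_right 0)"
    using L2_fun_\<rho>barD(2)[OF \<phi>] by (intro tendsto_mult_ennreal tendsto_const) auto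
  moreover have "\<forall>\<^sub>F t in at_right 0. ennreal ((cmod (\<kappa> t))\<^sup>2) * L2_normsq \<rho>bar \<phi> =
      L2_normsq \<rho>bar (\<lambda>x. (transition_op P t \<phi> x - \<phi> x) / of_real t - z * \<phi> x)"
    using eventually_at_right_less[of 0]
  proof eventually_elim
    case (elim t)
    have "L2_normsq \<rho>bar (\<lambda>x. (transition_op P t \<phi> x - \<phi> x) / of_real t - z * \<phi> x) = L2_normsq \<rho>bar (\<lambda>x. \<kappa> t * \<phi> x)"
    proof (rule L2_normsq_cong_AE)
      show "AE x in \<rho>bar. (transition_op P t \<phi> x - \<phi> x) / of_real t - z * \<phi> x = \<kappa> t * \<phi> x"
        using eig[OF elim] by eventually_elim (simp add: \<kappa>_def algebra_simps diff_divide_distrib)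
    qed
    then show ?case
      by (simp add: L2_normsq_scale)
  qed
  ultimately show ?thesis
    unfolding generator_def using \<phi> z\<phi> by (auto intro: Lim_transform_eventually)
qed

end

section \<open>The group of imaginary eigenvalues\<close>

locale mixing_chain = periodic_chain +
  assumes PS: "PS_mixing P \<tau> \<rho>"
begin

lemma mixing_at: "mixing_on (measure_support (\<rho> s)) (P \<tau>) (\<rho> s)"
  by (rule periodic_all[where Q="\<lambda>s. mixing_on (measure_support (\<rho> s)) (P \<tau>) (\<rho> s)"])
    (use PS in \<open>auto simp: \<rho>_add_period PS_mixing_def\<close>)

section \<open>Frequencies and characters of the circle of length \<tau>\<close>

definition freq :: "int \<Rightarrow> complex" where
  "freq m = complex_of_real (2 * pi * of_int m / \<tau>) * \<i>"

definition char_fun :: "int \<Rightarrow> real \<Rightarrow> complex" where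
  "char_fun m s = exp (freq m * of_real s)"

lemma freq_inj: "freq m = freq n \<longleftrightarrow> m = n"
  using period_pos by (simp add: freq_def)

lemma Re_freq [simp]: "Re (freq m) = 0"
  by (simp add: freq_def)

lemma cmod_char_fun [simp]: "cmod (char_fun m s) = 1"
  by (simp add: char_fun_def)

lemma char_fun_nonzero [simp]: "char_fun m s \<noteq> 0"
  by (simp add: char_fun_def)

lemma char_fun_add: "char_fun m (s + t) = char_fun m s * char_fun m t"
  by (simp add: char_fun_def distrib_left exp_add)

lemma char_fun_0 [simp]: "char_fun m 0 = 1" "char_fun 0 s = 1"
  by (simp_all add: char_fun_def freq_def)

lemma char_fun_eq_1_iff: "char_fun m s = 1 \<longleftrightarrow> of_int m * s / \<tau> \<in> \<int>"
proof -
  have "char_fun m s = 1 \<longleftrightarrow> (\<exists>n::int. 2 * pi * of_int m / \<tau> * s = of_int (2 * n) * pi)"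
    by (simp add: char_fun_def freq_def exp_eq_1)
  also have "\<dots> \<longleftrightarrow> (\<exists>n::int. of_int m * s / \<tau> = of_int n)"
    using period_pos by (simp add: field_simps)
  finally show ?thesis
    by (auto simp: Ints_def)
qed

lemma char_fun_period [simp]: "char_fun m \<tau> = 1"
  using period_pos by (simp add: char_fun_eq_1_iff)

lemma char_fun_add_period: "char_fun m (s + \<tau>) = char_fun m s"
  by (simp add: char_fun_add)

lemma char_fun_mult: "char_fun m s * char_fun n s = char_fun (m + n) s"
  by (simp add: char_fun_def exp_add[symmetric] freq_def distrib_right add_divide_distrib distrib_left)

lemma char_fun_inverse [simp]: "char_fun (- m) s * char_fun m s = 1" "char_fun m s * char_fun (- m) s = 1"
  by (simp_all add: char_fun_mult)

lemma measurable_char_fun [measurable]: "char_fun m \<in> borel_measurable borel"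
  unfolding char_fun_def
  by (intro borel_measurable_continuous_onI continuous_intros)

section \<open>Eigenfunctions as functions of the phase\<close>

lemma U_obtain:
  assumes "AE s in U. Q s"
  obtains s where "Q s"
proof -
  have "\<not> (\<forall>s. \<not> Q s)"
  proof
    assume "\<forall>s. \<not> Q s"
    with assms have "AE s in U. False"
      by simp
    then show False
      using U.AE_False by simp
  qed
  then show ?thesis
    using that by blast
qed

lemma \<rho>_obtain:
  assumes "AE x in \<rho> s. Q x"
  obtains x where "Q x"
proof -
  have "\<not> (\<forall>x. \<not> Q x)"
  proof
    assume "\<forall>x. \<not> Q x"
    with assms have "AE x in \<rho> s. False"
      by simp
    then show False
      using prob_space.AE_False[OF prob_space_\<rho>] by simp
  qed
  then show ?thesis
    using that by blast
qed

lemma AE_\<rho>bar_eqI: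
  fixes f g :: "'a \<Rightarrow> complex"
  assumes [measurable]: "f \<in> borel_measurable borel" "g \<in> borel_measurable borel"
    and "AE s in U. AE x in \<rho> s. f x = g x"
  shows "AE x in \<rho>bar. f x = g x"
  using assms(3) by (subst AE_\<rho>bar) measurable

text \<open>Mixing makes \<phi> a constant \<open>c s\<close> under almost every
  \<open>\<rho> s\<close>, and all these constants would vanish if exp (z \<tau>) were not 1. The
  evolution equation gives c (s + t) = exp (z t) c (s), so dividing by the character leaves a
  rotation-invariant function of s, hence a constant.\<close>

lemma eigenfunction_structure:
  assumes eig: "eigenfunction P \<rho>bar z \<phi>" and z: "Re z = 0"
  obtains m C where "C \<noteq> 0" "z = freq m" "AE s in U. AE x in \<rho> s. \<phi> x = C * char_fun m s"
proof -
  have gen: "generator P \<rho>bar \<phi> (\<lambda>x. z * \<phi> x)" and nz: "\<not> (AE x in \<rho>bar. \<phi> x = 0)"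
    using eig unfolding eigenfunction_def by blast+
  have \<phi>: "\<phi> \<in> L2_fun \<rho>bar"
    using gen unfolding generator_def by blast
  note \<phi>_meas [measurable] = L2_fun_\<rho>barD(1)[OF \<phi>]
  have eigT: "AE s in U. AE x in \<rho> s. transition_op P t \<phi> x = exp (z * of_real t) * \<phi> x" if "0 \<le> t" for t
    using generator_eigen_imp[OF gen z that] by (rule AE_\<rho>barD)
  have int: "AE s in U. integrable (\<rho> s) \<phi>"
    using integrable_bind(1)[OF prob_space_U \<rho>_kernel_U, of \<phi>] L2_fun_\<rho>barD(3)[OF \<phi>]
    by (simp add: average_measure_def)
  define c where "c s = (\<integral>x. \<phi> x \<partial>\<rho> s)" for s
  have c_per: "c (s + \<tau>) = c s" for s
    by (simp add: c_def \<rho>_add_period)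
  have c_meas [measurable]: "c \<in> borel_measurable borel"
    unfolding c_def
    by (rule measurable_compose[OF measurable_prob_algebraD[OF \<rho>_kernel] integral_measurable_subprob_algebra[OF \<phi>_meas]])
  have "AE s in U. AE x in \<rho> s. transition_op P (real k * \<tau>) \<phi> x = exp (z * \<tau>) ^ k * \<phi> x" for k
    using eigT[OF periods_nonneg[of k]] by (simp add: exp_of_nat_mult[symmetric] mult_ac)
  \<comment> \<open>Only countably many k occur, so one exceptional set of s serves for all of
    them.\<close>
  then have "AE s in U. \<forall>k. AE x in \<rho> s. transition_op P (real k * \<tau>) \<phi> x = exp (z * \<tau>) ^ k * \<phi> x"
    by (simp add: AE_all_countable)
  with int have const: "AE s in U. (AE x in \<rho> s. \<phi> x = c s) \<and> (exp (z * \<tau>) \<noteq> 1 \<longrightarrow> c s = 0)"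
  proof eventually_elim
    case (elim s)
    show ?case
      using mixing_eigenfunction_const[OF mixing_at elim(1), of "exp (z * \<tau>)"] elim(2) z by (simp add: c_def)
  qed
  have "exp (z * \<tau>) = 1"
  proof (rule ccontr)
    assume *: "exp (z * \<tau>) \<noteq> 1"
    have "AE x in \<rho>bar. \<phi> x = 0"
    proof (rule AE_\<rho>bar_eqI)
      show "AE s in U. AE x in \<rho> s. \<phi> x = 0"
        using const
      proof eventually_elim
        case (elim s)
        then have ae: "AE x in \<rho> s. \<phi> x = c s" and c: "c s = 0"
          using * by blast+
        show ?case
          using ae unfolding c .
      qed
    qed auto
    with nz show False by simp
  qed
  then obtain n :: int where n: "Im z * \<tau> = of_int (2 * n) * pi"
    unfolding exp_eq_1 by auto
  have zm: "z = freq n"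
    unfolding freq_def using n period_pos z by (intro complex_eqI) (auto simp: field_simps)
  have ez: "exp (z * of_real t) = char_fun n t" for t
    by (simp add: char_fun_def zm)
  define d where "d s = char_fun (- n) s * c s" for s
  have d_per: "d (s + \<tau>) = d s" for s
    by (simp add: d_def char_fun_add_period c_per)
  have d_meas [measurable]: "d \<in> borel_measurable borel"
    unfolding d_def by measurable
  have d_shift: "AE s in U. d (s + t) = d s" if t: "0 \<le> t" for t
  proof -
    have "AE s in U. integrable (\<rho> (s + t)) \<phi>"
      using AE_U_shift[OF _ int, of t] by (simp add: \<rho>_add_period)
    with eigT[OF t] show ?thesis
    proof eventually_elim
      case (elim s)
      have "c (s + t) = (\<integral>x. transition_op P t \<phi> x \<partial>\<rho> s)"
        using transition_op_\<rho>(3)[OF elim(2) t] by (simp add: c_def)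
      also have "\<dots> = (\<integral>x. char_fun n t * \<phi> x \<partial>\<rho> s)"
        using elim(1) t by (intro integral_cong_AE) (auto simp: ez)
      finally have "c (s + t) = char_fun n t * c s"
        by (simp add: c_def)
      then have "d (s + t) = (char_fun (- n) t * char_fun n t) * (char_fun (- n) s * c s)"
        by (simp add: d_def char_fun_add)
      then show ?case
        by (simp add: d_def)
    qed
  qed
  \<comment> \<open>The exceptional set of s in \<open>d_shift\<close> depends on t. Fubini
    exchanges the two variables and yields one base point \<open>s0\<close> that works for almost
    every t.\<close>
  interpret UU: pair_sigma_finite U U ..
  have "AE t in U. AE s in U. d (s + t) = d s"
    using AE_U_bounds by eventually_elim (simp add: d_shift)
  then have "AE s in U. AE t in U. d (s + t) = d s"
    by (subst UU.AE_commute) measurable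
  then obtain s0 where s0: "AE t in U. d (s0 + t) = d s0"
    by (rule U_obtain)
  define C where "C = d s0"
  have "AE t in U. d (s0 + (t + - s0)) = d s0"
    by (rule AE_U_shift[OF _ s0]) (simp add: add.assoc[symmetric] d_per)
  then have dC: "AE s in U. d s = C"
    by (simp add: C_def)
  have \<phi>C: "AE s in U. AE x in \<rho> s. \<phi> x = C * char_fun n s"
    using const dC
  proof eventually_elim
    case (elim s)
    have "char_fun n s * d s = c s"
      by (simp add: d_def mult.assoc[symmetric])
    then have "c s = C * char_fun n s"
      using elim(2) by (simp add: mult.commute)
    with elim(1) show ?case by simp
  qed
  have "C \<noteq> 0"
  proof
    assume "C = 0"
    have "AE x in \<rho>bar. \<phi> x = 0"
      by (rule AE_\<rho>bar_eqI) (use \<phi>C \<open>C = 0\<close> in auto)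
    with nz show False by simp
  qed
  then show ?thesis
    using that zm \<phi>C by blast
qed

text \<open>An eigenfunction divided by its constant: a function of the state alone that reads off a
  character of the phase. Only almost every s is required, which is all that an equality modulo
  \<open>\<rho>bar\<close> can see.\<close>

definition phase_fun :: "int \<Rightarrow> ('a \<Rightarrow> complex) \<Rightarrow> bool" where
  "phase_fun m \<phi> \<longleftrightarrow> \<phi> \<in> borel_measurable borel \<and> (AE s in U. AE x in \<rho> s. \<phi> x = char_fun m s)"

definition spectrum :: "int set" where
  "spectrum = {m. \<exists>\<phi>. phase_fun m \<phi>}"

lemma phase_fun_shift:
  assumes "phase_fun m \<phi>"
  shows "AE s in U. AE x in \<rho> (s + t). \<phi> x = char_fun m (s + t)"
proof (rule AE_U_shift[where Q="\<lambda>s. AE x in \<rho> s. \<phi> x = char_fun m s"])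
  show "(AE x in \<rho> (s + \<tau>). \<phi> x = char_fun m (s + \<tau>)) = (AE x in \<rho> s. \<phi> x = char_fun m s)" for s
    unfolding \<rho>_add_period char_fun_add_period by (rule refl)
qed (use assms in \<open>simp add: phase_fun_def\<close>)

text \<open>Started from \<open>\<rho> s\<close>, the process at time t has law
  \<open>\<rho> (s + t)\<close>, where \<phi> is constant; multiplicativity of the character gives
  the eigenvalue. Modulus 1 gives both square-integrability and nonvanishing.\<close>

lemma phase_fun_eigenfunction:
  assumes ph: "phase_fun m \<phi>"
  shows "eigenfunction P \<rho>bar (freq m) \<phi>"
  unfolding eigenfunction_def
proof
  have \<phi> [measurable]: "\<phi> \<in> borel_measurable borel" and ae: "AE s in U. AE x in \<rho> s. \<phi> x = char_fun m s"
    using ph unfolding phase_fun_def by blast+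
  have "AE s in U. AE x in \<rho> s. cmod (\<phi> x) = 1"
    using ae by eventually_elim (auto elim: AE_mp)
  then have cmod1: "AE x in \<rho>bar. cmod (\<phi> x) = 1"
    by (subst AE_\<rho>bar) measurable
  show "\<not> (AE x in \<rho>bar. \<phi> x = 0)"
  proof
    assume "AE x in \<rho>bar. \<phi> x = 0"
    with cmod1 have "AE x in \<rho>bar. False"
      by eventually_elim simp
    then show False
      using prob_space.AE_False[OF prob_space_\<rho>bar] by simp
  qed
  have "L2_normsq \<rho>bar \<phi> = (\<integral>\<^sup>+x. 1 \<partial>\<rho>bar)"
    unfolding L2_normsq_def by (rule nn_integral_cong_AE) (use cmod1 in eventually_elim, simp)
  then have "L2_normsq \<rho>bar \<phi> < \<infinity>"
    using prob_space.emeasure_space_1[OF prob_space_\<rho>bar] by simp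
  then have L2: "\<phi> \<in> L2_fun \<rho>bar"
    by (simp add: L2_fun_def)
  show "generator P \<rho>bar \<phi> (\<lambda>x. freq m * \<phi> x)"
  proof (rule generator_eigenI[OF L2])
    fix t :: real assume "0 < t"
    then have t: "0 \<le> t" by simp
    show "AE x in \<rho>bar. transition_op P t \<phi> x = exp (freq m * of_real t) * \<phi> x"
    proof (rule AE_\<rho>bar_eqI)
      show "AE s in U. AE x in \<rho> s. transition_op P t \<phi> x = exp (freq m * of_real t) * \<phi> x"
        using ae phase_fun_shift[OF ph, of t]
      proof eventually_elim
        case (elim s)
        have "AE x in \<rho> s. AE y in P t x. \<phi> y = char_fun m (s + t)"
          using elim(2) unfolding \<rho>_add[OF t]
          by (intro AE_bindD[OF measurable_prob_algebraD[OF P_kernel_\<rho>[OF t]]] prob_space.not_empty) auto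
        with elim(1) show ?case
        proof eventually_elim
          case (elim x)
          interpret p: prob_space "P t x"
            using t by simp
          have "transition_op P t \<phi> x = (\<integral>y. char_fun m (s + t) \<partial>P t x)"
            unfolding transition_op_def using elim(2) t by (intro integral_cong_AE) auto
          also have "\<dots> = char_fun m t * char_fun m s"
            by (simp add: p.prob_space char_fun_add)
          finally show ?case
            using elim(1) by (simp add: char_fun_def)
        qed
      qed
    qed (use t in measurable)
  qed
qed

lemma phase_fun_simple:
  assumes ph: "phase_fun m \<phi>"
  shows "simple_eigenvalue P \<rho>bar (freq m)"
  unfolding simple_eigenvalue_def
proof (intro exI[of _ \<phi>] conjI allI impI)
  show "eigenfunction P \<rho>bar (freq m) \<phi>"
    by (rule phase_fun_eigenfunction[OF ph])
  fix \<psi> assume \<psi>: "eigenfunction P \<rho>bar (freq m) \<psi>"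
  obtain n C where C: "freq m = freq n" "AE s in U. AE x in \<rho> s. \<psi> x = C * char_fun n s"
    using eigenfunction_structure[OF \<psi> Re_freq] by metis
  have [measurable]: "\<phi> \<in> borel_measurable borel" and ae: "AE s in U. AE x in \<rho> s. \<phi> x = char_fun m s"
    using ph unfolding phase_fun_def by blast+
  have "\<psi> \<in> L2_fun \<rho>bar"
    using \<psi> unfolding eigenfunction_def generator_def by blast
  note [measurable] = L2_fun_\<rho>barD(1)[OF this]
  have "AE s in U. AE x in \<rho> s. \<psi> x = C * \<phi> x"
    using C(2) ae
  proof eventually_elim
    case (elim s)
    then show ?case
      by eventually_elim (use C(1) in \<open>simp add: freq_inj\<close>)
  qed
  then have "AE x in \<rho>bar. \<psi> x = C * \<phi> x"
    by (rule AE_\<rho>bar_eqI[rotated 2]) measurable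
  then show "\<exists>c. AE x in \<rho>bar. \<psi> x = c * \<phi> x"
    by blast
qed

lemma eigenvalue_imp_spectrum:
  assumes "eigenvalue P \<rho>bar z" "Re z = 0"
  obtains m where "m \<in> spectrum" "z = freq m"
proof -
  obtain \<phi> where \<phi>: "eigenfunction P \<rho>bar z \<phi>"
    using assms by (auto simp: eigenvalue_def)
  obtain m C where C: "C \<noteq> 0" "z = freq m" "AE s in U. AE x in \<rho> s. \<phi> x = C * char_fun m s"
    using eigenfunction_structure[OF \<phi> assms(2)] by metis
  have "\<phi> \<in> L2_fun \<rho>bar"
    using \<phi> unfolding eigenfunction_def generator_def by blast
  note [measurable] = L2_fun_\<rho>barD(1)[OF this]
  have "AE s in U. AE x in \<rho> s. \<phi> x / C = char_fun m s"
    using C(3)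
  proof eventually_elim
    case (elim s)
    then show ?case
      by eventually_elim (simp add: C(1))
  qed
  then have "phase_fun m (\<lambda>x. \<phi> x / C)"
    by (simp add: phase_fun_def)
  then show ?thesis
    using that C(2) by (auto simp: spectrum_def)
qed

lemma spectrum_simple: "m \<in> spectrum \<Longrightarrow> simple_eigenvalue P \<rho>bar (freq m)"
  using phase_fun_simple by (auto simp: spectrum_def)

lemma spectrum_0: "0 \<in> spectrum"
  unfolding spectrum_def phase_fun_def by (auto intro!: exI[of _ "\<lambda>_. 1"])

text \<open>Phase functions multiply like characters.\<close>

lemma spectrum_add:
  assumes "m \<in> spectrum" "n \<in> spectrum"
  shows "m + n \<in> spectrum"
proof -
  obtain \<phi> \<psi> where [measurable]: "\<phi> \<in> borel_measurable borel" "\<psi> \<in> borel_measurable borel"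
    and ae: "AE s in U. AE x in \<rho> s. \<phi> x = char_fun m s" "AE s in U. AE x in \<rho> s. \<psi> x = char_fun n s"
    using assms by (auto simp: spectrum_def phase_fun_def)
  have "AE s in U. AE x in \<rho> s. \<phi> x * \<psi> x = char_fun (m + n) s"
    using ae
  proof eventually_elim
    case (elim s)
    then show ?case
      by eventually_elim (simp add: char_fun_mult)
  qed
  then show ?thesis
    unfolding spectrum_def phase_fun_def by (auto intro!: exI[of _ "\<lambda>x. \<phi> x * \<psi> x"])
qed

lemma spectrum_minus:
  assumes "m \<in> spectrum"
  shows "- m \<in> spectrum"
proof -
  obtain \<phi> where [measurable]: "\<phi> \<in> borel_measurable borel"
    and ae: "AE s in U. AE x in \<rho> s. \<phi> x = char_fun m s"
    using assms by (auto simp: spectrum_def phase_fun_def)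
  have "AE s in U. AE x in \<rho> s. inverse (\<phi> x) = char_fun (- m) s"
    using ae
  proof eventually_elim
    case (elim s)
    then show ?case
      by eventually_elim (simp add: inverse_unique)
  qed
  then show ?thesis
    unfolding spectrum_def phase_fun_def by (auto intro!: exI[of _ "\<lambda>x. inverse (\<phi> x)"])
qed

text \<open>If \<open>\<rho> (s + \<sigma>)\<close> equals \<open>\<rho> s\<close>, the same measure
  sees \<phi> as the character at s and at s + \<sigma>; any point where both equations hold forces
  the two values to agree.\<close>

lemma spectrum_period:
  assumes m: "m \<in> spectrum" and \<sigma>: "\<And>s. \<rho> (s + \<sigma>) = \<rho> s"
  shows "of_int m * \<sigma> / \<tau> \<in> \<int>"
proof -
  obtain \<phi> where ph: "phase_fun m \<phi>"
    using m by (auto simp: spectrum_def)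
  have ae: "AE s in U. AE x in \<rho> s. \<phi> x = char_fun m s"
    using ph unfolding phase_fun_def by blast
  have "AE s in U. char_fun m (s + \<sigma>) = char_fun m s"
    using ae phase_fun_shift[OF ph, of \<sigma>]
  proof eventually_elim
    case (elim s)
    then have "AE x in \<rho> s. \<phi> x = char_fun m s \<and> \<phi> x = char_fun m (s + \<sigma>)"
      unfolding \<sigma> by eventually_elim simp
    then obtain x where "\<phi> x = char_fun m s \<and> \<phi> x = char_fun m (s + \<sigma>)"
      by (rule \<rho>_obtain)
    then show ?case by auto
  qed
  then obtain s where "char_fun m (s + \<sigma>) = char_fun m s"
    by (rule U_obtain)
  then have "char_fun m \<sigma> = 1"
    by (simp add: char_fun_add)
  then show ?thesis
    by (simp add: char_fun_eq_1_iff)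
qed


section \<open>Fourier coefficients\<close>

definition mean :: "('a \<Rightarrow> real) \<Rightarrow> real \<Rightarrow> real" where
  "mean f s = (\<integral>x. f x \<partial>\<rho> s)"

definition fourier_coeff :: "(real \<Rightarrow> real) \<Rightarrow> int \<Rightarrow> complex" where
  "fourier_coeff c m = (\<integral>t. char_fun (- m) t * complex_of_real (c t) \<partial>U)"

lemma mean_add_period: "mean f (s + \<tau>) = mean f s"
  by (simp add: mean_def \<rho>_add_period)

lemma measurable_mean [measurable]:
  assumes "f \<in> borel_measurable borel"
  shows "mean f \<in> borel_measurable borel"
  unfolding mean_def
  by (rule measurable_compose[OF measurable_prob_algebraD[OF \<rho>_kernel] integral_measurable_subprob_algebra[OF assms]])

lemma abs_integral_le:
  fixes f :: "'a \<Rightarrow> real"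
  assumes \<mu>: "\<mu> \<in> space (prob_algebra borel)" and f: "f \<in> borel_measurable borel" "\<And>x. \<bar>f x\<bar> \<le> 1"
  shows "integrable \<mu> f" and "\<bar>\<integral>x. f x \<partial>\<mu>\<bar> \<le> 1"
proof -
  interpret prob_space \<mu>
    using \<mu> by (simp add: space_prob_algebra)
  have "f \<in> borel_measurable \<mu>"
    using \<mu> f(1) measurable_cong_sets[of \<mu> borel borel "borel :: real measure"] by (simp add: space_prob_algebra)
  then show i: "integrable \<mu> f"
    using f(2) by (intro integrable_const_bound[where B=1]) auto
  have "\<bar>\<integral>x. f x \<partial>\<mu>\<bar> \<le> (\<integral>x. \<bar>f x\<bar> \<partial>\<mu>)"
    by (rule integral_abs_bound)
  also have "\<dots> \<le> 1"
    using i f(2) by (intro integral_le_const) auto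
  finally show "\<bar>\<integral>x. f x \<partial>\<mu>\<bar> \<le> 1" .
qed

text \<open>
  The phase function is a limit of time averages
  \<open>1/T \<integral>\<^sub>0\<^sup>T exp (- i \<lambda> t) P(t) f dt\<close> along a subsequence of \<open>T = K \<tau>\<close>.
\<close>

lemma fourier_coeff_spectrum:
  assumes f: "continuous_on UNIV f" "\<And>x. \<bar>f x\<bar> \<le> 1" and nz: "fourier_coeff (mean f) m \<noteq> 0"
  shows "m \<in> spectrum"
proof -
  have f_meas [measurable]: "f \<in> borel_measurable borel"
    by (rule borel_measurable_continuous_onI[OF f(1)])
  define F where "F x t = char_fun (- m) t * complex_of_real (\<integral>y. f y \<partial>P (max 0 t) x)" for x t
  have "(\<lambda>(t, x). \<integral>y. f y \<partial>P (max 0 t) x) \<in> borel_measurable (borel \<Otimes>\<^sub>M borel)"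
  proof (rule right_continuous_measurable)
    show "(\<lambda>x. \<integral>y. f y \<partial>P (max 0 t) x) \<in> borel_measurable borel" for t
      by (rule measurable_compose[OF measurable_prob_algebraD[OF P_kernel'] integral_measurable_subprob_algebra[OF f_meas]])
  qed (rule P_right_continuous[OF f])
  from measurable_compose[OF measurable_pair_swap' this]
  have [measurable]: "(\<lambda>(x, t). \<integral>y. f y \<partial>P (max 0 t) x) \<in> borel_measurable (borel \<Otimes>\<^sub>M borel)"
    by (simp add: case_prod_beta)
  have F_meas [measurable]: "(\<lambda>(x, t). F x t) \<in> borel_measurable (borel \<Otimes>\<^sub>M borel)"
    unfolding F_def by measurable
  have F_bound: "cmod (F x t) \<le> 1" for x t
    unfolding F_def norm_mult using abs_integral_le(2)[OF P_in f_meas f(2), of "max 0 t" x] by simp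
  \<comment> \<open>One period of the time average. The exponential has period \<tau>, so the
    average over K periods is the Cesaro mean of \<open>g\<close> under multiples of the
    period.\<close>
  define g where "g x = (\<integral>t. F x t \<partial>U)" for x
  have g_meas [measurable]: "g \<in> borel_measurable borel"
    unfolding g_def by (rule U.borel_measurable_lebesgue_integral) measurable
  have F_int: "integrable U (F x)" for x
    using F_bound by (intro U.integrable_const_bound[where B=1]) auto
  have g_bound: "cmod (g x) \<le> 1" for x
  proof -
    have "cmod (g x) \<le> (\<integral>t. cmod (F x t) \<partial>U)"
      unfolding g_def by (rule integral_norm_bound)
    also have "\<dots> \<le> 1"
      using F_int F_bound by (intro U.integral_le_const) auto
    finally show ?thesis .
  qed
  define c where "c = fourier_coeff (mean f) m"
  \<comment> \<open>Up to the factor \<open>char_fun m s\<close>, the variables t and s enter only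
    through t + s, and rotation invariance removes the shift.\<close>
  have g_mean: "(\<integral>x. g x \<partial>\<rho> s) = char_fun m s * c" for s
  proof -
    interpret \<rho>: prob_space "\<rho> s" by simp
    interpret pp: pair_prob_space "\<rho> s" U ..
    have "integrable (\<rho> s \<Otimes>\<^sub>M U) (\<lambda>(x, t). F x t)"
      using F_bound by (intro pp.integrable_const_bound[where B=1]) auto
    then have "(\<integral>x. g x \<partial>\<rho> s) = (\<integral>t. (\<integral>x. F x t \<partial>\<rho> s) \<partial>U)"
      unfolding g_def by (rule pp.Fubini_integral[symmetric])
    also have "\<dots> = (\<integral>t. char_fun m s * (char_fun (- m) (t + s) * complex_of_real (mean f (t + s))) \<partial>U)"
    proof (rule integral_cong_AE)
      show "AE t in U. (\<integral>x. F x t \<partial>\<rho> s) = char_fun m s * (char_fun (- m) (t + s) * complex_of_real (mean f (t + s)))"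
        using AE_U_bounds
      proof eventually_elim
        case (elim t)
        then have t: "0 \<le> t" by simp
        have "integrable (\<rho> s \<bind> P t) f"
          using abs_integral_le(1)[OF \<rho>_in f_meas f(2), of "s + t"] by (simp add: \<rho>_add t)
        then have "mean f (t + s) = (\<integral>x. (\<integral>y. f y \<partial>P t x) \<partial>\<rho> s)"
          unfolding mean_def add.commute[of t s] \<rho>_add[OF t]
          by (rule integral_bind[OF prob_space_\<rho> P_kernel_\<rho>[OF t]])
        moreover have "(\<integral>x. F x t \<partial>\<rho> s) = char_fun (- m) t * complex_of_real (\<integral>x. (\<integral>y. f y \<partial>P t x) \<partial>\<rho> s)"
          using t by (simp add: F_def)
        moreover have "char_fun m s * char_fun (- m) (t + s) = char_fun (- m) t"
          by (simp add: char_fun_add mult.left_commute)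
        ultimately show ?case
          by (simp only: mult.assoc[symmetric])
      qed
      show "(\<lambda>t. \<integral>x. F x t \<partial>\<rho> s) \<in> borel_measurable U"
        by (rule \<rho>.borel_measurable_lebesgue_integral) measurable
    qed measurable
    also have "\<dots> = char_fun m s * (\<integral>t. char_fun (- m) (t + s) * complex_of_real (mean f (t + s)) \<partial>U)"
      by simp
    also have "(\<integral>t. char_fun (- m) (t + s) * complex_of_real (mean f (t + s)) \<partial>U) = c"
      unfolding c_def fourier_coeff_def
      by (rule integral_U_shift) (auto simp: char_fun_add_period mean_add_period)
    finally show ?thesis .
  qed
  define A where "A K x = (\<Sum>j<K. transition_op P (real j * \<tau>) g x) / of_nat K" for K :: nat and x
  have A_meas [measurable]: "A K \<in> borel_measurable borel" for K
    unfolding A_def by (intro borel_measurable_divide borel_measurable_sum transition_op_measurable) auto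
  have A_bound: "cmod (A K x) \<le> 1" for K x
  proof -
    have "cmod (\<Sum>j<K. transition_op P (real j * \<tau>) g x) \<le> real K"
      using sum_norm_bound[of "{..<K}" "\<lambda>j. transition_op P (real j * \<tau>) g x" 1]
        transition_op_bound[OF g_meas g_bound periods_nonneg] by simp
    then show ?thesis
      by (cases "K = 0") (auto simp: A_def norm_divide)
  qed
  define e where "e s = char_fun m s * c" for s
  have [measurable]: "e \<in> borel_measurable borel"
    unfolding e_def by measurable
  define B where "B = 1 + cmod c"
  have bound: "(cmod (A K x - e s))\<^sup>2 \<le> B\<^sup>2" for K x s
  proof (rule power_mono)
    show "cmod (A K x - e s) \<le> B"
      using norm_triangle_ineq4[of "A K x" "e s"] A_bound[of K x] by (simp add: B_def e_def norm_mult)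
  qed simp
  define E where "E K s = (\<integral>x. (cmod (A K x - e s))\<^sup>2 \<partial>\<rho> s)" for K s
  have sq_int: "integrable (\<rho> s) (\<lambda>x. (cmod (A K x - e s))\<^sup>2)" for K s
  proof -
    interpret \<rho>: prob_space "\<rho> s" by simp
    show ?thesis
      using bound by (intro \<rho>.integrable_const_bound[where B="B\<^sup>2"]) auto
  qed
  have E_nn: "(\<integral>\<^sup>+x. ennreal ((cmod (A K x - e s))\<^sup>2) \<partial>\<rho> s) = ennreal (E K s)" for K s
    unfolding E_def using sq_int by (rule nn_integral_eq_integral) simp
  have E_nonneg: "0 \<le> E K s" for K s
    by (simp add: E_def)
  have nn_meas: "(\<lambda>s. \<integral>\<^sup>+x. ennreal ((cmod (A K x - e s))\<^sup>2) \<partial>\<rho> s) \<in> borel_measurable borel" for K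
    by (rule nn_integral_measurable_subprob_algebra2[OF _ measurable_prob_algebraD[OF \<rho>_kernel]]) measurable
  have E_meas [measurable]: "E K \<in> borel_measurable borel" for K
  proof -
    have "(\<lambda>s. enn2real (\<integral>\<^sup>+x. ennreal ((cmod (A K x - e s))\<^sup>2) \<partial>\<rho> s)) \<in> borel_measurable borel"
      using nn_meas by measurable
    then show ?thesis
      unfolding E_nn enn2real_ennreal[OF E_nonneg] .
  qed
  have E_bound: "E K s \<le> B\<^sup>2" for K s
  proof -
    interpret \<rho>: prob_space "\<rho> s" by simp
    show ?thesis
      unfolding E_def using sq_int bound by (intro \<rho>.integral_le_const) auto
  qed
  have E_lim: "(\<lambda>K. E K s) \<longlonglongrightarrow> 0" for s
    using mean_ergodic[OF mixing_at g_meas g_bound, of s] by (simp add: E_def A_def e_def g_mean)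
  have "(\<lambda>K. \<integral>s. E K s \<partial>U) \<longlonglongrightarrow> (\<integral>s. 0 \<partial>U)"
    by (rule integral_dominated_convergence[where w="\<lambda>_. B\<^sup>2"]) (use E_lim E_bound E_nonneg in auto)
  then have lim: "(\<lambda>K. \<integral>s. E K s \<partial>U) \<longlonglongrightarrow> 0"
    by simp
  \<comment> \<open>Convergence in each L2 (\<open>\<rho> s\<close>) separately could need
    subsequences that depend on s. The error averaged over s is made summable along one subsequence,
    which then converges pointwise for almost every s and \<open>\<rho> s\<close>-almost every
    x.\<close>
  have "\<exists>K. (\<integral>s. E K s \<partial>U) < (1 / 2) ^ j" for j :: nat
    by (rule eventually_happens'[OF sequentially_bot order_tendstoD(2)[OF lim]]) simp
  then obtain k where k: "(\<integral>s. E (k j) s \<partial>U) < (1 / 2) ^ j" for j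
    by metis
  have E_int: "integrable U (E K)" for K
    using E_bound E_nonneg by (intro U.integrable_const_bound[where B="B\<^sup>2"]) auto
  have "(\<integral>\<^sup>+s. (\<Sum>j. ennreal (E (k j) s)) \<partial>U) = (\<Sum>j. (\<integral>\<^sup>+s. ennreal (E (k j) s) \<partial>U))"
    by (rule nn_integral_suminf) measurable
  also have "\<dots> \<le> (\<Sum>j. ennreal ((1 / 2) ^ j))"
  proof (intro suminf_le)
    fix j
    have "(\<integral>\<^sup>+s. ennreal (E (k j) s) \<partial>U) = ennreal (\<integral>s. E (k j) s \<partial>U)"
      using E_int E_nonneg by (intro nn_integral_eq_integral) auto
    also have "\<dots> \<le> ennreal ((1 / 2) ^ j)"
      using k[of j] by (intro ennreal_leI) simp
    finally show "(\<integral>\<^sup>+s. ennreal (E (k j) s) \<partial>U) \<le> ennreal ((1 / 2) ^ j)" .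
  qed auto
  also have "\<dots> = ennreal (\<Sum>j. (1 / 2) ^ j)"
    by (rule suminf_ennreal2) (auto intro: summable_geometric)
  finally have "(\<integral>\<^sup>+s. (\<Sum>j. ennreal (E (k j) s)) \<partial>U) \<noteq> \<infinity>"
    by (auto simp: top_unique)
  then have "AE s in U. (\<Sum>j. ennreal (E (k j) s)) \<noteq> \<infinity>"
    by (rule nn_integral_PInf_AE[rotated]) measurable
  then have conv: "AE s in U. AE x in \<rho> s. (\<lambda>j. A (k j) x) \<longlonglongrightarrow> e s"
  proof eventually_elim
    case (elim s)
    have "(\<integral>\<^sup>+x. (\<Sum>j. ennreal ((cmod (A (k j) x - e s))\<^sup>2)) \<partial>\<rho> s) = (\<Sum>j. ennreal (E (k j) s))"
      by (subst nn_integral_suminf) (auto simp: E_nn)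
    with elim have "AE x in \<rho> s. (\<Sum>j. ennreal ((cmod (A (k j) x - e s))\<^sup>2)) \<noteq> \<infinity>"
      by (intro nn_integral_PInf_AE) auto
    then show ?case
    proof eventually_elim
      case (elim x)
      then have "summable (\<lambda>j. (cmod (A (k j) x - e s))\<^sup>2)"
        by (intro summable_suminf_not_top) auto
      then have "(\<lambda>j. (cmod (A (k j) x - e s))\<^sup>2) \<longlonglongrightarrow> 0"
        by (rule summable_LIMSEQ_zero)
      then have "(\<lambda>j. sqrt ((cmod (A (k j) x - e s))\<^sup>2)) \<longlonglongrightarrow> sqrt 0"
        by (rule tendsto_real_sqrt)
      then have "(\<lambda>j. A (k j) x - e s) \<longlonglongrightarrow> 0"
        by (simp add: tendsto_norm_zero_iff)
      then show ?case
        by (simp add: LIM_zero_iff)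
    qed
  qed
  \<comment> \<open>The pointwise limit is \<open>char_fun m s * c\<close>; the nonzero coefficient
    \<open>c\<close> is divided out.\<close>
  define \<phi> where "\<phi> x = lim (\<lambda>j. A (k j) x) / c" for x
  have "phase_fun m \<phi>"
    unfolding phase_fun_def
  proof
    show "\<phi> \<in> borel_measurable borel"
      unfolding \<phi>_def by (intro borel_measurable_divide borel_measurable_lim_metric) auto
    show "AE s in U. AE x in \<rho> s. \<phi> x = char_fun m s"
      using conv
    proof eventually_elim
      case (elim s)
      then show ?case
        by eventually_elim (use nz in \<open>simp add: \<phi>_def limI e_def c_def\<close>)
    qed
  qed
  then show ?thesis
    by (auto simp: spectrum_def)
qed


text \<open>
  Integrals of \<open>g\<close> against trigonometric polynomials vanish. The powers of \<open>q\<close> below blow up on part of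
  a short interval to the right of \<open>0\<close>, where \<open>g\<close> would be positive, and are bounded off that interval.
\<close>

lemma fourier_nonpos_at_0:
  fixes g :: "real \<Rightarrow> real"
  assumes meas [measurable]: "g \<in> borel_measurable borel" and bd: "\<And>t. \<bar>g t\<bar> \<le> C"
    and cont: "(g \<longlongrightarrow> g 0) (at_right 0)"
    and orth: "\<And>m. (\<integral>t. char_fun m t * complex_of_real (g t) \<partial>U) = 0"
  shows "g 0 \<le> 0"
proof (rule ccontr)
  assume "\<not> g 0 \<le> 0"
  define \<epsilon> where "\<epsilon> = g 0 / 2"
  have \<epsilon>: "0 < \<epsilon>" "\<epsilon> < g 0"
    using \<open>\<not> g 0 \<le> 0\<close> by (auto simp: \<epsilon>_def)
  obtain b where b: "0 < b" "\<And>t. 0 < t \<Longrightarrow> t < b \<Longrightarrow> \<epsilon> < g t"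
    using order_tendstoD(1)[OF cont \<epsilon>(2)] unfolding eventually_at_right_field by auto
  define \<delta> where "\<delta> = min b (\<tau> / 2)"
  have \<delta>: "0 < \<delta>" "\<delta> \<le> b" "\<delta> < \<tau>"
    using b period_pos by (auto simp: \<delta>_def)
  \<comment> \<open>A trigonometric polynomial of degree 1, symmetric about \<delta> / 2 and
    normalised to the value 1 at 0 and \<delta>: it exceeds 1 between these points and has modulus
    at most 1 on the rest of the circle.\<close>
  define q where "q t = 1 + cos (2 * pi * (t - \<delta> / 2) / \<tau>) - cos (pi * \<delta> / \<tau>)" for t
  have q_meas [measurable]: "q \<in> borel_measurable borel"
    unfolding q_def by measurable
  have q_abs: "\<bar>q t\<bar> \<le> 3" for t
    using cos_le_one[of "2 * pi * (t - \<delta> / 2) / \<tau>"] cos_ge_minus_one[of "2 * pi * (t - \<delta> / 2) / \<tau>"]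
      cos_le_one[of "pi * \<delta> / \<tau>"] cos_ge_minus_one[of "pi * \<delta> / \<tau>"]
    unfolding q_def by linarith
  have angle: "0 < pi * \<delta> / \<tau>" "pi * \<delta> / \<tau> < pi"
    using \<delta> period_pos by (auto simp: field_simps)
  have cos_mono: "cos (pi * y / \<tau>) \<le> cos (2 * pi * x / \<tau>)" if "2 * \<bar>x\<bar> \<le> y" "y \<le> \<tau>" for x y
  proof -
    have "cos (2 * pi * x / \<tau>) = cos (pi * (2 * \<bar>x\<bar>) / \<tau>)"
      using cos_abs_real[of "2 * pi * x / \<tau>"] period_pos by (simp add: abs_mult abs_divide mult_ac)
    also have "\<dots> \<ge> cos (pi * y / \<tau>)"
      using that period_pos by (intro cos_monotone_0_pi_le) (auto simp: field_simps)
    finally show ?thesis .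
  qed
  \<comment> \<open>The value of \<open>q\<close> at \<delta> / 4 and 3 \<delta> / 4, a lower bound
    on the middle half of the interval.\<close>
  define r where "r = 1 + cos (pi * (\<delta> / 2) / \<tau>) - cos (pi * \<delta> / \<tau>)"
  have r: "1 < r"
    unfolding r_def using \<delta> period_pos cos_monotone_0_pi[of "pi * (\<delta> / 2) / \<tau>" "pi * \<delta> / \<tau>"]
    by (auto simp: field_simps)
  have q1: "1 \<le> q t" if "0 \<le> t" "t \<le> \<delta>" for t
  proof -
    have "2 * \<bar>t - \<delta> / 2\<bar> \<le> \<delta>"
      using that by (auto simp: abs_if)
    then show ?thesis
      using cos_mono[of "t - \<delta> / 2" \<delta>] \<delta> unfolding q_def by (simp add: mult_ac)
  qed
  have qr: "r \<le> q t" if "\<delta> / 4 \<le> t" "t \<le> 3 * \<delta> / 4" for t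
  proof -
    have "2 * \<bar>t - \<delta> / 2\<bar> \<le> \<delta> / 2"
      using that by (auto simp: abs_if)
    then show ?thesis
      using cos_mono[of "t - \<delta> / 2" "\<delta> / 2"] \<delta> unfolding q_def r_def by (simp add: mult_ac)
  qed
  have q2: "\<bar>q t\<bar> \<le> 1" if "\<delta> \<le> t" "t \<le> \<tau>" for t
  proof -
    have mono: "cos (pi * u / \<tau>) \<le> cos (pi * \<delta> / \<tau>)" if "\<delta> \<le> u" "u \<le> \<tau>" for u
    proof (rule cos_monotone_0_pi_le)
      show "pi * \<delta> / \<tau> \<le> pi * u / \<tau>"
        using that period_pos by (intro divide_right_mono mult_left_mono) auto
      have "pi * u / \<tau> \<le> pi * \<tau> / \<tau>"
        using that period_pos by (intro divide_right_mono mult_left_mono) auto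
      then show "pi * u / \<tau> \<le> pi"
        using period_pos by simp
    qed (use angle in simp)
    have "cos (2 * pi * (t - \<delta> / 2) / \<tau>) \<le> cos (pi * \<delta> / \<tau>)"
    proof (cases "2 * t - \<delta> \<le> \<tau>")
      case True
      have "2 * pi * (t - \<delta> / 2) / \<tau> = pi * (2 * t - \<delta>) / \<tau>"
        by (simp add: algebra_simps)
      then show ?thesis
        using mono[of "2 * t - \<delta>"] True that by (simp only:)
    next
      case False
      \<comment> \<open>Past the point opposite to \<delta> / 2 the angle exceeds pi and is
        reflected back into the range where the cosine decreases.\<close>
      have "cos (2 * pi * (t - \<delta> / 2) / \<tau>) = cos (2 * pi - 2 * pi * (t - \<delta> / 2) / \<tau>)"
        by (simp add: cos_diff)
      also have "2 * pi - 2 * pi * (t - \<delta> / 2) / \<tau> = pi * (2 * (\<tau> - t) + \<delta>) / \<tau>"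
        using period_pos by (simp add: field_simps)
      finally show ?thesis
        using mono[of "2 * (\<tau> - t) + \<delta>"] False that by simp
    qed
    then show ?thesis
      using cos_ge_minus_one[of "2 * pi * (t - \<delta> / 2) / \<tau>"] cos_le_one[of "pi * \<delta> / \<tau>"]
      unfolding q_def by linarith
  qed
  have C: "0 \<le> C"
    using bd[of 0] by linarith
  have gq_bound: "\<bar>g t * q t ^ n\<bar> \<le> C * 3 ^ n" for t n
    unfolding abs_mult power_abs using bd q_abs C by (intro mult_mono power_mono) auto
  have gq_int: "integrable U (\<lambda>t. char_fun m t * complex_of_real (g t * q t ^ n))" for m n
    using gq_bound by (intro U.integrable_const_bound[where B="C * 3 ^ n"]) (auto simp: norm_mult simp del: of_real_mult)
  define k where "k = 1 - cos (pi * \<delta> / \<tau>)"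
  \<comment> \<open>Only the characters -1, 0 and 1 occur in \<open>q\<close>.\<close>
  have q_char: "complex_of_real (q t) = of_real k
      + (char_fun 1 (- \<delta> / 2) / 2) * char_fun 1 t + (char_fun (- 1) (- \<delta> / 2) / 2) * char_fun (- 1) t" for t
  proof -
    have "char_fun 1 (t + - \<delta> / 2) = cis (2 * pi * (t - \<delta> / 2) / \<tau>)"
      by (simp add: char_fun_def freq_def cis_conv_exp diff_divide_distrib right_diff_distrib mult_ac)
    moreover have "char_fun (- 1) (t + - \<delta> / 2) = cis (- (2 * pi * (t - \<delta> / 2) / \<tau>))"
      by (simp add: char_fun_def freq_def cis_conv_exp diff_divide_distrib right_diff_distrib mult_ac)
    ultimately have "char_fun 1 (t + - \<delta> / 2) + char_fun (- 1) (t + - \<delta> / 2)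
        = 2 * complex_of_real (cos (2 * pi * (t - \<delta> / 2) / \<tau>))"
      by (simp add: complex_eq_iff)
    then have "complex_of_real (cos (2 * pi * (t - \<delta> / 2) / \<tau>)) =
        (char_fun 1 t * char_fun 1 (- \<delta> / 2) + char_fun (- 1) t * char_fun (- 1) (- \<delta> / 2)) / 2"
      unfolding char_fun_add by simp
    moreover have "complex_of_real (q t) = of_real k + complex_of_real (cos (2 * pi * (t - \<delta> / 2) / \<tau>))"
      by (simp add: q_def k_def)
    ultimately show ?thesis
      by (simp add: add_divide_distrib mult.commute)
  qed
  \<comment> \<open>Each factor \<open>q\<close> moves the frequency by at most 1, so the induction
    has to treat all frequencies at once.\<close>
  have zero: "(\<integral>t. char_fun m t * complex_of_real (g t * q t ^ n) \<partial>U) = 0" for m n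
  proof (induction n arbitrary: m)
    case 0
    show ?case using orth by simp
  next
    case (Suc n)
    let ?\<alpha> = "char_fun 1 (- \<delta> / 2) / 2" and ?\<beta> = "char_fun (- 1) (- \<delta> / 2) / 2"
    let ?h = "\<lambda>m t. char_fun m t * complex_of_real (g t * q t ^ n)"
    have "char_fun m t * complex_of_real (g t * q t ^ Suc n) =
        of_real k * ?h m t + ?\<alpha> * ?h (m + 1) t + ?\<beta> * ?h (m + - 1) t" for t
    proof -
      have "char_fun m t * complex_of_real (g t * q t ^ Suc n) = ?h m t * complex_of_real (q t)"
        by (simp add: mult_ac)
      also have "\<dots> = of_real k * ?h m t + ?\<alpha> * ?h (m + 1) t + ?\<beta> * ?h (m + - 1) t"
        unfolding q_char char_fun_mult[symmetric] by (simp only: ring_distribs mult_ac)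
      finally show ?thesis .
    qed
    then have "(\<integral>t. char_fun m t * complex_of_real (g t * q t ^ Suc n) \<partial>U) =
        (\<integral>t. of_real k * ?h m t + ?\<alpha> * ?h (m + 1) t + ?\<beta> * ?h (m + - 1) t \<partial>U)"
      by (simp only:)
    also have "\<dots> = of_real k * (\<integral>t. ?h m t \<partial>U) + ?\<alpha> * (\<integral>t. ?h (m + 1) t \<partial>U) + ?\<beta> * (\<integral>t. ?h (m + - 1) t \<partial>U)"
      using gq_int[of _ n]
      by (simp only: Bochner_Integration.integral_add integral_mult_right_zero Bochner_Integration.integrable_add integrable_mult_right)
    finally show ?case
      by (simp only: Suc) simp
  qed
  have gq_int': "integrable U (\<lambda>t. g t * q t ^ n)" for n
    using gq_bound by (intro U.integrable_const_bound[where B="C * 3 ^ n"]) auto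
  have zero': "(\<integral>t. g t * q t ^ n \<partial>U) = 0" for n
  proof -
    have "complex_of_real (\<integral>t. g t * q t ^ n \<partial>U) = (\<integral>t. complex_of_real (g t * q t ^ n) \<partial>U)"
      by (rule integral_complex_of_real[symmetric])
    also have "\<dots> = 0"
      using zero[of 0 n] by simp
    finally show ?thesis by simp
  qed
  define p where "p = measure U {\<delta> / 4..3 * \<delta> / 4}"
  have p: "0 < p"
  proof -
    have "p = measure lborel ({0..\<tau>} \<inter> {\<delta> / 4..3 * \<delta> / 4}) / measure lborel {0..\<tau>}"
      unfolding p_def using period_pos by (intro measure_uniform_measure) auto
    also have "{0..\<tau>} \<inter> {\<delta> / 4..3 * \<delta> / 4} = {\<delta> / 4..3 * \<delta> / 4}"
      using \<delta> by auto
    finally show ?thesis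
      using \<delta> period_pos by simp
  qed
  \<comment> \<open>The integrand is at least \<epsilon> r^n on the middle half, nonnegative on the
    rest of [0, \<delta>) and at least - \<open>C\<close> elsewhere; subtracting \<open>C\<close>
    everywhere covers all three cases.\<close>
  have lower: "\<epsilon> * r ^ n * p - C \<le> 0" for n
  proof -
    have ind: "integrable U (indicator {\<delta> / 4..3 * \<delta> / 4} :: real \<Rightarrow> real)"
      by (auto intro!: U.integrable_const_bound[where B=1] split: split_indicator)
    have "\<epsilon> * r ^ n * p - C = (\<integral>t. \<epsilon> * r ^ n * indicator {\<delta> / 4..3 * \<delta> / 4} t - C \<partial>U)"
      using ind U.prob_space by (simp add: p_def)
    also have "\<dots> \<le> (\<integral>t. g t * q t ^ n \<partial>U)"
    proof (rule integral_mono_AE)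
      show "AE t in U. \<epsilon> * r ^ n * indicator {\<delta> / 4..3 * \<delta> / 4} t - C \<le> g t * q t ^ n"
        using AE_U_bounds
      proof eventually_elim
        case (elim t)
        show ?case
        proof (cases "t < \<delta>")
          case True
          \<comment> \<open>The point 0 lies outside the right neighbourhood given by the limit and
            uses \<epsilon> < \<open>g 0\<close> directly.\<close>
          have g: "\<epsilon> \<le> g t"
            using b(2)[of t] True elim \<delta> \<epsilon> by (cases "t = 0") (auto intro: less_imp_le)
          show ?thesis
          proof (cases "t \<in> {\<delta> / 4..3 * \<delta> / 4}")
            case True
            have "\<epsilon> * r ^ n \<le> g t * q t ^ n"
              using g qr[of t] True \<epsilon> r by (intro mult_mono power_mono) auto
            with True C show ?thesis by simp
          next
            case False
            have "0 \<le> g t * q t ^ n"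
              using g \<epsilon> q1[of t] True elim by (intro mult_nonneg_nonneg zero_le_power) auto
            with False C show ?thesis by simp
          qed
        next
          case False
          have "\<bar>g t * q t ^ n\<bar> \<le> C * 1 ^ n"
            unfolding abs_mult power_abs using bd q2[of t] False elim C by (intro mult_mono power_mono) auto
          moreover have "t \<notin> {\<delta> / 4..3 * \<delta> / 4}"
            using False \<delta> by auto
          ultimately show ?thesis by simp
        qed
      qed
    qed (use ind gq_int' in auto)
    finally show ?thesis
      using zero' by simp
  qed
  obtain n where "C / (\<epsilon> * p) < r ^ n"
    using real_arch_pow[OF r] by blast
  then have "C < \<epsilon> * r ^ n * p"
    using \<epsilon> p by (simp add: pos_divide_less_eq mult_ac)
  with lower[of n] show False
    by simp
qed

text \<open>Translating \<open>a\<close> to 0 multiplies the Fourier integrals by unimodular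
  numbers, and the two signs of \<open>g\<close> give the two inequalities. Right-continuity yields
  vanishing at the given point, not merely almost everywhere.\<close>

lemma fourier_zero:
  fixes g :: "real \<Rightarrow> real"
  assumes meas [measurable]: "g \<in> borel_measurable borel" and bd: "\<And>t. \<bar>g t\<bar> \<le> C"
    and per: "\<And>t. g (t + \<tau>) = g t" and cont: "(g \<longlongrightarrow> g a) (at_right a)"
    and orth: "\<And>m. (\<integral>t. char_fun m t * complex_of_real (g t) \<partial>U) = 0"
  shows "g a = 0"
proof -
  have cont': "((\<lambda>t. g (t + a)) \<longlongrightarrow> g (0 + a)) (at_right 0)"
    using cont by (simp add: filterlim_at_right_to_0[of _ _ a])
  have orth': "(\<integral>t. char_fun m t * complex_of_real (g (t + a)) \<partial>U) = 0" for m
  proof -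
    have "char_fun m t * complex_of_real (g (t + a)) =
        char_fun (- m) a * (char_fun m (t + a) * complex_of_real (g (t + a)))" for t
      by (simp add: char_fun_add mult_ac)
    then have "(\<integral>t. char_fun m t * complex_of_real (g (t + a)) \<partial>U) =
        (\<integral>t. char_fun (- m) a * (char_fun m (t + a) * complex_of_real (g (t + a))) \<partial>U)"
      by (simp only:)
    also have "\<dots> = char_fun (- m) a * (\<integral>t. char_fun m (t + a) * complex_of_real (g (t + a)) \<partial>U)"
      by simp
    also have "(\<integral>t. char_fun m (t + a) * complex_of_real (g (t + a)) \<partial>U) = (\<integral>t. char_fun m t * complex_of_real (g t) \<partial>U)"
      by (rule integral_U_shift) (auto simp: char_fun_add_period per)
    finally show ?thesis
      by (simp add: orth)
  qed
  have "g (0 + a) \<le> 0"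
    by (rule fourier_nonpos_at_0[where g="\<lambda>t. g (t + a)" and C=C]) (use bd cont' orth' in auto)
  moreover have "- g (0 + a) \<le> 0"
    by (rule fourier_nonpos_at_0[where g="\<lambda>t. - g (t + a)" and C=C]) (use bd tendsto_minus[OF cont'] orth' in auto)
  ultimately show ?thesis
    by simp
qed

text \<open>Translation by \<sigma> multiplies a Fourier coefficient of \<open>mean f\<close> by a
  value of the character, which is 1 wherever the coefficient is nonzero. The difference of
  \<open>mean f\<close> and its translate thus has zero coefficients and, being right-continuous,
  vanishes at every s.\<close>

lemma annihilator_period:
  assumes \<sigma>: "\<And>m. m \<in> spectrum \<Longrightarrow> char_fun m \<sigma> = 1"
  shows "\<rho> (s + \<sigma>) = \<rho> s"
proof (rule prob_algebra_eqI_continuous)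
  fix f :: "'a \<Rightarrow> real" assume f: "continuous_on UNIV f" "\<And>x. \<bar>f x\<bar> \<le> 1"
  have f_meas [measurable]: "f \<in> borel_measurable borel"
    by (rule borel_measurable_continuous_onI[OF f(1)])
  have mean_bound: "\<bar>mean f t\<bar> \<le> 1" for t
    unfolding mean_def by (rule abs_integral_le(2)[OF \<rho>_in f_meas f(2)])
  have mean_cont: "(mean f \<longlongrightarrow> mean f a) (at_right a)" for a
    unfolding mean_def by (rule \<rho>_right_continuous[OF f])
  have mean_int: "integrable U (\<lambda>t. char_fun m t * complex_of_real (mean f (t + u)))" for m u
    using mean_bound by (intro U.integrable_const_bound[where B=1]) (auto simp: norm_mult)
  define g where "g t = mean f (t + \<sigma>) - mean f t" for t
  have "g s = 0"
  proof (rule fourier_zero[where g=g and a=s and C=2])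
    show "\<bar>g t\<bar> \<le> 2" for t
      using mean_bound[of t] mean_bound[of "t + \<sigma>"] unfolding g_def by linarith
    show "g (t + \<tau>) = g t" for t
      using mean_add_period[of f "t + \<sigma>"] mean_add_period[of f t] by (simp add: g_def add_ac)
    have "((\<lambda>t. mean f (t + \<sigma>)) \<longlongrightarrow> mean f (s + \<sigma>)) (at_right s)"
    proof -
      have "((\<lambda>h. mean f (h + (s + \<sigma>))) \<longlongrightarrow> mean f (s + \<sigma>)) (at_right 0)"
        using mean_cont[of "s + \<sigma>"] by (simp add: filterlim_at_right_to_0[of _ _ "s + \<sigma>"])
      then show ?thesis
        by (subst filterlim_at_right_to_0) (simp add: add.assoc)
    qed
    then show "(g \<longlongrightarrow> g s) (at_right s)"
      unfolding g_def by (intro tendsto_diff mean_cont)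
    fix m
    have "(\<integral>t. char_fun m t * complex_of_real (mean f (t + \<sigma>)) \<partial>U) =
        (\<integral>t. char_fun (- m) \<sigma> * (char_fun m (t + \<sigma>) * complex_of_real (mean f (t + \<sigma>))) \<partial>U)"
    proof -
      have "char_fun m t * complex_of_real (mean f (t + \<sigma>)) =
          char_fun (- m) \<sigma> * (char_fun m (t + \<sigma>) * complex_of_real (mean f (t + \<sigma>)))" for t
        by (simp add: char_fun_add mult_ac)
      then show ?thesis
        by (simp only:)
    qed
    also have "\<dots> = char_fun (- m) \<sigma> * (\<integral>t. char_fun m (t + \<sigma>) * complex_of_real (mean f (t + \<sigma>)) \<partial>U)"
      by simp
    also have "(\<integral>t. char_fun m (t + \<sigma>) * complex_of_real (mean f (t + \<sigma>)) \<partial>U) = fourier_coeff (mean f) (- m)"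
      unfolding fourier_coeff_def minus_minus by (rule integral_U_shift) (auto simp: char_fun_add_period mean_add_period)
    \<comment> \<open>Either the coefficient vanishes, or \<open>- m\<close> is in the spectrum and
      the factor is 1. The sign arises because the integral pairs with \<open>char_fun m\<close> and
      \<open>fourier_coeff\<close> with the inverse character.\<close>
    also have "char_fun (- m) \<sigma> * fourier_coeff (mean f) (- m) = fourier_coeff (mean f) (- m)"
      using fourier_coeff_spectrum[OF f, of "- m"] \<sigma>[of "- m"] by (cases "- m \<in> spectrum") auto
    finally have "(\<integral>t. char_fun m t * complex_of_real (mean f (t + \<sigma>)) \<partial>U) = (\<integral>t. char_fun m t * complex_of_real (mean f t) \<partial>U)"
      by (simp add: fourier_coeff_def)
    then show "(\<integral>t. char_fun m t * complex_of_real (g t) \<partial>U) = 0"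
      using mean_int[of m \<sigma>] mean_int[of m 0] by (simp add: g_def right_diff_distrib)
    show "g \<in> borel_measurable borel"
      unfolding g_def by measurable
  qed
  then show "(\<integral>x. f x \<partial>\<rho> (s + \<sigma>)) = (\<integral>x. f x \<partial>\<rho> s)"
    by (simp add: g_def mean_def)
qed simp_all


section \<open>Periods and eigenvalues\<close>

text \<open>Without a sign condition on \<sigma>, so that differences of periods, which may be zero
  or negative, are covered.\<close>

definition is_period :: "real \<Rightarrow> bool" where
  "is_period \<sigma> \<longleftrightarrow> (\<forall>s. \<rho> (s + \<sigma>) = \<rho> s)"

lemma periodic_measure_iff: "periodic_measure P \<sigma> \<rho> \<longleftrightarrow> 0 < \<sigma> \<and> is_period \<sigma>"
  using periodic by (auto simp: periodic_measure_def is_period_def)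

lemma minimum_period_iff:
  "minimum_period P \<rho> \<sigma> \<longleftrightarrow> 0 < \<sigma> \<and> is_period \<sigma> \<and> (\<forall>\<sigma>'. 0 < \<sigma>' \<longrightarrow> is_period \<sigma>' \<longrightarrow> \<sigma> \<le> \<sigma>')"
  by (auto simp: minimum_period_def periodic_measure_iff)

lemma is_period_\<tau>: "is_period \<tau>"
  by (simp add: is_period_def \<rho>_add_period)

lemma is_period_diff_multiple:
  assumes "is_period \<sigma>" "is_period \<sigma>'"
  shows "is_period (\<sigma>' - real n * \<sigma>)"
proof (induction n)
  case (Suc n)
  show ?case
    unfolding is_period_def
  proof
    fix s
    have "\<rho> (s + (\<sigma>' - real (Suc n) * \<sigma>)) = \<rho> (s + (\<sigma>' - real (Suc n) * \<sigma>) + \<sigma>)"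
      using assms(1) by (simp add: is_period_def)
    also have "s + (\<sigma>' - real (Suc n) * \<sigma>) + \<sigma> = s + (\<sigma>' - real n * \<sigma>)"
      by (simp add: algebra_simps)
    finally show "\<rho> (s + (\<sigma>' - real (Suc n) * \<sigma>)) = \<rho> s"
      using Suc by (simp add: is_period_def)
  qed
qed (use assms in simp)

text \<open>Division with remainder: the remainder of \<tau> modulo \<sigma> is a period below
  \<sigma>, so it is 0.\<close>

lemma minimum_period_divides:
  assumes "minimum_period P \<rho> \<sigma>"
  obtains k :: nat where "k \<noteq> 0" "\<sigma> = \<tau> / real k"
proof -
  have \<sigma>: "0 < \<sigma>" "is_period \<sigma>" and min: "\<And>\<sigma>'. 0 < \<sigma>' \<Longrightarrow> is_period \<sigma>' \<Longrightarrow> \<sigma> \<le> \<sigma>'"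
    using assms by (auto simp: minimum_period_iff)
  define k where "k = nat \<lfloor>\<tau> / \<sigma>\<rfloor>"
  have "real k = of_int \<lfloor>\<tau> / \<sigma>\<rfloor>"
    using \<sigma> period_pos by (simp add: k_def)
  then have k: "real k * \<sigma> \<le> \<tau>" "\<tau> < (real k + 1) * \<sigma>"
    using floor_divide_lower[OF \<sigma>(1), of \<tau>] floor_divide_upper[OF \<sigma>(1), of \<tau>] by simp_all
  have "\<tau> - real k * \<sigma> = 0"
  proof (rule ccontr)
    assume "\<tau> - real k * \<sigma> \<noteq> 0"
    then have "\<sigma> \<le> \<tau> - real k * \<sigma>"
      using k by (intro min is_period_diff_multiple \<sigma> is_period_\<tau>) simp
    with k show False
      by (simp add: algebra_simps)
  qed
  then have "\<tau> = real k * \<sigma>"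
    by simp
  moreover from this have "k \<noteq> 0"
    using period_pos by (intro notI) simp
  ultimately show ?thesis
    using that by simp
qed

section \<open>The spectrum as a subgroup of the integers\<close>

lemma spectrum_mult:
  assumes "l \<in> spectrum"
  shows "l * m \<in> spectrum"
proof -
  have nat: "l * int n \<in> spectrum" for n
    by (induction n) (auto simp: spectrum_0 algebra_simps intro: spectrum_add assms)
  show ?thesis
  proof (cases "0 \<le> m")
    case True
    then show ?thesis
      using nat[of "nat m"] by simp
  next
    case False
    then show ?thesis
      using spectrum_minus[OF nat[of "nat (- m)"]] by simp
  qed
qed

text \<open>The least positive element generates, since remainders modulo it stay in the subgroup
  and are smaller.\<close>

lemma spectrum_generator:
  assumes "m \<in> spectrum" "m \<noteq> 0"
  obtains l :: nat where "l \<noteq> 0" "int l \<in> spectrum" "\<And>n. n \<in> spectrum \<Longrightarrow> int l dvd n"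
proof -
  define l where "l = (LEAST l::nat. l \<noteq> 0 \<and> int l \<in> spectrum)"
  have "\<bar>m\<bar> \<in> spectrum"
    using assms spectrum_minus by (simp add: abs_if)
  then have ex: "nat \<bar>m\<bar> \<noteq> 0 \<and> int (nat \<bar>m\<bar>) \<in> spectrum"
    using assms by simp
  have l: "l \<noteq> 0 \<and> int l \<in> spectrum"
    unfolding l_def by (rule LeastI[of _ "nat \<bar>m\<bar>"]) (rule ex)
  have "int l dvd n" if n: "n \<in> spectrum" for n
  proof (rule ccontr)
    assume nd: "\<not> int l dvd n"
    have "0 < int l"
      using l by simp
    then have "0 \<le> n mod int l" "n mod int l < int l"
      by (rule pos_mod_sign, rule pos_mod_bound)
    moreover have "n mod int l \<noteq> 0"
      using nd mod_0_imp_dvd by blast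
    ultimately have pos: "0 < n mod int l" "n mod int l < int l"
      by linarith+
    have "n + int l * - (n div int l) \<in> spectrum"
      using n l by (intro spectrum_add spectrum_mult) auto
    then have "n mod int l \<in> spectrum"
      by (simp add: minus_mult_div_eq_mod[symmetric])
    then have "nat (n mod int l) \<noteq> 0 \<and> int (nat (n mod int l)) \<in> spectrum"
      using pos by simp
    from Least_le[of "\<lambda>l. l \<noteq> 0 \<and> int l \<in> spectrum", OF this]
    have "l \<le> nat (n mod int l)"
      unfolding l_def[symmetric] .
    with pos show False
      by linarith
  qed
  with l that show ?thesis
    by blast
qed

text \<open>The period \<tau> / k forces k to divide every frequency. Conversely, if l generates the
  spectrum then \<tau> / l is a period, so minimality gives l \<le> k; together with k dvd l this
  yields l = k.\<close>

lemma spectrum_of_minimum_period: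
  assumes min: "minimum_period P \<rho> (\<tau> / real k)" and k: "k \<noteq> 0"
  shows "m \<in> spectrum \<longleftrightarrow> int k dvd m"
proof -
  have per: "is_period (\<tau> / real k)" and least: "\<And>\<sigma>'. 0 < \<sigma>' \<Longrightarrow> is_period \<sigma>' \<Longrightarrow> \<tau> / real k \<le> \<sigma>'"
    using min by (auto simp: minimum_period_iff)
  have dvd: "int k dvd m" if m: "m \<in> spectrum" for m
  proof -
    have "of_int m * (\<tau> / real k) / \<tau> \<in> \<int>"
      using per by (intro spectrum_period[OF m]) (simp add: is_period_def)
    then have "real_of_int m / real_of_int (int k) \<in> \<int>"
      using period_pos by simp
    then obtain n :: int where "real_of_int m / real_of_int (int k) = of_int n"
      by (auto elim: Ints_cases)
    then have "real_of_int m = real_of_int (int k * n)"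
      using k by (simp add: field_simps)
    then have "m = int k * n"
      by (simp only: of_int_eq_iff)
    then show ?thesis by simp
  qed
  have "int k \<in> spectrum"
  proof (cases "spectrum \<subseteq> {0}")
    case True
    \<comment> \<open>If 0 is the only frequency, every real number is a period, in particular one
      below the supposed minimum.\<close>
    have "is_period (\<tau> / (2 * real k))"
      unfolding is_period_def using True by (intro allI annihilator_period) auto
    then have "\<tau> / real k \<le> \<tau> / (2 * real k)"
      using k period_pos by (intro least) auto
    then show ?thesis
      using k period_pos by (simp add: field_simps)
  next
    case False
    then obtain m0 where "m0 \<in> spectrum" "m0 \<noteq> 0"
      by auto
    then obtain l where l: "l \<noteq> 0" "int l \<in> spectrum" "\<And>n. n \<in> spectrum \<Longrightarrow> int l dvd n"
      by (rule spectrum_generator) blast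
    have "char_fun n (\<tau> / real l) = 1" if n: "n \<in> spectrum" for n
    proof -
      obtain j where "n = int l * j"
        using l(3)[OF n] by (auto elim: dvdE)
      then have "of_int n * (\<tau> / real l) / \<tau> = of_int j"
        using l(1) period_pos by simp
      then show ?thesis
        by (simp add: char_fun_eq_1_iff)
    qed
    then have "is_period (\<tau> / real l)"
      unfolding is_period_def by (intro allI annihilator_period)
    then have "\<tau> / real k \<le> \<tau> / real l"
      using l(1) period_pos by (intro least) auto
    then have "l \<le> k"
      using k l(1) period_pos by (simp add: field_simps)
    moreover have "k \<le> l"
      using dvd[OF l(2)] l(1) by (auto dest: dvd_imp_le)
    ultimately show ?thesis
      using l(2) by simp
  qed
  then show ?thesis
    using dvd spectrum_mult by (auto elim!: dvdE)
qed

text \<open>A nonzero frequency m confines all periods to multiples of \<tau> / |m|. Well-ordering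
  of the positive multiples, among which \<tau> itself occurs, would then give a minimum
  period.\<close>

lemma no_minimum_period_spectrum:
  assumes none: "\<nexists>\<sigma>. minimum_period P \<rho> \<sigma>" and m: "m \<in> spectrum"
  shows "m = 0"
proof (rule ccontr)
  assume m0: "m \<noteq> 0"
  define M where "M = nat \<bar>m\<bar>"
  have M: "0 < M" "real M = \<bar>of_int m\<bar>"
    using m0 by (auto simp: M_def)
  define Q where "Q n \<longleftrightarrow> 0 < n \<and> is_period (real n * \<tau> / real M)" for n :: nat
  define n0 where "n0 = (LEAST n. Q n)"
  have "Q M"
    using M is_period_\<tau> by (simp add: Q_def)
  then have Q0: "Q n0"
    unfolding n0_def by (rule LeastI)
  have "minimum_period P \<rho> (real n0 * \<tau> / real M)"
    unfolding minimum_period_iff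
  proof (intro conjI allI impI)
    show "0 < real n0 * \<tau> / real M" "is_period (real n0 * \<tau> / real M)"
      using Q0 M(1) period_pos by (auto simp: Q_def)
    fix \<sigma> :: real assume \<sigma>: "0 < \<sigma>" "is_period \<sigma>"
    have "of_int m * \<sigma> / \<tau> \<in> \<int>"
      using \<sigma>(2) by (intro spectrum_period[OF m]) (simp add: is_period_def)
    then have "\<bar>of_int m * \<sigma> / \<tau>\<bar> \<in> \<int>"
      by (rule Ints_abs)
    then have "real M * \<sigma> / \<tau> \<in> \<int>"
      using \<sigma>(1) period_pos by (simp add: abs_mult M(2))
    then obtain j :: int where j: "real M * \<sigma> / \<tau> = of_int j"
      by (auto elim: Ints_cases)
    have "0 < real M * \<sigma> / \<tau>"
      using M(1) \<sigma>(1) period_pos by simp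
    then have jpos: "0 < j"
      by (simp add: j)
    have \<sigma>_eq: "\<sigma> = real (nat j) * \<tau> / real M"
      using j jpos M(1) period_pos by (simp add: field_simps)
    have "Q (nat j)"
      unfolding Q_def using \<sigma>(2) jpos unfolding \<sigma>_eq by simp
    then have "n0 \<le> nat j"
      unfolding n0_def by (rule Least_le)
    then show "real n0 * \<tau> / real M \<le> \<sigma>"
      unfolding \<sigma>_eq using period_pos by (intro divide_right_mono mult_right_mono) auto
  qed
  with none show False
    by blast
qed

section \<open>Translation into eigenvalues\<close>

lemma freq_multiple: "complex_of_real (2 * real l * of_int m * pi / \<tau>) * \<i> = freq (int l * m)"
  by (simp add: freq_def mult_ac)

lemma freq_eq_0_iff: "freq m = 0 \<longleftrightarrow> m = 0"
  using freq_inj[of m 0] by (simp add: freq_def)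

lemma simple_eigenvalue_freq_spectrum:
  assumes "simple_eigenvalue P \<rho>bar (freq m)"
  shows "m \<in> spectrum"
proof -
  have "eigenvalue P \<rho>bar (freq m)"
    using assms unfolding simple_eigenvalue_def eigenvalue_def by blast
  then obtain n where "n \<in> spectrum" "freq m = freq n"
    by (rule eigenvalue_imp_spectrum) auto
  then show ?thesis
    by (simp add: freq_inj)
qed

text \<open>Forward, l = k. Backward, the nonzero frequency l excludes the absence of a minimum
  period, and every minimum period is \<tau> divided by a positive integer.\<close>

lemma minimum_period_iff_eigenvalues:
  "(\<exists>k::nat. k \<noteq> 0 \<and> minimum_period P \<rho> (\<tau> / real k)) \<longleftrightarrow>
   (\<exists>l::nat. l \<noteq> 0 \<and>
      (\<forall>m::int. simple_eigenvalue P \<rho>bar (freq (int l * m))) \<and>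
      (\<forall>z. Re z = 0 \<and> eigenvalue P \<rho>bar z \<longrightarrow> (\<exists>m::int. z = freq (int l * m))))"
proof
  assume "\<exists>k::nat. k \<noteq> 0 \<and> minimum_period P \<rho> (\<tau> / real k)"
  then obtain k :: nat where k: "k \<noteq> 0" "minimum_period P \<rho> (\<tau> / real k)"
    by blast
  note spec = spectrum_of_minimum_period[OF k(2,1)]
  show "\<exists>l::nat. l \<noteq> 0 \<and>
      (\<forall>m::int. simple_eigenvalue P \<rho>bar (freq (int l * m))) \<and>
      (\<forall>z. Re z = 0 \<and> eigenvalue P \<rho>bar z \<longrightarrow> (\<exists>m::int. z = freq (int l * m)))"
  proof (intro exI[of _ k] conjI allI impI)
    show "simple_eigenvalue P \<rho>bar (freq (int k * m))" for m
      by (rule spectrum_simple) (simp add: spec)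
    fix z assume "Re z = 0 \<and> eigenvalue P \<rho>bar z"
    then obtain n where "n \<in> spectrum" "z = freq n"
      using eigenvalue_imp_spectrum[of z] by blast
    then show "\<exists>m. z = freq (int k * m)"
      by (auto simp: spec elim!: dvdE)
  qed (rule k(1))
next
  assume "\<exists>l::nat. l \<noteq> 0 \<and>
      (\<forall>m::int. simple_eigenvalue P \<rho>bar (freq (int l * m))) \<and>
      (\<forall>z. Re z = 0 \<and> eigenvalue P \<rho>bar z \<longrightarrow> (\<exists>m::int. z = freq (int l * m)))"
  then obtain l :: nat where "l \<noteq> 0" "simple_eigenvalue P \<rho>bar (freq (int l * 1))"
    by blast
  then have "int l \<in> spectrum" "int l \<noteq> 0"
    using simple_eigenvalue_freq_spectrum[of "int l * 1"] by simp_all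
  then obtain \<sigma> where "minimum_period P \<rho> \<sigma>"
    using no_minimum_period_spectrum by blast
  then show "\<exists>k::nat. k \<noteq> 0 \<and> minimum_period P \<rho> (\<tau> / real k)"
    using minimum_period_divides by metis
qed

text \<open>For the converse, a minimum period \<tau> / k would put k into the spectrum and so
  produce a nonzero imaginary eigenvalue.\<close>

lemma no_minimum_period_iff_eigenvalues:
  "(\<nexists>\<sigma>. minimum_period P \<rho> \<sigma>) \<longleftrightarrow>
   simple_eigenvalue P \<rho>bar 0 \<and> (\<forall>z. Re z = 0 \<and> eigenvalue P \<rho>bar z \<longrightarrow> z = 0)"
proof
  assume none: "\<nexists>\<sigma>. minimum_period P \<rho> \<sigma>"
  show "simple_eigenvalue P \<rho>bar 0 \<and> (\<forall>z. Re z = 0 \<and> eigenvalue P \<rho>bar z \<longrightarrow> z = 0)"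
  proof (intro conjI allI impI)
    show "simple_eigenvalue P \<rho>bar 0"
      using spectrum_simple[OF spectrum_0] freq_eq_0_iff[of 0] by simp
    fix z assume "Re z = 0 \<and> eigenvalue P \<rho>bar z"
    then obtain n where "n \<in> spectrum" "z = freq n"
      using eigenvalue_imp_spectrum[of z] by blast
    then show "z = 0"
      using no_minimum_period_spectrum[OF none] by (simp add: freq_eq_0_iff)
  qed
next
  assume *: "simple_eigenvalue P \<rho>bar 0 \<and> (\<forall>z. Re z = 0 \<and> eigenvalue P \<rho>bar z \<longrightarrow> z = 0)"
  show "\<nexists>\<sigma>. minimum_period P \<rho> \<sigma>"
  proof
    assume "\<exists>\<sigma>. minimum_period P \<rho> \<sigma>"
    then obtain \<sigma> where \<sigma>: "minimum_period P \<rho> \<sigma>"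
      by blast
    then obtain k :: nat where k: "k \<noteq> 0" "\<sigma> = \<tau> / real k"
      by (rule minimum_period_divides)
    have "int k \<in> spectrum"
      using spectrum_of_minimum_period[of k "int k"] \<sigma> k by simp
    then have "eigenvalue P \<rho>bar (freq (int k))"
      using spectrum_simple unfolding simple_eigenvalue_def eigenvalue_def by blast
    then have "freq (int k) = 0"
      using * Re_freq by blast
    with k(1) show False
      by (simp add: freq_eq_0_iff)
  qed
qed

end

theorem theorem5p5:
  fixes P :: "real \<Rightarrow> 'a::polish_space \<Rightarrow> 'a measure"
    and \<rho> :: "real \<Rightarrow> 'a measure"
    and \<tau> :: real
  assumes "markov_semigroup P"
    and "stochastically_continuous P"
    and "periodic_measure P \<tau> \<rho>"
    and "PS_mixing P \<tau> \<rho>"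
  shows "((\<exists>k::nat. k \<noteq> 0 \<and> minimum_period P \<rho> (\<tau> / real k)) \<longleftrightarrow>
          (\<exists>l::nat. l \<noteq> 0 \<and>
             (\<forall>m::int. simple_eigenvalue P (average_measure \<tau> \<rho>)
                (complex_of_real (2 * real l * of_int m * pi / \<tau>) * \<i>)) \<and>
             (\<forall>z. Re z = 0 \<and> eigenvalue P (average_measure \<tau> \<rho>) z \<longrightarrow>
                (\<exists>m::int. z = complex_of_real (2 * real l * of_int m * pi / \<tau>) * \<i>))))
       \<and> ((\<nexists>\<sigma>. minimum_period P \<rho> \<sigma>) \<longleftrightarrow>
          (simple_eigenvalue P (average_measure \<tau> \<rho>) 0 \<and>
             (\<forall>z. Re z = 0 \<and> eigenvalue P (average_measure \<tau> \<rho>) z \<longrightarrow> z = 0)))"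
proof -
  interpret mixing_chain \<tau> P \<rho>
    using assms by unfold_locales (auto simp: periodic_measure_def)
  show ?thesis
    unfolding freq_multiple
    using minimum_period_iff_eigenvalues no_minimum_period_iff_eigenvalues by (rule conjI)
qed

end
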